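(* Let $m\ge2$ and $k\in\{1,\dots,m-1\}$ be integers. For every real $\alpha<1/2$ there is a constant $C$ (independent of $\varphi$) such that $$\int_Y\exp(-\alpha\varphi)\,d\hat v\le C$$ for every $\hat g$-admissible, $G$-invariant function $\varphi\in C^\infty(Y)$ satisfying $\sup_Y\varphi=0$.
   Context: $Y$ is the blow-up of $\mathbb{P}_m\mathbb{C}$ along $\{[z_0,\dots,z_k,0,\dots,0]\}\cong\mathbb{P}_k\mathbb{C}$ and $\{[0,\dots,0,z_{k+1},\dots,z_m]\}\cong\mathbb{P}_{m-k-1}\mathbb{C}$, realised as the submanifold of $\mathbb{P}_m\mathbb{C}\times\mathbb{P}_k\mathbb{C}\times\mathbb{P}_{m-k-1}\mathbb{C}$ of points $([z_0,\dots,z_m],[\zeta_0,\dots,\zeta_k],[\eta_{k+1},\dots,\eta_m])$ such that $(z_0,\dots,z_k)$ is proportional to $(\zeta_0,\dots,\zeta_k)$ and $(z_{k+1},\dots,z_m)$ is proportional to $(\eta_{k+1},\dots,\eta_m)$. Let $\pi_1,\pi_2,\pi_3$ be the projections of $Y$ to the three factors. Write $\partial_{\lambda\bar\mu}=\frac{\partial^2}{\partial z_\lambda\partial\bar z_\mu}$. Metric: $\hat g=2\pi_1^*g_m+k\,\pi_2^*g_k+(m-k-1)\pi_3^*g_{m-k-1}$, where $g_n$ is the Fubini–Study metric of $\mathbb{P}_n\mathbb{C}$ with components $\partial_{\lambda\bar\mu}\ln(1+|z_1|^2+\dots+|z_n|^2)$ in the chart $z_0=1$. Thus in the dense chart of points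 $([1,z_1,\dots,z_m],[1,z_1,\dots,z_k],[z_{k+1},\dots,z_m])$ with $(z_{k+1},\dots,z_m)\ne0$, $\hat g_{\lambda\bar\mu}=2\partial_{\lambda\bar\mu}\ln(1+|z_1|^2+\dots+|z_m|^2)+k\,\partial_{\lambda\bar\mu}\ln(1+|z_1|^2+\dots+|z_k|^2)+(m-k-1)\partial_{\lambda\bar\mu}\ln(|z_{k+1}|^2+\dots+|z_m|^2)$. $d\hat v$ is the volume element of $\hat g$ on $Y$. A real function $\varphi\in C^\infty(Y)$ is $\hat g$-admissible if the Hermitian matrix $(\hat g_{\lambda\bar\mu}+\partial_{\lambda\bar\mu}\varphi)$ is positive definite at every point of $Y$ (in local holomorphic coordinates). Group: $G$ is the group of automorphisms of $Y$ naturally induced by the automorphisms of $\mathbb{P}_m\mathbb{C}$ exchanging $z_i$ and $z_j$ ($i,j\in\{0,\dots,k\}$), exchanging $z_p$ and $z_q$ ($p,q\in\{k+1,\dots,m\}$), and replacing $z_l$ by $z_le^{i\theta}$ ($l\in\{0,\dots,m\}$, $\theta\in[0,2\pi]$); on $Y$ the coordinates $\zeta_0,\dots,\zeta_k$ and $\eta_{k+1},\dots,\eta_m$ are transformed in the same way as $z_0,\dots,z_k$ and $z_{k+1},\dots,z_m$ respectively. *)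

theory Defs
  imports "HOL-Analysis.Analysis" "HOL-Algebra.Bij" "HOL-Algebra.Generated_Groups"
begin

section \<open>Projective spaces and the blow-up\<close>

text \<open>
  Homogeneous coordinates indexed by a set \<open>I\<close> of naturals are functions vanishing outside \<open>I\<close>.
  Keeping the index sets \<open>{0..m}\<close>, \<open>{0..k}\<close> and \<open>{k+1..m}\<close> lets one coordinate
  transformation act on the three projective spaces at once.
\<close>

type_synonym cvec = "nat \<Rightarrow> complex"

type_synonym triple = "cvec set \<times> cvec set \<times> cvec set"

definition hvec :: "nat set \<Rightarrow> cvec set" where
  "hvec I = {z. (\<exists>j\<in>I. z j \<noteq> 0) \<and> (\<forall>j. j \<notin> I \<longrightarrow> z j = 0)}"

definition proj_pt :: "cvec \<Rightarrow> cvec set" where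
  "proj_pt z = {(\<lambda>j. c * z j) | c. c \<noteq> 0}"

text \<open>The proportionality factors may be zero: that is what happens on the exceptional divisors.\<close>

definition blowup :: "nat \<Rightarrow> nat \<Rightarrow> triple set" where
  "blowup m k = {(proj_pt z, proj_pt \<zeta>, proj_pt \<eta>) | z \<zeta> \<eta>.
     z \<in> hvec {0..m} \<and> \<zeta> \<in> hvec {0..k} \<and> \<eta> \<in> hvec {k+1..m} \<and>
     (\<exists>s. \<forall>j\<in>{0..k}. z j = s * \<zeta> j) \<and> (\<exists>t. \<forall>j\<in>{k+1..m}. z j = t * \<eta> j)}"


section \<open>Holomorphic charts\<close>

text \<open>
  A point of the blow-up has the form \<open>([s \<zeta> + t \<eta>], [\<zeta>], [\<eta>])\<close> with \<open>(s, t) \<noteq> (0, 0)\<close>.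
  The chart \<open>(i, p, r)\<close>, where \<open>i \<le> k < p \<le> m\<close> and \<open>r \<in> {i, p}\<close>, covers the points with
  \<open>\<zeta>\<^sub>i \<noteq> 0\<close>, \<open>\<eta>\<^sub>p \<noteq> 0\<close> and \<open>z\<^sub>r \<noteq> 0\<close>, normalised by \<open>\<zeta>\<^sub>i = \<eta>\<^sub>p = z\<^sub>r = 1\<close>. Its \<open>m\<close> coordinates
  are indexed by \<open>{0..m} - {r}\<close>: they are \<open>\<zeta>\<^sub>j\<close> for \<open>j \<noteq> i\<close>, \<open>\<eta>\<^sub>j\<close> for \<open>j \<noteq> p\<close>, and, at the
  element of \<open>{i, p}\<close> other than \<open>r\<close>, the remaining one of \<open>s = z\<^sub>i\<close> and \<open>t = z\<^sub>p\<close>.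
  The coordinate space is the set of extensional functions, the space of the product measure.
\<close>

type_synonym chart_index = "nat \<times> nat \<times> nat"

definition charts :: "nat \<Rightarrow> nat \<Rightarrow> chart_index set" where
  "charts m k = {(i, p, r). i \<in> {0..k} \<and> p \<in> {k+1..m} \<and> r \<in> {i, p}}"

definition coord_set :: "nat \<Rightarrow> chart_index \<Rightarrow> nat set" where
  "coord_set m = (\<lambda>(i, p, r). {0..m} - {r})"

definition coord_space :: "nat set \<Rightarrow> cvec set" where
  "coord_space I = (I \<rightarrow>\<^sub>E UNIV)"

definition lift_\<zeta> :: "nat \<Rightarrow> nat \<Rightarrow> chart_index \<Rightarrow> cvec \<Rightarrow> cvec" where
  "lift_\<zeta> m k = (\<lambda>(i, p, r) w j. if j \<in> {0..k} then (w(i := 1)) j else 0)"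

definition lift_\<eta> :: "nat \<Rightarrow> nat \<Rightarrow> chart_index \<Rightarrow> cvec \<Rightarrow> cvec" where
  "lift_\<eta> m k = (\<lambda>(i, p, r) w j. if j \<in> {k+1..m} then (w(p := 1)) j else 0)"

definition lift_z :: "nat \<Rightarrow> nat \<Rightarrow> chart_index \<Rightarrow> cvec \<Rightarrow> cvec" where
  "lift_z m k = (\<lambda>(i, p, r) w j.
     (w(r := 1)) i * lift_\<zeta> m k (i, p, r) w j + (w(r := 1)) p * lift_\<eta> m k (i, p, r) w j)"

definition chart :: "nat \<Rightarrow> nat \<Rightarrow> chart_index \<Rightarrow> cvec \<Rightarrow> triple" where
  "chart m k c w =
     (proj_pt (lift_z m k c w), proj_pt (lift_\<zeta> m k c w), proj_pt (lift_\<eta> m k c w))"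


section \<open>Differentiation in coordinates\<close>

text \<open>\<open>partial v j f\<close> is the real partial derivative of \<open>f\<close> in the direction \<open>v\<close> of the complex
  \<open>j\<close>-th coordinate; \<open>v = 1\<close> and \<open>v = \<i>\<close> give the derivatives in the real and imaginary parts.\<close>

definition partial :: "complex \<Rightarrow> nat \<Rightarrow> (cvec \<Rightarrow> 'b::real_normed_vector) \<Rightarrow> cvec \<Rightarrow> 'b" where
  "partial v j f w = vector_derivative (\<lambda>t::real. f (w(j := w j + of_real t * v))) (at 0)"

fun Ck :: "nat \<Rightarrow> nat set \<Rightarrow> (cvec \<Rightarrow> real) \<Rightarrow> bool" where
  "Ck 0 I f \<longleftrightarrow> continuous_on (coord_space I) f"
| "Ck (Suc n) I f \<longleftrightarrow> continuous_on (coord_space I) f \<and>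
     (\<forall>j\<in>I. \<forall>v\<in>{1, \<i>}.
        (\<forall>w\<in>coord_space I. (\<lambda>t::real. f (w(j := w j + of_real t * v))) differentiable (at 0)) \<and>
        Ck n I (partial v j f))"

definition wirtinger :: "nat \<Rightarrow> (cvec \<Rightarrow> complex) \<Rightarrow> cvec \<Rightarrow> complex" where
  "wirtinger j f w = (partial 1 j f w - \<i> * partial \<i> j f w) / 2"

definition wirtinger_bar :: "nat \<Rightarrow> (cvec \<Rightarrow> complex) \<Rightarrow> cvec \<Rightarrow> complex" where
  "wirtinger_bar j f w = (partial 1 j f w + \<i> * partial \<i> j f w) / 2"

definition ddbar :: "(cvec \<Rightarrow> real) \<Rightarrow> cvec \<Rightarrow> nat \<Rightarrow> nat \<Rightarrow> complex" where
  "ddbar f w \<nu> \<mu> = wirtinger \<nu> (wirtinger_bar \<mu> (\<lambda>u. of_real (f u))) w"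

definition smooth_on_blowup :: "nat \<Rightarrow> nat \<Rightarrow> (triple \<Rightarrow> real) \<Rightarrow> bool" where
  "smooth_on_blowup m k \<phi> \<longleftrightarrow>
     (\<forall>c\<in>charts m k. \<forall>n. Ck n (coord_set m c) (\<phi> \<circ> chart m k c))"


section \<open>Metric, admissibility and volume\<close>

text \<open>
  Components of the pull-back of the Fubini-Study metric of the projective space with index
  set \<open>J\<close> under a holomorphic map with homogeneous lift \<open>F\<close>. Each lift used below has a coordinate
  identically equal to \<open>1\<close>, so this is the formula \<open>\<partial>\<partial>\<^sup>- ln (1 + \<Sum>|z\<^sub>j|\<^sup>2)\<close> in the affine chart
  given by that coordinate.
\<close>

definition fubini_study :: "nat set \<Rightarrow> (cvec \<Rightarrow> cvec) \<Rightarrow> cvec \<Rightarrow> nat \<Rightarrow> nat \<Rightarrow> complex" where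
  "fubini_study J F = ddbar (\<lambda>w. ln (\<Sum>j\<in>J. (cmod (F w j))\<^sup>2))"

definition ghat :: "nat \<Rightarrow> nat \<Rightarrow> chart_index \<Rightarrow> cvec \<Rightarrow> nat \<Rightarrow> nat \<Rightarrow> complex" where
  "ghat m k c w \<nu> \<mu> =
     2 * fubini_study {0..m} (lift_z m k c) w \<nu> \<mu>
     + of_nat k * fubini_study {0..k} (lift_\<zeta> m k c) w \<nu> \<mu>
     + of_nat (m - k - 1) * fubini_study {k+1..m} (lift_\<eta> m k c) w \<nu> \<mu>"

definition pos_def_hermitian :: "nat set \<Rightarrow> (nat \<Rightarrow> nat \<Rightarrow> complex) \<Rightarrow> bool" where
  "pos_def_hermitian I A \<longleftrightarrow>
     (\<forall>\<nu>\<in>I. \<forall>\<mu>\<in>I. A \<mu> \<nu> = cnj (A \<nu> \<mu>)) \<and>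
     (\<forall>v. (\<exists>\<nu>\<in>I. v \<nu> \<noteq> 0) \<longrightarrow> 0 < Re (\<Sum>\<nu>\<in>I. \<Sum>\<mu>\<in>I. A \<nu> \<mu> * v \<nu> * cnj (v \<mu>)))"

definition admissible :: "nat \<Rightarrow> nat \<Rightarrow> (triple \<Rightarrow> real) \<Rightarrow> bool" where
  "admissible m k \<phi> \<longleftrightarrow>
     (\<forall>c\<in>charts m k. \<forall>w\<in>coord_space (coord_set m c).
        pos_def_hermitian (coord_set m c)
          (\<lambda>\<nu> \<mu>. ghat m k c w \<nu> \<mu> + ddbar (\<phi> \<circ> chart m k c) w \<nu> \<mu>))"

definition det_on :: "nat set \<Rightarrow> (nat \<Rightarrow> nat \<Rightarrow> complex) \<Rightarrow> complex" where
  "det_on I A = (\<Sum>\<sigma> | \<sigma> permutes I. of_int (sign \<sigma>) * (\<Prod>i\<in>I. A i (\<sigma> i)))"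

definition chart_multiplicity :: "nat \<Rightarrow> nat \<Rightarrow> triple \<Rightarrow> nat" where
  "chart_multiplicity m k y =
     card {c \<in> charts m k. y \<in> chart m k c ` coord_space (coord_set m c)}"

text \<open>
  In each chart the volume element is the determinant of the metric times Lebesgue measure,
  as for the Riemannian metric \<open>Re (\<Sum> g\<^sub>\<nu>\<^sub>\<mu> dz\<^sub>\<nu> dz\<^sub>\<mu>\<^sup>-)\<close>; other normalisations differ by a
  constant factor depending on \<open>m\<close> only. These local measures agree on overlaps and
  are glued with the Borel partition of unity that gives every chart containing \<open>y\<close> the weight
  \<open>1 / chart_multiplicity m k y\<close>.
\<close>

definition blowup_volume :: "nat \<Rightarrow> nat \<Rightarrow> triple measure" where
  "blowup_volume m k = measure_of (blowup m k)
     {A. A \<subseteq> blowup m k \<and> (\<forall>c\<in>charts m k.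
        chart m k c -` A \<inter> coord_space (coord_set m c)
          \<in> sets (Pi\<^sub>M (coord_set m c) (\<lambda>_. lborel)))}
     (\<lambda>A. \<Sum>c\<in>charts m k. \<integral>\<^sup>+ w.
        indicator A (chart m k c w)
          * ennreal (Re (det_on (coord_set m c) (ghat m k c w))
                       / real (chart_multiplicity m k (chart m k c w)))
        \<partial>(Pi\<^sub>M (coord_set m c) (\<lambda>_. lborel)))"


section \<open>The symmetry group\<close>

inductive_set generators :: "nat \<Rightarrow> nat \<Rightarrow> (cvec \<Rightarrow> cvec) set" for m k :: nat where
  swap_low: "i \<in> {0..k} \<Longrightarrow> j \<in> {0..k} \<Longrightarrow>
     (\<lambda>z. z \<circ> Transposition.transpose i j) \<in> generators m k"
| swap_high: "p \<in> {k+1..m} \<Longrightarrow> q \<in> {k+1..m} \<Longrightarrow>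
     (\<lambda>z. z \<circ> Transposition.transpose p q) \<in> generators m k"
| phase: "l \<in> {0..m} \<Longrightarrow> \<theta> \<in> {0..2 * pi} \<Longrightarrow>
     (\<lambda>z. z(l := z l * cis \<theta>)) \<in> generators m k"

definition induced :: "(cvec \<Rightarrow> cvec) \<Rightarrow> triple \<Rightarrow> triple" where
  "induced g = (\<lambda>(P, Q, R). (g ` P, g ` Q, g ` R))"

definition symmetry_group :: "nat \<Rightarrow> nat \<Rightarrow> (triple \<Rightarrow> triple) set" where
  "symmetry_group m k =
     generate (BijGroup (blowup m k)) ((\<lambda>g. restrict (induced g) (blowup m k)) ` generators m k)"

definition G_invariant :: "nat \<Rightarrow> nat \<Rightarrow> (triple \<Rightarrow> real) \<Rightarrow> bool" where
  "G_invariant m k \<phi> \<longleftrightarrow> (\<forall>g\<in>symmetry_group m k. \<forall>y\<in>blowup m k. \<phi> (g y) = \<phi> y)"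

end

theory Submission
  imports Defs
begin

text \<open>
  Write \<open>l = m - k - 1\<close>. On the dense torus of points whose homogeneous coordinates are all
  nonzero, put \<open>x\<^sub>j = ln |z\<^sub>j|\<close>. There the metric has the potential
  \<open>K x = 2 ln (\<Sum>\<^bsub>j \<le> m\<^esub> e\<^bsup>2 x j\<^esup>) + k ln (\<Sum>\<^bsub>j \<le> k\<^esub> e\<^bsup>2 x j\<^esup>) + l ln (\<Sum>\<^bsub>j > k\<^esub> e\<^bsup>2 x j\<^esup>)\<close>
  (\<open>potential\<close>), an invariant function \<open>\<phi>\<close> is a function of \<open>x\<close> (\<open>log_function\<close>), and the
  admissibility of \<open>\<phi>\<close> makes \<open>u = \<phi> + K\<close> convex (\<open>log_function_convex\<close>): at points with positive
  real coordinates, the complex Hessian of a function invariant under the torus is, up to the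
  factor 4, its real Hessian in the variables \<open>x\<close>.

  Let \<open>\<phi> \<le> 0\<close> have supremum \<open>0\<close>. Since \<open>u \<le> K\<close> and \<open>K\<close> grows at most like the support function
  \<open>h v = 4 max\<^bsub>j \<le> m\<^esub> v\<^sub>j + 2 k max\<^bsub>j \<le> k\<^esub> v\<^sub>j + 2 l max\<^bsub>j > k\<^esub> v\<^sub>j\<close> of the moment polytope, convexity
  gives \<open>u (x + v) \<le> u x + h v\<close> for all \<open>x\<close> and \<open>v\<close>. Starting at \<open>0\<close> and arriving at points where
  \<open>\<phi>\<close> is almost \<open>0\<close>, this yields \<open>u 0 \<ge> 0\<close>, because \<open>K \<ge> h\<close>. By Jensen's inequality and the
  invariance under permutations, \<open>u\<close> does not increase when each of the two blocks of coordinates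
  of \<open>x\<close> is replaced by its average \<open>a\<close> respectively \<open>b\<close>; going from there to \<open>0\<close> one obtains
  \<open>\<phi> \<ge> 2 k a + 2 l b + 4 min a b - K\<close> (\<open>log_function_lower_bound\<close>), with no constant depending
  on \<open>\<phi>\<close>.

  In every chart the density of the volume element is at most a constant times
  \<open>1 / (|z|\<^sup>4 |\<zeta>|\<^bsup>2 k\<^esup> |\<eta>|\<^bsup>2 l\<^esup>)\<close> (\<open>cmod_det_ghat_le\<close>). Estimating the entries of the metric one by
  one loses a factor \<open>|\<zeta>|\<^sup>2 |\<eta>|\<^sup>2\<close>; it is recovered by first combining rows of the matrix along
  the vector fields \<open>\<Sum> \<zeta>\<^sub>j \<partial>/\<partial>\<zeta>\<^sub>j + \<tau> \<partial>/\<partial>\<tau>\<close> and \<open>\<Sum> \<eta>\<^sub>j \<partial>/\<partial>\<eta>\<^sub>j - \<tau> \<partial>/\<partial>\<tau>\<close>, on which the metric is small.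

  Together, for \<open>0 \<le> \<alpha> < 1/2\<close>, the integrand in a chart with coordinates \<open>w\<^sub>j\<close> is at most a constant
  times \<open>\<Prod> |w\<^sub>j|\<^bsup>- 2\<^esup> exp (- \<kappa> |ln |w\<^sub>j| |)\<close> with \<open>\<kappa> = (1 - 2 \<alpha>) / (2 m) > 0\<close>
  (\<open>integrand_exponent\<close>), and this product is integrable over \<open>\<complex>\<^sup>m\<close>.
\<close>

section \<open>Determinants\<close>

lemma det_on_identical_rows:
  assumes fin: "finite I" and a: "a \<in> I" and b: "b \<in> I" and ab: "a \<noteq> b"
    and eq: "\<And>\<mu>. \<mu> \<in> I \<Longrightarrow> A a \<mu> = A b \<mu>"
  shows "det_on I A = 0"
proof -
  let ?t = "Transposition.transpose a b"
  let ?f = "\<lambda>\<sigma>. of_int (sign \<sigma>) * (\<Prod>i\<in>I. A i (\<sigma> i)) :: complex"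
  have t: "?t permutes I"
    using a b by (rule permutes_swap_id)
  have "det_on I A = (\<Sum>\<sigma> | \<sigma> permutes I. ?f (\<sigma> \<circ> ?t))"
    unfolding det_on_def by (rule sum_permutations_compose_right[OF t])
  also have "\<dots> = (\<Sum>\<sigma> | \<sigma> permutes I. - ?f \<sigma>)"
  proof (rule sum.cong[OF refl])
    fix \<sigma> assume "\<sigma> \<in> {\<sigma>. \<sigma> permutes I}"
    then have \<sigma>: "\<sigma> permutes I" by simp
    have perm: "permutation \<sigma>" "permutation ?t"
      using \<sigma> t fin permutation_permutes by blast+
    have s: "sign (\<sigma> \<circ> ?t) = - sign \<sigma>"
      using sign_compose[OF perm] ab by (simp add: sign_swap_id)
    have "(\<Prod>i\<in>I. A i ((\<sigma> \<circ> ?t) i)) = (\<Prod>i\<in>I. A (?t i) ((\<sigma> \<circ> ?t) (?t i)))"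
      using prod.permute[OF t, of "\<lambda>i. A i ((\<sigma> \<circ> ?t) i)"] by (simp add: o_def)
    also have "\<dots> = (\<Prod>i\<in>I. A i (\<sigma> i))"
    proof (rule prod.cong[OF refl])
      fix i assume "i \<in> I"
      then have si: "\<sigma> i \<in> I" using permutes_in_image[OF \<sigma>] by simp
      consider "i = a" | "i = b" | "i \<noteq> a" "i \<noteq> b" by blast
      then show "A (?t i) ((\<sigma> \<circ> ?t) (?t i)) = A i (\<sigma> i)"
        using eq[OF si] by cases simp_all
    qed
    finally show "?f (\<sigma> \<circ> ?t) = - ?f \<sigma>"
      by (simp add: s)
  qed
  also have "\<dots> = - det_on I A"
    by (simp add: det_on_def sum_negf)
  finally show ?thesis by simp
qed

lemma det_on_row_combination:
  assumes fin: "finite I" and a: "a \<in> I"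
  shows "det_on I (A(a := \<lambda>\<mu>. \<Sum>\<nu>\<in>I. c \<nu> * A \<nu> \<mu>)) = c a * det_on I A"
proof -
  have split: "(\<Prod>i\<in>I. (A(a := R)) i (\<sigma> i)) = R (\<sigma> a) * (\<Prod>i\<in>I - {a}. A i (\<sigma> i))" for R \<sigma>
  proof -
    have "(\<Prod>i\<in>I. (A(a := R)) i (\<sigma> i)) = (A(a := R)) a (\<sigma> a) * (\<Prod>i\<in>I - {a}. (A(a := R)) i (\<sigma> i))"
      by (rule prod.remove[OF fin a])
    also have "(\<Prod>i\<in>I - {a}. (A(a := R)) i (\<sigma> i)) = (\<Prod>i\<in>I - {a}. A i (\<sigma> i))"
      by (rule prod.cong) auto
    finally show ?thesis by simp
  qed
  have "det_on I (A(a := \<lambda>\<mu>. \<Sum>\<nu>\<in>I. c \<nu> * A \<nu> \<mu>))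
      = (\<Sum>\<sigma> | \<sigma> permutes I. \<Sum>\<nu>\<in>I. c \<nu> * (of_int (sign \<sigma>) * (\<Prod>i\<in>I. (A(a := A \<nu>)) i (\<sigma> i))))"
    unfolding det_on_def split
    by (intro sum.cong refl) (simp add: sum_distrib_left sum_distrib_right mult_ac)
  also have "\<dots> = (\<Sum>\<nu>\<in>I. c \<nu> * det_on I (A(a := A \<nu>)))"
    by (subst sum.swap) (simp add: det_on_def sum_distrib_left)
  also have "\<dots> = (\<Sum>\<nu>\<in>I. if \<nu> = a then c a * det_on I A else 0)"
  proof (rule sum.cong[OF refl])
    fix \<nu> assume \<nu>: "\<nu> \<in> I"
    have "det_on I (A(a := A \<nu>)) = 0" if "\<nu> \<noteq> a"
      using that \<nu> a fin by (intro det_on_identical_rows[of _ a \<nu>]) auto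
    then show "c \<nu> * det_on I (A(a := A \<nu>)) = (if \<nu> = a then c a * det_on I A else 0)"
      by auto
  qed
  also have "\<dots> = c a * det_on I A"
    using a fin by simp
  finally show ?thesis .
qed

text \<open>
  Termwise estimate of the Leibniz formula, for entries bounded by a product of a row weight and a
  column weight.
\<close>

lemma cmod_det_on_le:
  assumes fin: "finite I" and B: "B \<ge> 0"
    and r: "\<And>\<nu>. \<nu> \<in> I \<Longrightarrow> r \<nu> \<ge> 0" and s: "\<And>\<nu>. \<nu> \<in> I \<Longrightarrow> s \<nu> \<ge> 0"
    and bd: "\<And>\<nu> \<mu>. \<nu> \<in> I \<Longrightarrow> \<mu> \<in> I \<Longrightarrow> cmod (A \<nu> \<mu>) \<le> B * (r \<nu> * s \<mu>)"
  shows "cmod (det_on I A) \<le> fact (card I) * (B ^ card I * ((\<Prod>\<nu>\<in>I. r \<nu>) * (\<Prod>\<nu>\<in>I. s \<nu>)))"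
proof -
  have "cmod (det_on I A) \<le> (\<Sum>\<sigma> | \<sigma> permutes I. B ^ card I * ((\<Prod>\<nu>\<in>I. r \<nu>) * (\<Prod>\<nu>\<in>I. s \<nu>)))"
    unfolding det_on_def
  proof (rule sum_norm_le)
    fix \<sigma> assume "\<sigma> \<in> {\<sigma>. \<sigma> permutes I}"
    then have \<sigma>: "\<sigma> permutes I" by simp
    have "cmod (of_int (sign \<sigma>) * (\<Prod>i\<in>I. A i (\<sigma> i))) = (\<Prod>i\<in>I. cmod (A i (\<sigma> i)))"
      by (simp add: norm_mult prod_norm sign_def)
    also have "\<dots> \<le> (\<Prod>i\<in>I. B * (r i * s (\<sigma> i)))"
      using bd permutes_in_image[OF \<sigma>] by (intro prod_mono) auto
    also have "\<dots> = B ^ card I * ((\<Prod>\<nu>\<in>I. r \<nu>) * (\<Prod>\<nu>\<in>I. s (\<sigma> \<nu>)))"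
      by (simp add: prod.distrib)
    also have "(\<Prod>\<nu>\<in>I. s (\<sigma> \<nu>)) = (\<Prod>\<nu>\<in>I. s \<nu>)"
      using prod.permute[OF \<sigma>, of s] by (simp add: o_def)
    finally show "cmod (of_int (sign \<sigma>) * (\<Prod>i\<in>I. A i (\<sigma> i)))
      \<le> B ^ card I * ((\<Prod>\<nu>\<in>I. r \<nu>) * (\<Prod>\<nu>\<in>I. s \<nu>))" .
  qed
  also have "\<dots> = fact (card I) * (B ^ card I * ((\<Prod>\<nu>\<in>I. r \<nu>) * (\<Prod>\<nu>\<in>I. s \<nu>)))"
    using fin by (simp add: card_permutations)
  finally show ?thesis .
qed

lemma det_on_optional_row_combination:
  fixes c :: "nat \<Rightarrow> complex"
  assumes "finite I" and "R = {} \<or> (\<exists>a\<in>I. R = {a} \<and> c a = 1)"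
  shows "det_on I (\<lambda>\<nu> \<mu>. if \<nu> \<in> R then \<Sum>\<kappa>\<in>I. c \<kappa> * A \<kappa> \<mu> else A \<nu> \<mu>) = det_on I A"
  using assms(2)
proof (elim disjE bexE conjE)
  fix a assume a: "a \<in> I" and R: "R = {a}" and c: "c a = 1"
  have "(\<lambda>\<nu> \<mu>. if \<nu> \<in> R then \<Sum>\<kappa>\<in>I. c \<kappa> * A \<kappa> \<mu> else A \<nu> \<mu>)
      = A(a := \<lambda>\<mu>. \<Sum>\<kappa>\<in>I. c \<kappa> * A \<kappa> \<mu>)"
    using R by (auto simp: fun_eq_iff)
  then show ?thesis
    using det_on_row_combination[OF assms(1) a, where c = c and A = A] c by simp
qed simp

section \<open>The determinant of the metric\<close>

text \<open>
  The matrix of the metric in a chart, written out. \<open>J1\<close> and \<open>J2\<close> index the free homogeneous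
  coordinates of the two blocks, \<open>e\<close> is the index of the remaining coordinate \<open>\<tau>\<close>, and the point is
  \<open>[v\<^sub>1 + \<tau> v\<^sub>2]\<close> where \<open>v\<^sub>1\<close> and \<open>v\<^sub>2\<close> are the vectors of the two blocks, each with one further coordinate
  equal to \<open>1\<close>. Then \<open>S = |v\<^sub>1|\<^sup>2\<close>, \<open>E = |v\<^sub>2|\<^sup>2\<close>, \<open>T = |\<tau>|\<^sup>2\<close>, \<open>F = S + T E\<close>, and \<open>A\<close> is the complex Hessian of
  \<open>2 ln F + kk ln S + ll ln E\<close>. The two choices of \<open>r\<close> in a chart differ by exchanging the blocks.
\<close>

locale blowup_matrix =
  fixes J1 J2 :: "nat set" and e :: nat and w :: cvec and kk ll :: real
    and A :: "nat \<Rightarrow> nat \<Rightarrow> complex" and S E T F x y t :: real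
  assumes fin: "finite J1" "finite J2"
    and disj: "J1 \<inter> J2 = {}" "e \<notin> J1" "e \<notin> J2"
    and kl: "kk \<ge> 0" "ll \<ge> 0"
    and S_def: "S = 1 + (\<Sum>j\<in>J1. (cmod (w j))\<^sup>2)"
    and E_def: "E = 1 + (\<Sum>j\<in>J2. (cmod (w j))\<^sup>2)"
    and T_def: "T = (cmod (w e))\<^sup>2"
    and F_def: "F = S + T * E"
    and x_def: "x = sqrt S" and y_def: "y = sqrt E" and t_def: "t = cmod (w e)"
    and A11: "\<And>\<nu> \<mu>. \<nu> \<in> J1 \<Longrightarrow> \<mu> \<in> J1 \<Longrightarrow> A \<nu> \<mu> =
      (if \<nu> = \<mu> then of_real (2 / F + kk / S) else 0) - of_real (2 / F\<^sup>2 + kk / S\<^sup>2) * (cnj (w \<nu>) * w \<mu>)"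
    and A22: "\<And>\<nu> \<mu>. \<nu> \<in> J2 \<Longrightarrow> \<mu> \<in> J2 \<Longrightarrow> A \<nu> \<mu> =
      (if \<nu> = \<mu> then of_real (2 * T / F + ll / E) else 0)
        - of_real (2 * T\<^sup>2 / F\<^sup>2 + ll / E\<^sup>2) * (cnj (w \<nu>) * w \<mu>)"
    and A12: "\<And>\<nu> \<mu>. \<nu> \<in> J1 \<Longrightarrow> \<mu> \<in> J2 \<Longrightarrow> A \<nu> \<mu> = - of_real (2 * T / F\<^sup>2) * (cnj (w \<nu>) * w \<mu>)"
    and A1e: "\<And>\<nu>. \<nu> \<in> J1 \<Longrightarrow> A \<nu> e = - of_real (2 * E / F\<^sup>2) * (cnj (w \<nu>) * w e)"
    and A2e: "\<And>\<nu>. \<nu> \<in> J2 \<Longrightarrow> A \<nu> e = of_real (2 * S / F\<^sup>2) * (cnj (w \<nu>) * w e)"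
    and Aee: "A e e = of_real (2 * E * S / F\<^sup>2)"
    and hermitian: "\<And>\<nu> \<mu>. A \<mu> \<nu> = cnj (A \<nu> \<mu>)"
begin

text \<open>
  The squares of the column weights \<open>col\<close> bound the diagonal entries of \<open>A\<close>, up to a constant.
\<close>

definition "I = insert e (J1 \<union> J2)"
definition "N = real (card J1 + card J2 + 1)"
definition "col \<mu> = (if \<mu> \<in> J1 then 1 / x else if \<mu> \<in> J2 then 1 / y else x * y / F)"

lemma A21: "\<nu> \<in> J2 \<Longrightarrow> \<mu> \<in> J1 \<Longrightarrow> A \<nu> \<mu> = - of_real (2 * T / F\<^sup>2) * (cnj (w \<nu>) * w \<mu>)"
  and Ae1: "\<mu> \<in> J1 \<Longrightarrow> A e \<mu> = - of_real (2 * E / F\<^sup>2) * (cnj (w e) * w \<mu>)"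
  and Ae2: "\<mu> \<in> J2 \<Longrightarrow> A e \<mu> = of_real (2 * S / F\<^sup>2) * (cnj (w e) * w \<mu>)"
  by (subst hermitian; simp add: A12 A1e A2e mult.commute)+

lemma x_ge_1: "x \<ge> 1" and y_ge_1: "y \<ge> 1" and t_nonneg: "t \<ge> 0"
  and S_eq: "S = x\<^sup>2" and E_eq: "E = y\<^sup>2" and T_eq: "T = t\<^sup>2"
proof -
  have "S \<ge> 1" "E \<ge> 1" unfolding S_def E_def by (simp_all add: sum_nonneg)
  then show "x \<ge> 1" "y \<ge> 1" "t \<ge> 0" "S = x\<^sup>2" "E = y\<^sup>2" "T = t\<^sup>2"
    unfolding x_def y_def t_def T_def by simp_all
qed

lemma F_eq: "F = x\<^sup>2 + t\<^sup>2 * y\<^sup>2"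
  by (simp add: F_def S_eq E_eq T_eq)

lemma F_ge1: "F \<ge> x\<^sup>2" and F_ge2: "F \<ge> t\<^sup>2 * y\<^sup>2" and F_ge3: "F \<ge> t * x * y"
  and F_pos: "F > 0"
proof -
  show 1: "F \<ge> x\<^sup>2" and "F \<ge> t\<^sup>2 * y\<^sup>2" by (auto simp: F_eq)
  have "2 * (x * (t * y)) \<le> x\<^sup>2 + (t * y)\<^sup>2"
    using sum_squares_bound[of x "t * y"] by (simp add: mult_ac)
  moreover have "0 \<le> x * (t * y)" using x_ge_1 y_ge_1 t_nonneg by simp
  ultimately have "x * (t * y) \<le> F" unfolding F_eq power_mult_distrib by linarith
  then show "F \<ge> t * x * y" by (simp add: mult_ac)
  have "x\<^sup>2 \<ge> 1" using x_ge_1 by simp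
  then show "F > 0" using 1 by linarith
qed

lemma norm_le_x: "j \<in> J1 \<Longrightarrow> cmod (w j) \<le> x"
  and norm_le_y: "j \<in> J2 \<Longrightarrow> cmod (w j) \<le> y"
proof -
  assume "j \<in> J1"
  then have "(cmod (w j))\<^sup>2 \<le> (\<Sum>j\<in>J1. (cmod (w j))\<^sup>2)"
    using fin by (intro member_le_sum) auto
  then show "cmod (w j) \<le> x"
    unfolding x_def by (intro real_le_rsqrt) (simp add: S_def)
next
  assume "j \<in> J2"
  then have "(cmod (w j))\<^sup>2 \<le> (\<Sum>j\<in>J2. (cmod (w j))\<^sup>2)"
    using fin by (intro member_le_sum) auto
  then show "cmod (w j) \<le> y"
    unfolding y_def by (intro real_le_rsqrt) (simp add: E_def)
qed

lemma sum_I: "(\<Sum>\<nu>\<in>I. f \<nu>) = (\<Sum>\<nu>\<in>J1. f \<nu>) + (\<Sum>\<nu>\<in>J2. f \<nu>) + (f e :: complex)"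
  unfolding I_def using fin disj by (simp add: sum.union_disjoint)

lemma prod_I: "(\<Prod>\<nu>\<in>I. f \<nu>) = (\<Prod>\<nu>\<in>J1. f \<nu>) * (\<Prod>\<nu>\<in>J2. f \<nu>) * (f e :: real)"
  unfolding I_def using fin disj by (simp add: prod.union_disjoint)

lemma sum_norm_sq_1: "(\<Sum>\<nu>\<in>J1. w \<nu> * cnj (w \<nu>)) = of_real (S - 1)"
  and sum_norm_sq_2: "(\<Sum>\<nu>\<in>J2. w \<nu> * cnj (w \<nu>)) = of_real (E - 1)"
  unfolding S_def E_def by (simp_all only: complex_norm_square[symmetric] of_real_sum add_diff_cancel_left')

lemma norm_sq_e: "w e * cnj (w e) = of_real T"
  unfolding T_def by (simp only: complex_norm_square)

text \<open>
  \<open>R1\<close> combines the rows of \<open>A\<close> along the vector field that scales the first block and \<open>\<tau>\<close>, and so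
  multiplies every homogeneous coordinate of the point except the one normalised to \<open>1\<close>. \<open>R2\<close> combines
  them along the field that scales the second block and acts on \<open>\<tau>\<close> with the opposite sign, and so
  moves only one homogeneous coordinate of the point. In both combinations the leading terms cancel.
\<close>

definition "c1 \<nu> = (if \<nu> \<in> J2 then 0 else w \<nu>)"
definition "R1 \<mu> = (\<Sum>\<nu>\<in>I. c1 \<nu> * A \<nu> \<mu>)"
definition "c2 \<nu> = (if \<nu> \<in> J1 then 0 else if \<nu> \<in> J2 then w \<nu> else - w e)"
definition "R2 \<mu> = (\<Sum>\<nu>\<in>I. c2 \<nu> * A \<nu> \<mu>)"

lemma R1_split: "R1 \<mu> = (\<Sum>\<nu>\<in>J1. w \<nu> * A \<nu> \<mu>) + w e * A e \<mu>"
proof -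
  have "(\<Sum>\<nu>\<in>J1. c1 \<nu> * A \<nu> \<mu>) = (\<Sum>\<nu>\<in>J1. w \<nu> * A \<nu> \<mu>)"
    using disj by (intro sum.cong) (auto simp: c1_def)
  moreover have "(\<Sum>\<nu>\<in>J2. c1 \<nu> * A \<nu> \<mu>) = 0"
    by (intro sum.neutral) (auto simp: c1_def)
  ultimately show ?thesis
    using disj by (simp add: R1_def sum_I c1_def)
qed

lemma R2_split: "R2 \<mu> = (\<Sum>\<nu>\<in>J2. w \<nu> * A \<nu> \<mu>) - w e * A e \<mu>"
proof -
  have "(\<Sum>\<nu>\<in>J2. c2 \<nu> * A \<nu> \<mu>) = (\<Sum>\<nu>\<in>J2. w \<nu> * A \<nu> \<mu>)"
    using disj by (intro sum.cong) (auto simp: c2_def)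
  moreover have "(\<Sum>\<nu>\<in>J1. c2 \<nu> * A \<nu> \<mu>) = 0"
    by (intro sum.neutral) (auto simp: c2_def)
  ultimately show ?thesis
    using disj by (simp add: R2_def sum_I c2_def)
qed

lemma sum_diagonal_rank_one:
  assumes "finite J" "\<mu> \<in> J" "(\<Sum>\<nu>\<in>J. w \<nu> * cnj (w \<nu>)) = of_real s"
    and "\<And>\<nu>. \<nu> \<in> J \<Longrightarrow> A \<nu> \<mu> = (if \<nu> = \<mu> then of_real a else 0) - of_real b * (cnj (w \<nu>) * w \<mu>)"
  shows "(\<Sum>\<nu>\<in>J. w \<nu> * A \<nu> \<mu>) = of_real (a - b * s) * w \<mu>"
proof -
  have "(\<Sum>\<nu>\<in>J. w \<nu> * A \<nu> \<mu>) = (\<Sum>\<nu>\<in>J. (if \<nu> = \<mu> then of_real a * w \<mu> else 0)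
      - (w \<nu> * cnj (w \<nu>)) * (of_real b * w \<mu>))"
    by (intro sum.cong refl) (auto simp: assms(4) algebra_simps)
  also have "\<dots> = of_real a * w \<mu> - of_real s * (of_real b * w \<mu>)"
    using assms(1-3) by (simp add: sum_subtractf flip: sum_distrib_right)
  finally show ?thesis by (simp add: algebra_simps)
qed

lemma sum_rank_one:
  assumes "(\<Sum>\<nu>\<in>J. w \<nu> * cnj (w \<nu>)) = of_real s"
    and "\<And>\<nu>. \<nu> \<in> J \<Longrightarrow> A \<nu> \<mu> = of_real b * (cnj (w \<nu>) * z)"
  shows "(\<Sum>\<nu>\<in>J. w \<nu> * A \<nu> \<mu>) = of_real (b * s) * z"
proof -
  have "(\<Sum>\<nu>\<in>J. w \<nu> * A \<nu> \<mu>) = (\<Sum>\<nu>\<in>J. (w \<nu> * cnj (w \<nu>)) * (of_real b * z))"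
    by (intro sum.cong refl) (auto simp: assms(2) algebra_simps)
  also have "\<dots> = of_real s * (of_real b * z)"
    using assms(1) by (simp flip: sum_distrib_right)
  finally show ?thesis by (simp add: algebra_simps)
qed

lemma scaled_e_row:
  assumes "A e \<mu> = of_real b * (cnj (w e) * z)"
  shows "w e * A e \<mu> = of_real (b * T) * z"
proof -
  have "w e * A e \<mu> = (w e * cnj (w e)) * (of_real b * z)"
    using assms by (simp add: mult_ac)
  then show ?thesis by (simp only: norm_sq_e) (simp add: mult_ac)
qed

lemma SE_pos: "S > 0" "E > 0" "S \<noteq> 0" "E \<noteq> 0" "F \<noteq> 0"
  using x_ge_1 y_ge_1 F_pos by (auto simp: S_eq E_eq)

lemma divide_F: "c / F = c * F / F\<^sup>2" and divide_S: "c / S = c * S / S\<^sup>2" and divide_E: "c / E = c * E / E\<^sup>2"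
  using SE_pos(3-5) by (simp_all add: power2_eq_square)

lemma R1_block1: assumes "\<mu> \<in> J1" shows "R1 \<mu> = of_real (2 / F\<^sup>2 + kk / S\<^sup>2) * w \<mu>"
proof -
  have 1: "(\<Sum>\<nu>\<in>J1. w \<nu> * A \<nu> \<mu>)
      = of_real ((2 / F + kk / S) - (2 / F\<^sup>2 + kk / S\<^sup>2) * (S - 1)) * w \<mu>"
    by (rule sum_diagonal_rank_one[OF fin(1) assms sum_norm_sq_1]) (rule A11[OF _ assms])
  have "R1 \<mu> = of_real ((2 / F + kk / S) - (2 / F\<^sup>2 + kk / S\<^sup>2) * (S - 1) + (- (2 * E / F\<^sup>2)) * T) * w \<mu>"
    unfolding R1_split 1 scaled_e_row[OF Ae1[OF assms, folded of_real_minus]] of_real_add distrib_right ..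
  also have "(2 / F + kk / S) - (2 / F\<^sup>2 + kk / S\<^sup>2) * (S - 1) + (- (2 * E / F\<^sup>2)) * T
     = 2 * (F - S - T * E + 1) / F\<^sup>2 + kk / S\<^sup>2"
    unfolding divide_F[of 2] divide_S[of kk] by (simp add: algebra_simps add_divide_distrib diff_divide_distrib)
  also have "F - S - T * E + 1 = 1" by (simp add: F_def)
  finally show ?thesis by simp
qed

lemma R1_block2: assumes "\<mu> \<in> J2" shows "R1 \<mu> = of_real (2 * T / F\<^sup>2) * w \<mu>"
proof -
  have 1: "(\<Sum>\<nu>\<in>J1. w \<nu> * A \<nu> \<mu>) = of_real ((- (2 * T / F\<^sup>2)) * (S - 1)) * w \<mu>"
    by (rule sum_rank_one[OF sum_norm_sq_1]) (rule A12[OF _ assms, folded of_real_minus])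
  have "R1 \<mu> = of_real ((- (2 * T / F\<^sup>2)) * (S - 1) + (2 * S / F\<^sup>2) * T) * w \<mu>"
    unfolding R1_split 1 scaled_e_row[OF Ae2[OF assms]] of_real_add distrib_right ..
  also have "(- (2 * T / F\<^sup>2)) * (S - 1) + (2 * S / F\<^sup>2) * T = 2 * T / F\<^sup>2"
    by (simp add: algebra_simps add_divide_distrib diff_divide_distrib)
  finally show ?thesis .
qed

lemma R1_e: "R1 e = of_real (2 * E / F\<^sup>2) * w e"
proof -
  have 1: "(\<Sum>\<nu>\<in>J1. w \<nu> * A \<nu> e) = of_real ((- (2 * E / F\<^sup>2)) * (S - 1)) * w e"
    by (rule sum_rank_one[OF sum_norm_sq_1]) (rule A1e[folded of_real_minus])
  have "R1 e = of_real ((- (2 * E / F\<^sup>2)) * (S - 1) + 2 * E * S / F\<^sup>2) * w e"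
    unfolding R1_split 1 Aee mult.commute[of "w e"] of_real_add distrib_right ..
  also have "(- (2 * E / F\<^sup>2)) * (S - 1) + 2 * E * S / F\<^sup>2 = 2 * E / F\<^sup>2"
    by (simp add: algebra_simps add_divide_distrib diff_divide_distrib)
  finally show ?thesis .
qed

lemma R2_block1: assumes "\<mu> \<in> J1" shows "R2 \<mu> = of_real (2 * T / F\<^sup>2) * w \<mu>"
proof -
  have 1: "(\<Sum>\<nu>\<in>J2. w \<nu> * A \<nu> \<mu>) = of_real ((- (2 * T / F\<^sup>2)) * (E - 1)) * w \<mu>"
    by (rule sum_rank_one[OF sum_norm_sq_2]) (rule A21[OF _ assms, folded of_real_minus])
  have "R2 \<mu> = of_real ((- (2 * T / F\<^sup>2)) * (E - 1) - (- (2 * E / F\<^sup>2)) * T) * w \<mu>"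
    unfolding R2_split 1 scaled_e_row[OF Ae1[OF assms, folded of_real_minus]]
    by (simp only: of_real_diff left_diff_distrib)
  also have "(- (2 * T / F\<^sup>2)) * (E - 1) - (- (2 * E / F\<^sup>2)) * T = 2 * T / F\<^sup>2"
    by (simp add: algebra_simps add_divide_distrib diff_divide_distrib)
  finally show ?thesis .
qed

lemma R2_block2: assumes "\<mu> \<in> J2" shows "R2 \<mu> = of_real (2 * T\<^sup>2 / F\<^sup>2 + ll / E\<^sup>2) * w \<mu>"
proof -
  have 1: "(\<Sum>\<nu>\<in>J2. w \<nu> * A \<nu> \<mu>)
      = of_real ((2 * T / F + ll / E) - (2 * T\<^sup>2 / F\<^sup>2 + ll / E\<^sup>2) * (E - 1)) * w \<mu>"
    by (rule sum_diagonal_rank_one[OF fin(2) assms sum_norm_sq_2]) (rule A22[OF _ assms])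
  have "R2 \<mu> = of_real ((2 * T / F + ll / E) - (2 * T\<^sup>2 / F\<^sup>2 + ll / E\<^sup>2) * (E - 1) - (2 * S / F\<^sup>2) * T) * w \<mu>"
    unfolding R2_split 1 scaled_e_row[OF Ae2[OF assms]]
    by (simp only: of_real_diff left_diff_distrib)
  also have "(2 * T / F + ll / E) - (2 * T\<^sup>2 / F\<^sup>2 + ll / E\<^sup>2) * (E - 1) - (2 * S / F\<^sup>2) * T
     = 2 * T * (F - S - T * E + T) / F\<^sup>2 + ll / E\<^sup>2"
    unfolding divide_F[of "2 * T"] divide_E[of ll] by (simp add: algebra_simps add_divide_distrib diff_divide_distrib power2_eq_square)
  also have "F - S - T * E + T = T" by (simp add: F_def)
  finally show ?thesis by (simp add: power2_eq_square)
qed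

lemma R2_e: "R2 e = - of_real (2 * S / F\<^sup>2) * w e"
proof -
  have 1: "(\<Sum>\<nu>\<in>J2. w \<nu> * A \<nu> e) = of_real ((2 * S / F\<^sup>2) * (E - 1)) * w e"
    by (rule sum_rank_one[OF sum_norm_sq_2]) (rule A2e)
  have "R2 e = of_real ((2 * S / F\<^sup>2) * (E - 1) - 2 * E * S / F\<^sup>2) * w e"
    unfolding R2_split 1 Aee mult.commute[of "w e"]
    by (simp only: of_real_diff left_diff_distrib)
  also have "(2 * S / F\<^sup>2) * (E - 1) - 2 * E * S / F\<^sup>2 = - (2 * S / F\<^sup>2)"
    by (simp add: algebra_simps add_divide_distrib diff_divide_distrib)
  finally show ?thesis by simp
qed

end

context blowup_matrix
begin

text \<open>
  A common constant for the bounds of all entries.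
\<close>

definition "B = N * (4 + 2 * kk + 2 * ll)"

lemma N_ge_1: "N \<ge> 1" by (simp add: N_def)

lemma col1: "\<mu> \<in> J1 \<Longrightarrow> col \<mu> = 1 / x" and col2: "\<mu> \<in> J2 \<Longrightarrow> col \<mu> = 1 / y"
  and cole: "col e = x * y / F"
  using disj by (auto simp: col_def)

lemma txy_sq: "t\<^sup>2 * x\<^sup>2 * y\<^sup>2 \<le> F\<^sup>2"
proof -
  have "(t * x * y)\<^sup>2 \<le> F\<^sup>2"
    using F_ge3 x_ge_1 y_ge_1 t_nonneg by (intro power_mono) auto
  then show ?thesis by (simp add: power_mult_distrib)
qed

lemma norm_rank_one_le:
  assumes "c \<ge> 0" "cmod u \<le> a" "cmod v \<le> b" "c * (a * b) \<le> C * r"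
  shows "cmod (of_real c * (cnj u * v)) \<le> C * r" and "cmod (- of_real c * (cnj u * v)) \<le> C * r"
proof -
  have a: "a \<ge> 0" using assms(2) norm_ge_zero order_trans by blast
  have "cmod u * cmod v \<le> a * b"
    using assms a by (intro mult_mono) auto
  then have "c * (cmod u * cmod v) \<le> c * (a * b)"
    using assms(1) by (intro mult_left_mono)
  then show "cmod (of_real c * (cnj u * v)) \<le> C * r" and "cmod (- of_real c * (cnj u * v)) \<le> C * r"
    using assms(1,4) by (simp_all add: norm_mult)
qed

lemma norm_e_le: "cmod (w e) \<le> t" by (simp add: t_def)

lemma frac_le: "b > 0 \<Longrightarrow> d > 0 \<Longrightarrow> a * d \<le> c * b \<Longrightarrow> a / b \<le> c / (d::real)"
  by (simp add: frac_le_eq divide_simps mult_ac)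

lemma ratio_estimates: "1 / F \<le> 1 / x\<^sup>2" "T / F \<le> 1 / y\<^sup>2" "1 / F\<^sup>2 * (x * x) \<le> 1 / x\<^sup>2"
  "T\<^sup>2 / F\<^sup>2 * (y * y) \<le> 1 / y\<^sup>2" "1 / S\<^sup>2 * (x * x) = 1 / x\<^sup>2" "1 / E\<^sup>2 * (y * y) = 1 / y\<^sup>2"
  "T / F\<^sup>2 * (x * y) \<le> 1 / (x * y)" "E / F\<^sup>2 * (x * t) \<le> 1 / x * (x * y / F)"
  "S / F\<^sup>2 * (y * t) \<le> 1 / y * (x * y / F)"
proof -
  have x0: "x > 0" and y0: "y > 0" using x_ge_1 y_ge_1 by auto
  show a: "1 / F \<le> 1 / x\<^sup>2"
    using F_ge1 F_pos x0 by (intro frac_le) auto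
  show b: "T / F \<le> 1 / y\<^sup>2"
    using F_ge2 F_pos y0 by (intro frac_le) (auto simp: T_eq mult_ac)
  have "1 / F * (1 / F) \<le> 1 / x\<^sup>2 * (1 / x\<^sup>2)"
    using a F_pos by (intro mult_mono) auto
  then have "1 / F * (1 / F) * (x * x) \<le> 1 / x\<^sup>2 * (1 / x\<^sup>2) * (x * x)"
    using x0 by (intro mult_right_mono) auto
  then show "1 / F\<^sup>2 * (x * x) \<le> 1 / x\<^sup>2"
    using x0 by (simp add: power2_eq_square)
  have "T / F * (T / F) \<le> 1 / y\<^sup>2 * (1 / y\<^sup>2)"
    using b F_pos by (intro mult_mono) (auto simp: T_eq)
  then have "T / F * (T / F) * (y * y) \<le> 1 / y\<^sup>2 * (1 / y\<^sup>2) * (y * y)"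
    using y0 by (intro mult_right_mono) auto
  then show "T\<^sup>2 / F\<^sup>2 * (y * y) \<le> 1 / y\<^sup>2"
    using y0 by (simp add: power2_eq_square)
  show "1 / S\<^sup>2 * (x * x) = 1 / x\<^sup>2" "1 / E\<^sup>2 * (y * y) = 1 / y\<^sup>2"
    using x0 y0 by (simp_all add: S_eq E_eq power2_eq_square)
  have "T * (x * y) / F\<^sup>2 \<le> 1 / (x * y)"
    using txy_sq F_pos x0 y0 by (intro frac_le) (auto simp: T_eq power2_eq_square mult_ac)
  then show "T / F\<^sup>2 * (x * y) \<le> 1 / (x * y)" by simp
  have "E * (x * t) / F\<^sup>2 \<le> y / F"
  proof (rule frac_le)
    have "y * F * (t * x * y) \<le> y * F * F"
      using F_ge3 F_pos y0 by (intro mult_left_mono) auto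
    then show "E * (x * t) * F \<le> y * F\<^sup>2"
      by (simp add: E_eq power2_eq_square mult_ac)
  qed (use F_pos in auto)
  then show "E / F\<^sup>2 * (x * t) \<le> 1 / x * (x * y / F)"
    using x0 by simp
  have "S * (y * t) / F\<^sup>2 \<le> x / F"
  proof (rule frac_le)
    have "x * F * (t * x * y) \<le> x * F * F"
      using F_ge3 F_pos x0 by (intro mult_left_mono) auto
    then show "S * (y * t) * F \<le> x * F\<^sup>2"
      by (simp add: S_eq power2_eq_square mult_ac)
  qed (use F_pos in auto)
  then show "S / F\<^sup>2 * (y * t) \<le> 1 / y * (x * y / F)"
    using y0 by simp
qed

lemma B_bounds: "4 + 2 * kk + 2 * ll \<le> B" "(2 + kk) * N \<le> B" "(2 + ll) * N \<le> B" "2 * N \<le> B" "2 \<le> B" "B \<ge> 0"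
proof -
  have *: "c * N \<le> B" if "c \<le> 4 + 2 * kk + 2 * ll" for c
    unfolding B_def using that N_ge_1 mult_left_mono[of c "4 + 2 * kk + 2 * ll" N] by (simp add: mult.commute)
  show "(2 + kk) * N \<le> B" "(2 + ll) * N \<le> B" "2 * N \<le> B"
    using kl by (intro *; simp)+
  have "1 * (4 + 2 * kk + 2 * ll) \<le> N * (4 + 2 * kk + 2 * ll)"
    using N_ge_1 kl by (intro mult_right_mono) auto
  then show 1: "4 + 2 * kk + 2 * ll \<le> B" by (simp add: B_def)
  then show "2 \<le> B" "B \<ge> 0" using kl by linarith+
qed

lemma entry_bound:
  assumes "\<nu> \<in> I" "\<mu> \<in> I"
  shows "cmod (A \<nu> \<mu>) \<le> B * (col \<nu> * col \<mu>)"
proof -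
  have x0: "x > 0" and y0: "y > 0" using x_ge_1 y_ge_1 by auto
  have T0: "T \<ge> 0" by (simp add: T_eq)
  have mono: "c * r \<le> B * r" if "c \<le> B" "r \<ge> 0" for c r
    using that by (rule mult_right_mono)
  have kB: "4 + 2 * kk \<le> B" "4 + 2 * ll \<le> B" using B_bounds(1) kl by linarith+
  have sym: "cmod (A \<nu> \<mu>) = cmod (A \<mu> \<nu>)" "col \<nu> * col \<mu> = col \<mu> * col \<nu>" for \<nu> \<mu>
    by (simp_all add: hermitian[of \<nu> \<mu>] mult.commute)
  have main: "cmod (A \<nu> \<mu>) \<le> B * (col \<nu> * col \<mu>)"
    if "\<nu> \<in> J1 \<and> \<mu> \<in> J1 \<or> \<nu> \<in> J2 \<and> \<mu> \<in> J2 \<or> \<nu> \<in> J1 \<and> \<mu> \<in> J2 \<or> \<nu> \<in> J1 \<and> \<mu> = e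
      \<or> \<nu> \<in> J2 \<and> \<mu> = e \<or> \<nu> = e \<and> \<mu> = e" for \<nu> \<mu>
    using that
  proof (elim disjE conjE)
    assume asm: "\<nu> \<in> J1" "\<mu> \<in> J1"
    let ?a = "2 / F + kk / S" and ?b = "2 / F\<^sup>2 + kk / S\<^sup>2"
    have a0: "?a \<ge> 0" "?b \<ge> 0" using F_pos SE_pos kl by simp_all
    have "cmod (A \<nu> \<mu>) \<le> ?a + ?b * (cmod (w \<nu>) * cmod (w \<mu>))"
      unfolding A11[OF asm]
      apply (rule order_trans[OF norm_triangle_ineq4])
      using a0 by (auto simp: norm_mult simp del: of_real_add of_real_divide)
    also have "\<dots> \<le> ?a + ?b * (x * x)"
      using norm_le_x[OF asm(1)] norm_le_x[OF asm(2)] a0 x0 by (intro add_left_mono mult_left_mono mult_mono) auto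
    also have "\<dots> = 2 * (1 / F) + kk * (1 / x\<^sup>2) + (2 * (1 / F\<^sup>2 * (x * x)) + kk * (1 / S\<^sup>2 * (x * x)))"
      by (simp add: S_eq ring_distribs)
    also have "\<dots> \<le> 2 * (1 / x\<^sup>2) + kk * (1 / x\<^sup>2) + (2 * (1 / x\<^sup>2) + kk * (1 / x\<^sup>2))"
      using ratio_estimates(1,3,5) kl by (intro add_mono mult_left_mono) auto
    also have "\<dots> = (4 + 2 * kk) * (1 / x\<^sup>2)" by (simp add: ring_distribs add_divide_distrib)
    also have "\<dots> \<le> B * (1 / x\<^sup>2)" using kB by (intro mono) auto
    finally show ?thesis using asm by (simp add: col1 power2_eq_square)
  next
    assume asm: "\<nu> \<in> J2" "\<mu> \<in> J2"
    let ?a = "2 * T / F + ll / E" and ?b = "2 * T\<^sup>2 / F\<^sup>2 + ll / E\<^sup>2"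
    have a0: "?a \<ge> 0" "?b \<ge> 0" using F_pos SE_pos kl T0 by simp_all
    have "cmod (A \<nu> \<mu>) \<le> ?a + ?b * (cmod (w \<nu>) * cmod (w \<mu>))"
      unfolding A22[OF asm]
      apply (rule order_trans[OF norm_triangle_ineq4])
      using a0 by (auto simp: norm_mult simp del: of_real_add of_real_divide)
    also have "\<dots> \<le> ?a + ?b * (y * y)"
      using norm_le_y[OF asm(1)] norm_le_y[OF asm(2)] a0 y0 by (intro add_left_mono mult_left_mono mult_mono) auto
    also have "\<dots> = 2 * (T / F) + ll * (1 / y\<^sup>2) + (2 * (T\<^sup>2 / F\<^sup>2 * (y * y)) + ll * (1 / E\<^sup>2 * (y * y)))"
      by (simp add: E_eq ring_distribs)
    also have "\<dots> \<le> 2 * (1 / y\<^sup>2) + ll * (1 / y\<^sup>2) + (2 * (1 / y\<^sup>2) + ll * (1 / y\<^sup>2))"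
      using ratio_estimates(2,4,6) kl by (intro add_mono mult_left_mono) auto
    also have "\<dots> = (4 + 2 * ll) * (1 / y\<^sup>2)" by (simp add: ring_distribs add_divide_distrib)
    also have "\<dots> \<le> B * (1 / y\<^sup>2)" using kB by (intro mono) auto
    finally show ?thesis using asm by (simp add: col2 power2_eq_square)
  next
    assume asm: "\<nu> \<in> J1" "\<mu> \<in> J2"
    have "2 * T / F\<^sup>2 * (x * y) \<le> B * (1 / (x * y))"
      using ratio_estimates(7) mono[OF B_bounds(5), of "1 / (x * y)"] x0 y0 by simp
    then show ?thesis
      unfolding A12[OF asm] using asm T0
      by (intro norm_rank_one_le(2)[OF _ norm_le_x[OF asm(1)] norm_le_y[OF asm(2)]]) (simp_all add: col1 col2)
  next
    assume asm: "\<nu> \<in> J1" "\<mu> = e"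
    have "2 * E / F\<^sup>2 * (x * t) \<le> B * (1 / x * (x * y / F))"
      using ratio_estimates(8) mono[OF B_bounds(5), of "1 / x * (x * y / F)"] x0 y0 F_pos by simp
    note est = this
    show ?thesis
      unfolding asm(2) A1e[OF asm(1)]
    proof (rule norm_rank_one_le(2)[OF _ norm_le_x[OF asm(1)] norm_e_le])
      show "0 \<le> 2 * E / F\<^sup>2" using SE_pos by simp
    qed (use est asm in \<open>simp only: col1 cole\<close>)
  next
    assume asm: "\<nu> \<in> J2" "\<mu> = e"
    have "2 * S / F\<^sup>2 * (y * t) \<le> B * (1 / y * (x * y / F))"
      using ratio_estimates(9) mono[OF B_bounds(5), of "1 / y * (x * y / F)"] x0 y0 F_pos by simp
    note est = this
    show ?thesis
      unfolding asm(2) A2e[OF asm(1)]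
    proof (rule norm_rank_one_le(1)[OF _ norm_le_y[OF asm(1)] norm_e_le])
      show "0 \<le> 2 * S / F\<^sup>2" using SE_pos by simp
    qed (use est asm in \<open>simp only: col2 cole\<close>)
  next
    assume asm: "\<nu> = e" "\<mu> = e"
    have "A \<nu> \<mu> = of_real (2 * (col e * col e))"
      unfolding asm Aee by (simp add: cole S_eq E_eq power2_eq_square mult_ac)
    then have "cmod (A \<nu> \<mu>) = 2 * (col e * col e)"
      using x0 y0 F_pos by (simp add: cole del: of_real_mult of_real_divide)
    then show ?thesis
      using mono[OF B_bounds(5), of "col e * col e"] asm by simp
  qed
  show ?thesis
    using assms main sym unfolding I_def by (metis Un_iff insert_iff)
qed

lemma scaled_coordinate_le:
  assumes "c \<ge> 0" "cmod (w \<mu>) \<le> b" "c * b \<le> a * (q * col \<mu>)" "a * N \<le> B" "0 \<le> q * col \<mu>"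
  shows "cmod (of_real c * w \<mu>) * N \<le> B * (q * col \<mu>)"
proof -
  have "c * cmod (w \<mu>) \<le> c * b" using assms by (intro mult_left_mono)
  then have "c * cmod (w \<mu>) * N \<le> a * (q * col \<mu>) * N"
    using assms N_ge_1 by (intro mult_right_mono) auto
  also have "\<dots> = (a * N) * (q * col \<mu>)" by simp
  also have "\<dots> \<le> B * (q * col \<mu>)"
    using assms by (intro mult_right_mono)
  finally show ?thesis using assms(1) by (simp add: norm_mult del: of_real_add of_real_mult of_real_divide)
qed

text \<open>
  The row \<open>R1\<close> is to be divided by a coordinate that is at least \<open>x / N\<close>; compared with the bound for
  the rows of the first block, this gains a factor \<open>1 / x\<^sup>2 = 1 / S\<close>. The row \<open>R2\<close> gains \<open>1 / E\<close>.
\<close>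

lemma R1_le:
  assumes "\<mu> \<in> I"
  shows "cmod (R1 \<mu>) * N \<le> B * (1 / x\<^sup>2 * col \<mu>)"
proof -
  have x0: "x > 0" and y0: "y > 0" using x_ge_1 y_ge_1 by auto
  have T0: "T \<ge> 0" by (simp add: T_eq)
  consider "\<mu> \<in> J1" | "\<mu> \<in> J2" | "\<mu> = e" using assms by (auto simp: I_def)
  then show ?thesis
  proof cases
    case 1
    show ?thesis unfolding R1_block1[OF 1]
    proof (rule scaled_coordinate_le[OF _ norm_le_x[OF 1] _ B_bounds(2)])
      have "1 / F\<^sup>2 * x \<le> 1 / x\<^sup>2 * (1 / x)"
        using ratio_estimates(3) x0 mult_right_mono[of "1 / F\<^sup>2 * (x * x)" "1 / x\<^sup>2" "1 / x"] by simp
      moreover have "1 / S\<^sup>2 * x = 1 / x\<^sup>2 * (1 / x)"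
        using x0 by (simp add: S_eq power2_eq_square)
      ultimately have "2 * (1 / F\<^sup>2 * x) + kk * (1 / S\<^sup>2 * x) \<le> 2 * (1 / x\<^sup>2 * (1 / x)) + kk * (1 / x\<^sup>2 * (1 / x))"
        by (intro add_mono mult_left_mono) (use kl in auto)
      then show "(2 / F\<^sup>2 + kk / S\<^sup>2) * x \<le> (2 + kk) * (1 / x\<^sup>2 * col \<mu>)"
        using 1 by (simp add: col1 ring_distribs add_divide_distrib)
    qed (use 1 x0 kl in \<open>auto simp: col1\<close>)
  next
    case 2
    show ?thesis unfolding R1_block2[OF 2]
    proof (rule scaled_coordinate_le[OF _ norm_le_y[OF 2] _ B_bounds(4)])
      have "T / F\<^sup>2 * y \<le> 1 / x\<^sup>2 * (1 / y)"
        using ratio_estimates(7) x0 y0 mult_right_mono[of "T / F\<^sup>2 * (x * y)" "1 / (x * y)" "1 / x"]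
        by (simp add: power2_eq_square mult_ac)
      then show "2 * T / F\<^sup>2 * y \<le> 2 * (1 / x\<^sup>2 * col \<mu>)"
        using 2 by (simp add: col2)
    qed (use 2 y0 T0 in \<open>auto simp: col2\<close>)
  next
    case 3
    show ?thesis unfolding 3 R1_e
    proof (rule scaled_coordinate_le[OF _ norm_e_le _ B_bounds(4)])
      have "E / F\<^sup>2 * t \<le> 1 / x\<^sup>2 * (x * y / F)"
        using ratio_estimates(8) x0 y0 mult_right_mono[of "E / F\<^sup>2 * (x * t)" "1 / x * (x * y / F)" "1 / x"]
        by (simp add: power2_eq_square mult_ac)
      then show "2 * E / F\<^sup>2 * t \<le> 2 * (1 / x\<^sup>2 * col e)"
        by (simp add: cole)
    qed (use x0 y0 F_pos SE_pos in \<open>auto simp: cole\<close>)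
  qed
qed

lemma R2_le:
  assumes "\<mu> \<in> I"
  shows "cmod (R2 \<mu>) * N \<le> B * (1 / y\<^sup>2 * col \<mu>)"
proof -
  have x0: "x > 0" and y0: "y > 0" using x_ge_1 y_ge_1 by auto
  have T0: "T \<ge> 0" by (simp add: T_eq)
  consider "\<mu> \<in> J1" | "\<mu> \<in> J2" | "\<mu> = e" using assms by (auto simp: I_def)
  then show ?thesis
  proof cases
    case 1
    show ?thesis unfolding R2_block1[OF 1]
    proof (rule scaled_coordinate_le[OF _ norm_le_x[OF 1] _ B_bounds(4)])
      have "T / F\<^sup>2 * x \<le> 1 / y\<^sup>2 * (1 / x)"
        using ratio_estimates(7) x0 y0 mult_right_mono[of "T / F\<^sup>2 * (x * y)" "1 / (x * y)" "1 / y"]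
        by (simp add: power2_eq_square mult_ac)
      then show "2 * T / F\<^sup>2 * x \<le> 2 * (1 / y\<^sup>2 * col \<mu>)"
        using 1 by (simp add: col1)
    qed (use 1 x0 T0 in \<open>auto simp: col1\<close>)
  next
    case 2
    show ?thesis unfolding R2_block2[OF 2]
    proof (rule scaled_coordinate_le[OF _ norm_le_y[OF 2] _ B_bounds(3)])
      have "T\<^sup>2 / F\<^sup>2 * y \<le> 1 / y\<^sup>2 * (1 / y)"
        using ratio_estimates(4) y0 mult_right_mono[of "T\<^sup>2 / F\<^sup>2 * (y * y)" "1 / y\<^sup>2" "1 / y"] by simp
      moreover have "1 / E\<^sup>2 * y = 1 / y\<^sup>2 * (1 / y)"
        using y0 by (simp add: E_eq power2_eq_square)
      ultimately have "2 * (T\<^sup>2 / F\<^sup>2 * y) + ll * (1 / E\<^sup>2 * y) \<le> 2 * (1 / y\<^sup>2 * (1 / y)) + ll * (1 / y\<^sup>2 * (1 / y))"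
        by (intro add_mono mult_left_mono) (use kl in auto)
      then show "(2 * T\<^sup>2 / F\<^sup>2 + ll / E\<^sup>2) * y \<le> (2 + ll) * (1 / y\<^sup>2 * col \<mu>)"
        using 2 by (simp add: col2 ring_distribs add_divide_distrib)
    qed (use 2 y0 kl T0 in \<open>auto simp: col2\<close>)
  next
    case 3
    have "cmod (of_real (2 * S / F\<^sup>2) * w e) * N \<le> B * (1 / y\<^sup>2 * col e)"
    proof (rule scaled_coordinate_le[OF _ norm_e_le _ B_bounds(4)])
      have "S / F\<^sup>2 * t \<le> 1 / y\<^sup>2 * (x * y / F)"
        using ratio_estimates(9) x0 y0 mult_right_mono[of "S / F\<^sup>2 * (y * t)" "1 / y * (x * y / F)" "1 / y"]
        by (simp add: power2_eq_square mult_ac)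
      then show "2 * S / F\<^sup>2 * t \<le> 2 * (1 / y\<^sup>2 * col e)"
        by (simp add: cole)
    qed (use x0 y0 F_pos SE_pos in \<open>auto simp: cole\<close>)
    then show ?thesis unfolding 3 R2_e by (simp add: norm_mult)
  qed
qed

lemma large_coordinate:
  fixes v :: cvec
  assumes "finite J" and "real (card J) + 1 \<le> n" and "s = sqrt (1 + (\<Sum>j\<in>J. (cmod (v j))\<^sup>2))"
  shows "(\<exists>j\<in>J. s \<le> cmod (v j) * n) \<or> s\<^sup>2 \<le> n"
proof (rule disjCI)
  assume "\<not> s\<^sup>2 \<le> n"
  then have sn: "s\<^sup>2 > n" by simp
  have s0: "s \<ge> 0" unfolding assms(3) by (simp add: sum_nonneg)
  have n0: "n \<ge> 1" using assms(2) by linarith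
  show "\<exists>j\<in>J. s \<le> cmod (v j) * n"
  proof (rule ccontr)
    assume "\<not> ?thesis"
    then have lt: "cmod (v j) * n \<le> s" if "j \<in> J" for j using that by force
    have "(cmod (v j))\<^sup>2 \<le> s\<^sup>2 / n\<^sup>2" if "j \<in> J" for j
    proof -
      have "(cmod (v j) * n)\<^sup>2 \<le> s\<^sup>2"
        using lt[OF that] n0 by (intro power_mono) auto
      then show ?thesis using n0 by (simp add: power_mult_distrib field_simps)
    qed
    then have "(\<Sum>j\<in>J. (cmod (v j))\<^sup>2) \<le> (\<Sum>j\<in>J. s\<^sup>2 / n\<^sup>2)"
      by (intro sum_mono)
    also have "\<dots> = real (card J) * (s\<^sup>2 / n\<^sup>2)" by simp
    also have "\<dots> \<le> (n - 1) * (s\<^sup>2 / n\<^sup>2)"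
      using assms(2) by (intro mult_right_mono) auto
    finally have "s\<^sup>2 - 1 \<le> (n - 1) * (s\<^sup>2 / n\<^sup>2)"
      unfolding assms(3) by (simp add: sum_nonneg)
    then have "(s\<^sup>2 - 1) * n\<^sup>2 \<le> (n - 1) * (s\<^sup>2 / n\<^sup>2) * n\<^sup>2"
      by (rule mult_right_mono) simp
    then have "(s\<^sup>2 - 1) * n\<^sup>2 \<le> (n - 1) * s\<^sup>2"
      using n0 by simp
    then have "s\<^sup>2 * (n * n - n + 1) \<le> n * n"
      by (simp add: algebra_simps power2_eq_square)
    moreover have "n * (n * n - n + 1) < s\<^sup>2 * (n * n - n + 1)"
    proof (rule mult_strict_right_mono[OF sn])
      have "n * n \<ge> n" using n0 by simp
      then show "0 < n * n - n + 1" by simp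
    qed
    ultimately have "n * (n * n - n + 1) < n * n" by linarith
    then have "n * n - n + 1 < n" using n0 by simp
    moreover have "(n - 1) * (n - 1) \<ge> 0" by simp
    ultimately show False by (simp add: algebra_simps)
  qed
qed

text \<open>
  In each block the row of a coordinate comparable to the norm is replaced by \<open>R1\<close> respectively \<open>R2\<close>.
  If there is none, the norm is bounded and the row is kept.
\<close>

lemma cmod_det_on_blowup_matrix_le:
  "cmod (det_on I A) \<le> fact (card I) * B ^ card I * N\<^sup>2 / (F\<^sup>2 * S ^ card J1 * E ^ card J2)"
proof -
  have x0: "x > 0" and y0: "y > 0" using x_ge_1 y_ge_1 by auto
  have finI: "finite I" using fin by (simp add: I_def)
  have N0: "N > 0" using N_ge_1 by simp
  obtain O1 a1 where O1: "O1 = {} \<and> x\<^sup>2 \<le> N \<or> (\<exists>j\<in>J1. O1 = {j} \<and> x \<le> cmod (w j) * N \<and> a1 = w j)"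
    using large_coordinate[OF fin(1), of N x w] by (auto simp: N_def x_def S_def)
  obtain O2 a2 where O2: "O2 = {} \<and> y\<^sup>2 \<le> N \<or> (\<exists>j\<in>J2. O2 = {j} \<and> y \<le> cmod (w j) * N \<and> a2 = w j)"
    using large_coordinate[OF fin(2), of N y w] by (auto simp: N_def y_def E_def)
  have sub: "O1 \<subseteq> J1" "O2 \<subseteq> J2" using O1 O2 by auto
  have a1: "x \<le> cmod a1 * N" "a1 \<noteq> 0" if "\<nu> \<in> O1" for \<nu> using O1 that x0 by auto
  have a2: "y \<le> cmod a2 * N" "a2 \<noteq> 0" if "\<nu> \<in> O2" for \<nu> using O2 that y0 by auto
  define A1 where "A1 = (\<lambda>\<nu> \<mu>. if \<nu> \<in> O1 then \<Sum>\<kappa>\<in>I. c1 \<kappa> / a1 * A \<kappa> \<mu> else A \<nu> \<mu>)"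
  define A2 where "A2 = (\<lambda>\<nu> \<mu>. if \<nu> \<in> O2 then \<Sum>\<kappa>\<in>I. c2 \<kappa> / a2 * A1 \<kappa> \<mu> else A1 \<nu> \<mu>)"
  have "O1 = {} \<or> (\<exists>a\<in>I. O1 = {a} \<and> c1 a / a1 = 1)"
    using O1 a1 disj by (auto simp: c1_def I_def)
  from det_on_optional_row_combination[OF finI this, of A] have d1: "det_on I A1 = det_on I A"
    by (simp add: A1_def)
  have "O2 = {} \<or> (\<exists>a\<in>I. O2 = {a} \<and> c2 a / a2 = 1)"
    using O2 a2 disj by (auto simp: c2_def I_def)
  from det_on_optional_row_combination[OF finI this, of A1] have d2: "det_on I A2 = det_on I A1"
    by (simp add: A2_def)
  have A2_1: "A2 \<nu> \<mu> = R1 \<mu> / a1" if "\<nu> \<in> O1" for \<nu> \<mu>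
  proof -
    have "\<nu> \<notin> O2" using that sub disj by auto
    then show ?thesis
      using that by (simp add: A2_def A1_def R1_def sum_divide_distrib)
  qed
  have A2_2: "A2 \<nu> \<mu> = R2 \<mu> / a2" if "\<nu> \<in> O2" for \<nu> \<mu>
  proof -
    have "(\<Sum>\<kappa>\<in>I. c2 \<kappa> / a2 * A1 \<kappa> \<mu>) = (\<Sum>\<kappa>\<in>I. c2 \<kappa> / a2 * A \<kappa> \<mu>)"
      using sub by (intro sum.cong) (auto simp: c2_def A1_def)
    then show ?thesis
      using that by (simp add: A2_def R2_def sum_divide_distrib)
  qed
  have A2_0: "A2 \<nu> \<mu> = A \<nu> \<mu>" if "\<nu> \<notin> O1" "\<nu> \<notin> O2" for \<nu> \<mu>
    using that by (simp add: A2_def A1_def)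
  define g where "g \<nu> = (if \<nu> \<in> O1 then 1 / x\<^sup>2 else if \<nu> \<in> O2 then 1 / y\<^sup>2 else 1)" for \<nu>
  have col0: "col \<nu> \<ge> 0" for \<nu> using x0 y0 F_pos by (simp add: col_def)
  have g0: "g \<nu> \<ge> 0" for \<nu> by (simp add: g_def)
  have div: "a / b \<le> c * (1 / s)" if "a * N \<le> c" "s \<le> b * N" "s > 0" "a \<ge> 0" "b > 0" for a b c s :: real
  proof -
    have "a * s \<le> a * (b * N)" using that by (intro mult_left_mono) auto
    also have "\<dots> = a * N * b" by simp
    also have "\<dots> \<le> c * b" using that by (intro mult_right_mono) auto
    finally show ?thesis using that by (simp add: field_simps)
  qed
  have bd: "cmod (A2 \<nu> \<mu>) \<le> B * ((g \<nu> * col \<nu>) * col \<mu>)" if I: "\<nu> \<in> I" "\<mu> \<in> I" for \<nu> \<mu>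
  proof -
    consider "\<nu> \<in> O1" | "\<nu> \<in> O2" "\<nu> \<notin> O1" | "\<nu> \<notin> O1" "\<nu> \<notin> O2" by blast
    then show ?thesis
    proof cases
      case 1
      have "cmod (R1 \<mu>) / cmod a1 \<le> B * (1 / x\<^sup>2 * col \<mu>) * (1 / x)"
        by (rule div[OF R1_le[OF I(2)] a1(1)[OF 1] x0]) (use a1(2)[OF 1] in auto)
      then show ?thesis
        using 1 sub by (simp add: A2_1 norm_divide g_def col1[OF subsetD[OF sub(1) 1]] mult_ac)
    next
      case 2
      have "cmod (R2 \<mu>) / cmod a2 \<le> B * (1 / y\<^sup>2 * col \<mu>) * (1 / y)"
        by (rule div[OF R2_le[OF I(2)] a2(1)[OF 2(1)] y0]) (use a2(2)[OF 2(1)] in auto)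
      then show ?thesis
        using 2 sub by (simp add: A2_2 norm_divide g_def col2[OF subsetD[OF sub(2) 2(1)]] mult_ac)
    next
      case 3
      then show ?thesis using entry_bound[OF I] by (simp add: A2_0 g_def)
    qed
  qed
  have g1: "(\<Prod>\<nu>\<in>J1. g \<nu>) \<le> N / x\<^sup>2"
    using O1
  proof (elim disjE conjE bexE)
    assume "O1 = {}" "x\<^sup>2 \<le> N"
    then have "(\<Prod>\<nu>\<in>J1. g \<nu>) = 1"
      using sub disj by (intro prod.neutral) (auto simp: g_def)
    then show ?thesis using \<open>x\<^sup>2 \<le> N\<close> x0 by simp
  next
    fix j assume j: "j \<in> J1" "O1 = {j}"
    have "(\<Prod>\<nu>\<in>J1. g \<nu>) = (\<Prod>\<nu>\<in>J1. if \<nu> = j then 1 / x\<^sup>2 else 1)"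
      using sub disj j by (intro prod.cong) (auto simp: g_def)
    also have "\<dots> = 1 / x\<^sup>2" using j fin by simp
    also have "\<dots> \<le> N / x\<^sup>2" using N_ge_1 by (intro divide_right_mono) auto
    finally show ?thesis .
  qed
  have g2: "(\<Prod>\<nu>\<in>J2. g \<nu>) \<le> N / y\<^sup>2"
    using O2
  proof (elim disjE conjE bexE)
    assume "O2 = {}" "y\<^sup>2 \<le> N"
    then have "(\<Prod>\<nu>\<in>J2. g \<nu>) = 1"
      using sub disj by (intro prod.neutral) (auto simp: g_def)
    then show ?thesis using \<open>y\<^sup>2 \<le> N\<close> y0 by simp
  next
    fix j assume j: "j \<in> J2" "O2 = {j}"
    have "(\<Prod>\<nu>\<in>J2. g \<nu>) = (\<Prod>\<nu>\<in>J2. if \<nu> = j then 1 / y\<^sup>2 else 1)"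
      using sub disj j by (intro prod.cong) (auto simp: g_def)
    also have "\<dots> = 1 / y\<^sup>2" using j fin by simp
    also have "\<dots> \<le> N / y\<^sup>2" using N_ge_1 by (intro divide_right_mono) auto
    finally show ?thesis .
  qed
  have ge: "g e = 1" using sub disj by (auto simp: g_def)
  have pc: "(\<Prod>\<nu>\<in>I. col \<nu>) = (1 / x) ^ card J1 * (1 / y) ^ card J2 * (x * y / F)"
    unfolding prod_I using cole by (simp add: col1 col2 cong: prod.cong)
  have "(\<Prod>\<nu>\<in>I. g \<nu>) \<le> N / x\<^sup>2 * (N / y\<^sup>2)"
    unfolding prod_I ge using mult_mono[OF g1 g2] g0 N0 by (simp add: prod_nonneg)
  then have pg: "(\<Prod>\<nu>\<in>I. g \<nu>) * ((\<Prod>\<nu>\<in>I. col \<nu>) * (\<Prod>\<nu>\<in>I. col \<nu>))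
      \<le> N / x\<^sup>2 * (N / y\<^sup>2) * ((\<Prod>\<nu>\<in>I. col \<nu>) * (\<Prod>\<nu>\<in>I. col \<nu>))"
    by (rule mult_right_mono) simp
  also have "\<dots> = N\<^sup>2 / (F\<^sup>2 * S ^ card J1 * E ^ card J2)"
    unfolding pc using x0 y0 F_pos
    by (simp add: S_eq E_eq power_mult_distrib power_divide field_simps power2_eq_square)
  finally have pg: "(\<Prod>\<nu>\<in>I. g \<nu>) * ((\<Prod>\<nu>\<in>I. col \<nu>) * (\<Prod>\<nu>\<in>I. col \<nu>))
    \<le> N\<^sup>2 / (F\<^sup>2 * S ^ card J1 * E ^ card J2)" .
  have "cmod (det_on I A) = cmod (det_on I A2)" using d1 d2 by simp
  also have "\<dots> \<le> fact (card I) * (B ^ card I * ((\<Prod>\<nu>\<in>I. g \<nu> * col \<nu>) * (\<Prod>\<nu>\<in>I. col \<nu>)))"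
    using finI B_bounds(6) g0 col0 bd by (intro cmod_det_on_le) auto
  also have "\<dots> = fact (card I) * B ^ card I * ((\<Prod>\<nu>\<in>I. g \<nu>) * ((\<Prod>\<nu>\<in>I. col \<nu>) * (\<Prod>\<nu>\<in>I. col \<nu>)))"
    by (simp add: prod.distrib mult_ac)
  also have "\<dots> \<le> fact (card I) * B ^ card I * (N\<^sup>2 / (F\<^sup>2 * S ^ card J1 * E ^ card J2))"
    using pg B_bounds(6) by (intro mult_left_mono) auto
  finally show ?thesis by simp
qed

end

section \<open>Wirtinger derivatives and the Fubini-Study metric\<close>

text \<open>
  \<open>f\<close> is real differentiable at \<open>w\<close> in the \<open>j\<close>-th coordinate, with derivatives \<open>a\<close> with respect to that
  coordinate and \<open>b\<close> with respect to its conjugate.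
\<close>

definition has_wirtinger :: "(cvec \<Rightarrow> complex) \<Rightarrow> nat \<Rightarrow> cvec \<Rightarrow> complex \<Rightarrow> complex \<Rightarrow> bool" where
  "has_wirtinger f j w a b \<longleftrightarrow>
     ((\<lambda>x. f (w(j := x))) has_derivative (\<lambda>h. a * h + b * cnj h)) (at (w j))"

lemma has_wirtinger_partial:
  assumes "has_wirtinger f j w a b"
  shows "partial v j f w = a * v + b * cnj v"
proof -
  have g: "((\<lambda>t. w j + of_real t * v) has_derivative (\<lambda>t. of_real t * v)) (at 0)"
    by (auto intro!: derivative_eq_intros)
  have f: "((\<lambda>x. f (w(j := x))) has_derivative (\<lambda>h. a * h + b * cnj h)) (at (w j + of_real 0 * v))"
    using assms by (simp add: has_wirtinger_def)
  have "((\<lambda>t. f (w(j := w j + of_real t * v))) has_derivative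
      (\<lambda>t. a * (of_real t * v) + b * cnj (of_real t * v))) (at 0)"
    by (rule has_derivative_compose[OF g f])
  then have "((\<lambda>t. f (w(j := w j + of_real t * v))) has_vector_derivative (a * v + b * cnj v)) (at 0)"
    unfolding has_vector_derivative_def by (simp add: scaleR_conv_of_real algebra_simps)
  then show ?thesis
    unfolding partial_def by (rule vector_derivative_at)
qed

lemma has_wirtinger_imp:
  assumes "has_wirtinger f j w a b"
  shows "wirtinger j f w = a" and "wirtinger_bar j f w = b"
  unfolding wirtinger_def wirtinger_bar_def has_wirtinger_partial[OF assms]
  by (simp_all add: algebra_simps)

lemma has_wirtinger_holomorphic:
  assumes "((\<lambda>x. f (w(j := x))) has_field_derivative a) (at (w j))"
  shows "has_wirtinger f j w a 0" and "has_wirtinger (\<lambda>u. cnj (f u)) j w 0 (cnj a)"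
  using assms has_derivative_cnj[of "\<lambda>x. f (w(j := x))" "\<lambda>h. a * h" "at (w j)"]
  by (simp_all add: has_wirtinger_def has_field_derivative_def)

lemma has_wirtinger_mult:
  assumes "has_wirtinger f j w a b" "has_wirtinger g j w c d"
  shows "has_wirtinger (\<lambda>u. f u * g u) j w (f w * c + a * g w) (f w * d + b * g w)"
  using has_derivative_mult[OF assms[unfolded has_wirtinger_def]]
  unfolding has_wirtinger_def by (simp add: algebra_simps)

lemma has_wirtinger_sum:
  assumes "\<And>i. i \<in> J \<Longrightarrow> has_wirtinger (f i) j w (a i) (b i)"
  shows "has_wirtinger (\<lambda>u. \<Sum>i\<in>J. f i u) j w (\<Sum>i\<in>J. a i) (\<Sum>i\<in>J. b i)"
  using has_derivative_sum[OF assms[unfolded has_wirtinger_def]]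
  unfolding has_wirtinger_def by (simp add: sum.distrib sum_distrib_right)

lemma has_wirtinger_divide:
  assumes "has_wirtinger f j w a b" "has_wirtinger g j w c d" "g w \<noteq> 0"
  shows "has_wirtinger (\<lambda>u. f u / g u) j w
     (a / g w - f w * c / (g w)\<^sup>2) (b / g w - f w * d / (g w)\<^sup>2)"
  unfolding has_wirtinger_def
  by (rule has_derivative_eq_rhs[OF has_derivative_divide'[OF assms(1,2)[unfolded has_wirtinger_def]]])
    (use assms(3) in \<open>auto simp: fun_eq_iff field_simps power2_eq_square\<close>)

lemma has_wirtinger_ln:
  fixes u :: "cvec \<Rightarrow> real"
  assumes d: "has_wirtinger (\<lambda>w. of_real (u w)) j w a b" and pos: "u w > 0"
  shows "has_wirtinger (\<lambda>w. of_real (ln (u w))) j w (a / of_real (u w)) (b / of_real (u w))"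
proof -
  let ?D = "\<lambda>h. a * h + b * cnj h"
  have u: "((\<lambda>x. u (w(j := x))) has_derivative (\<lambda>h. Re (?D h))) (at (w j))"
    using has_derivative_Re[OF d[unfolded has_wirtinger_def]] by simp
  have "((\<lambda>x. complex_of_real (u (w(j := x)))) has_derivative (\<lambda>h. of_real (Re (?D h)))) (at (w j))"
    using has_derivative_of_real[OF u] .
  then have real: "of_real (Re (?D h)) = ?D h" for h
    using has_derivative_unique[OF _ d[unfolded has_wirtinger_def]] by (metis (no_types, lifting))
  have "((\<lambda>x. ln (u (w(j := x)))) has_derivative (\<lambda>h. Re (?D h) * inverse (u w))) (at (w j))"
    using has_derivative_ln[OF _ u] pos by (simp add: divide_inverse mult.commute)
  from has_derivative_of_real[OF this]
  have "((\<lambda>x. complex_of_real (ln (u (w(j := x))))) has_derivative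
      (\<lambda>h. of_real (Re (?D h) * inverse (u w)))) (at (w j))" .
  also have "(\<lambda>h. complex_of_real (Re (?D h) * inverse (u w)))
     = (\<lambda>h. a / of_real (u w) * h + b / of_real (u w) * cnj h)"
    unfolding of_real_mult real by (simp add: fun_eq_iff divide_inverse algebra_simps)
  finally show ?thesis unfolding has_wirtinger_def .
qed

text \<open>
  The second derivatives of the lift (assumption \<open>ddF\<close>) do not appear in the formula: the conjugate of a holomorphic
  function has no holomorphic derivative.
\<close>

lemma fubini_study_eq:
  fixes F :: "cvec \<Rightarrow> cvec" and dF :: "nat \<Rightarrow> cvec \<Rightarrow> nat \<Rightarrow> complex"
  assumes dF: "\<And>u j \<nu>. j \<in> J \<Longrightarrow> ((\<lambda>x. F (u(\<nu> := x)) j) has_field_derivative dF \<nu> u j) (at (u \<nu>))"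
    and ddF: "\<And>u j \<nu> \<mu>. j \<in> J \<Longrightarrow> \<exists>a. ((\<lambda>x. dF \<mu> (u(\<nu> := x)) j) has_field_derivative a) (at (u \<nu>))"
    and pos: "\<And>u. (\<Sum>j\<in>J. (cmod (F u j))\<^sup>2) > 0"
  defines "N \<equiv> \<lambda>u. \<Sum>j\<in>J. (cmod (F u j))\<^sup>2"
  shows "fubini_study J F w \<nu> \<mu> =
    (\<Sum>j\<in>J. dF \<nu> w j * cnj (dF \<mu> w j)) / of_real (N w)
    - (\<Sum>j\<in>J. dF \<nu> w j * cnj (F w j)) * (\<Sum>j\<in>J. F w j * cnj (dF \<mu> w j)) / (of_real (N w))\<^sup>2"
proof -
  have N: "of_real (N u) = (\<Sum>j\<in>J. F u j * cnj (F u j))" for u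
    unfolding N_def of_real_sum complex_norm_square ..
  have N0: "N u > 0" for u using pos by (simp add: N_def)
  have dN: "has_wirtinger (\<lambda>w. of_real (N w)) \<kappa> u (\<Sum>j\<in>J. dF \<kappa> u j * cnj (F u j))
    (\<Sum>j\<in>J. F u j * cnj (dF \<kappa> u j))" for \<kappa> u
    unfolding N
    by (rule has_wirtinger_sum)
      (use has_wirtinger_mult[OF has_wirtinger_holomorphic[OF dF]] in simp)
  have bar: "wirtinger_bar \<mu> (\<lambda>u. of_real (ln (N u))) u = (\<Sum>j\<in>J. F u j * cnj (dF \<mu> u j)) / of_real (N u)" for u
    using has_wirtinger_imp(2)[OF has_wirtinger_ln[OF dN N0]] .
  have "has_wirtinger (\<lambda>u. \<Sum>j\<in>J. F u j * cnj (dF \<mu> u j)) \<nu> w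
      (\<Sum>j\<in>J. dF \<nu> w j * cnj (dF \<mu> w j)) (\<Sum>j\<in>J. F w j * cnj (SOME a. ((\<lambda>x. dF \<mu> (w(\<nu> := x)) j) has_field_derivative a) (at (w \<nu>))))"
  proof (rule has_wirtinger_sum)
    fix j assume j: "j \<in> J"
    have "((\<lambda>x. dF \<mu> (w(\<nu> := x)) j) has_field_derivative
       (SOME a. ((\<lambda>x. dF \<mu> (w(\<nu> := x)) j) has_field_derivative a) (at (w \<nu>)))) (at (w \<nu>))"
      using ddF[OF j] by (rule someI_ex)
    from has_wirtinger_mult[OF has_wirtinger_holomorphic(1)[OF dF[OF j]] has_wirtinger_holomorphic(2)[of "\<lambda>u. dF \<mu> u j", OF this]]
    show "has_wirtinger (\<lambda>u. F u j * cnj (dF \<mu> u j)) \<nu> w (dF \<nu> w j * cnj (dF \<mu> w j))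
      (F w j * cnj (SOME a. ((\<lambda>x. dF \<mu> (w(\<nu> := x)) j) has_field_derivative a) (at (w \<nu>))))"
      by simp
  qed
  from has_wirtinger_imp(1)[OF has_wirtinger_divide[OF this dN]] N0[of w]
  have "wirtinger \<nu> (wirtinger_bar \<mu> (\<lambda>u. of_real (ln (N u)))) w =
    (\<Sum>j\<in>J. dF \<nu> w j * cnj (dF \<mu> w j)) / of_real (N w)
    - (\<Sum>j\<in>J. F w j * cnj (dF \<mu> w j)) * (\<Sum>j\<in>J. dF \<nu> w j * cnj (F w j)) / (of_real (N w))\<^sup>2"
    unfolding bar[abs_def] by simp
  moreover have "fubini_study J F = ddbar (\<lambda>w. ln (N w))"
    by (simp add: fubini_study_def N_def)
  ultimately show ?thesis
    unfolding ddbar_def by (simp only: mult.commute)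
qed

section \<open>The chain rule in coordinates\<close>

lemma coord_space_upd: "w \<in> coord_space I \<Longrightarrow> j \<in> I \<Longrightarrow> w(j := x) \<in> coord_space I"
  by (auto simp: coord_space_def PiE_iff extensional_def)

lemma tendsto_coordinatewise:
  fixes X :: "'a \<Rightarrow> nat \<Rightarrow> complex"
  assumes "\<And>i. ((\<lambda>n. X n i) \<longlongrightarrow> l i) F"
  shows "(X \<longlongrightarrow> l) F"
proof -
  have "limitin (product_topology (\<lambda>i. euclidean) UNIV) X l F"
    unfolding limitin_componentwise using assms by simp
  then show ?thesis by (simp add: euclidean_product_topology)
qed

text \<open>
  Points of \<open>coord_space I\<close> agree outside \<open>I\<close>, so a neighbourhood only restricts the coordinates in \<open>I\<close>.
\<close>

lemma coordinate_neighbourhood: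
  fixes g :: "cvec \<Rightarrow> real"
  assumes cont: "continuous_on (coord_space I) g" and w: "w \<in> coord_space I" and e: "e > 0"
  shows "\<exists>\<delta>>0. \<forall>u\<in>coord_space I. (\<forall>j\<in>I. cmod (u j - w j) < \<delta>) \<longrightarrow> \<bar>g u - g w\<bar> < e"
proof (rule ccontr)
  assume "\<not> ?thesis"
  then have "\<exists>u\<in>coord_space I. (\<forall>j\<in>I. cmod (u j - w j) < 1 / Suc n) \<and> \<not> \<bar>g u - g w\<bar> < e" for n :: nat
    by (metis of_nat_0_less_iff zero_less_Suc zero_less_divide_1_iff)
  then obtain u where u: "\<And>n. u n \<in> coord_space I" "\<And>n j. j \<in> I \<Longrightarrow> cmod (u n j - w j) < 1 / Suc n"
    "\<And>n. \<not> \<bar>g (u n) - g w\<bar> < e" by metis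
  have "u \<longlonglongrightarrow> w"
  proof (rule tendsto_coordinatewise)
    fix j
    show "(\<lambda>n. u n j) \<longlonglongrightarrow> w j"
    proof (cases "j \<in> I")
      case True
      have "(\<lambda>n. u n j - w j) \<longlonglongrightarrow> 0"
        by (rule Lim_null_comparison[OF _ lim_1_over_n[THEN LIMSEQ_Suc]])
          (use u(2)[OF True] in \<open>auto intro!: always_eventually less_imp_le\<close>)
      then show ?thesis by (rule LIM_zero_cancel)
    next
      case False
      then have "u n j = w j" for n
        using u(1)[of n] w by (auto simp: coord_space_def PiE_iff extensional_def)
      then show ?thesis by simp
    qed
  qed
  then have "(\<lambda>n. g (u n)) \<longlonglongrightarrow> g w"
    by (rule continuous_on_tendsto_compose[OF cont _ w]) (simp add: u(1))
  then have "eventually (\<lambda>n. dist (g (u n)) (g w) < e) sequentially"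
    using e by (rule tendstoD)
  then obtain n where "dist (g (u n)) (g w) < e"
    using eventually_happens'[OF sequentially_bot] by blast
  then show False using u(3)[of n] by (simp add: dist_real_def)
qed

text \<open>
  Partial derivatives exist and are continuous in the real directions of all coordinates. The imaginary
  directions are left out because only curves with real coordinates are considered below.
\<close>

definition partially_differentiable :: "nat set \<Rightarrow> (cvec \<Rightarrow> real) \<Rightarrow> bool" where
  "partially_differentiable I f \<longleftrightarrow> (\<forall>j\<in>I. continuous_on (coord_space I) (partial 1 j f) \<and>
     (\<forall>w\<in>coord_space I. (\<lambda>t::real. f (w(j := w j + of_real t * 1))) differentiable (at 0)))"

lemma partial_has_vector_derivative:
  fixes f :: "cvec \<Rightarrow> 'b::real_normed_vector"
  assumes "(\<lambda>t::real. f (w(j := w j + of_real t * v))) differentiable (at 0)"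
  shows "((\<lambda>t. f (w(j := w j + of_real t * v))) has_vector_derivative partial v j f w) (at 0)"
  using assms unfolding partial_def by (simp add: vector_derivative_works)

lemma partial_along_line:
  fixes f :: "cvec \<Rightarrow> real"
  assumes "(\<lambda>t::real. f ((w(j := w j + of_real s * v))(j := (w(j := w j + of_real s * v)) j + of_real t * v)))
    differentiable (at 0)"
  shows "((\<lambda>t. f (w(j := w j + of_real t * v))) has_real_derivative partial v j f (w(j := w j + of_real s * v))) (at s)"
proof -
  have "((\<lambda>t. f (w(j := w j + of_real s * v + of_real t * v))) has_real_derivative
     partial v j f (w(j := w j + of_real s * v))) (at 0)"
    using partial_has_vector_derivative[OF assms]
    by (simp only: has_real_derivative_iff_has_vector_derivative fun_upd_upd fun_upd_same)
  then have "((\<lambda>t. f (w(j := w j + of_real (t + s) * v))) has_real_derivative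
     partial v j f (w(j := w j + of_real s * v))) (at 0)"
    by (simp add: ring_distribs ac_simps)
  then show ?thesis
    using DERIV_shift[of "\<lambda>t. f (w(j := w j + of_real t * v))" _ 0 s] by simp
qed

text \<open>
  Differentiability from continuity of the partial derivatives, changing one coordinate at a time.
\<close>

lemma increment_estimate:
  assumes fin: "finite I" and pd: "partially_differentiable I f" and w: "w \<in> coord_space I" and e: "e > 0"
  shows "\<exists>\<delta>>0. \<forall>h::nat \<Rightarrow> real. (\<forall>j\<in>I. \<bar>h j\<bar> < \<delta>) \<longrightarrow>
    \<bar>f (\<lambda>j. if j \<in> I then w j + of_real (h j) else w j) - f w - (\<Sum>j\<in>I. partial 1 j f w * h j)\<bar>
      \<le> e * (\<Sum>j\<in>I. \<bar>h j\<bar>)"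
proof -
  have "\<exists>\<delta>>0. \<forall>u\<in>coord_space I. (\<forall>l\<in>I. cmod (u l - w l) < \<delta>) \<longrightarrow> \<bar>partial 1 j f u - partial 1 j f w\<bar> < e"
    if "j \<in> I" for j
    using pd that by (intro coordinate_neighbourhood[OF _ w e]) (auto simp: partially_differentiable_def)
  then obtain d where d: "\<And>j. j \<in> I \<Longrightarrow> d j > 0"
    "\<And>j u. j \<in> I \<Longrightarrow> u \<in> coord_space I \<Longrightarrow> \<forall>l\<in>I. cmod (u l - w l) < d j
       \<Longrightarrow> \<bar>partial 1 j f u - partial 1 j f w\<bar> < e" by metis
  define \<delta> where "\<delta> = Min (insert 1 (d ` I))"
  have \<delta>: "\<delta> > 0" "\<And>j. j \<in> I \<Longrightarrow> \<delta> \<le> d j"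
    unfolding \<delta>_def using fin d(1) by (auto simp: Min_gr_iff)
  have main: "\<bar>f (\<lambda>j. if j \<in> J then w j + of_real (h j) else w j) - f w - (\<Sum>j\<in>J. partial 1 j f w * h j)\<bar>
      \<le> e * (\<Sum>j\<in>J. \<bar>h j\<bar>)" if h: "\<forall>j\<in>I. \<bar>h j\<bar> < \<delta>" and J: "finite J" "J \<subseteq> I" for h :: "nat \<Rightarrow> real" and J
    using J
  proof (induction J rule: finite_induct)
    case (insert j J)
    then have jI: "j \<in> I" by simp
    define u where "u = (\<lambda>l. if l \<in> J then w l + of_real (h l) else w l)"
    have uI: "u \<in> coord_space I"
      using w insert.prems by (auto simp: u_def coord_space_def PiE_iff extensional_def)
    let ?g = "\<lambda>t. f (u(j := u j + of_real t * 1))"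
    have "(?g has_real_derivative partial 1 j f (u(j := u j + of_real s * 1))) (at s)" for s
      using pd jI coord_space_upd[OF uI jI] unfolding partially_differentiable_def
      by (intro partial_along_line) blast
    then have g: "((\<lambda>t. ?g t - partial 1 j f w * t) has_real_derivative
        partial 1 j f (u(j := u j + of_real s * 1)) - partial 1 j f w) (at s)" for s
      by (auto intro!: derivative_eq_intros)
    have "norm ((?g (h j) - partial 1 j f w * h j) - (?g 0 - partial 1 j f w * 0)) \<le> e * norm (h j - 0)"
    proof (rule field_differentiable_bound[of "{-\<bar>h j\<bar>..\<bar>h j\<bar>}"])
      fix s assume s: "s \<in> {-\<bar>h j\<bar>..\<bar>h j\<bar>}"
      show "((\<lambda>t. ?g t - partial 1 j f w * t) has_real_derivative
        partial 1 j f (u(j := u j + of_real s * 1)) - partial 1 j f w) (at s within {-\<bar>h j\<bar>..\<bar>h j\<bar>})"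
        using g by (rule has_field_derivative_at_within)
      have "\<forall>l\<in>I. cmod ((u(j := u j + of_real s * 1)) l - w l) < d j"
      proof
        fix l assume l: "l \<in> I"
        have "\<bar>s\<bar> < \<delta>" "\<bar>h l\<bar> < \<delta>" using s h jI l by auto
        then have "\<bar>s\<bar> < d j" "\<bar>h l\<bar> < d j" "0 < d j" using \<delta>(2)[OF jI] d(1)[OF jI] by linarith+
        then show "cmod ((u(j := u j + of_real s * 1)) l - w l) < d j"
          using insert.hyps(2) by (auto simp: u_def)
      qed
      then show "norm (partial 1 j f (u(j := u j + of_real s * 1)) - partial 1 j f w) \<le> e"
        using d(2)[OF jI coord_space_upd[OF uI jI]] by (simp add: less_imp_le)
    qed auto
    moreover have "u(j := u j + of_real (h j) * 1) = (\<lambda>l. if l \<in> insert j J then w l + of_real (h l) else w l)"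
      using insert.hyps(2) by (auto simp: u_def)
    moreover have "u(j := u j + of_real 0 * 1) = u" by simp
    ultimately have "\<bar>f (\<lambda>l. if l \<in> insert j J then w l + of_real (h l) else w l) - partial 1 j f w * h j - f u\<bar>
        \<le> e * \<bar>h j\<bar>" by simp
    moreover have "\<bar>f u - f w - (\<Sum>j\<in>J. partial 1 j f w * h j)\<bar> \<le> e * (\<Sum>j\<in>J. \<bar>h j\<bar>)"
      using insert by (simp add: u_def)
    ultimately show ?case
      using insert.hyps by (simp add: ring_distribs)
  qed simp
  show ?thesis using main[OF _ fin subset_refl] \<delta>(1) by blast
qed

lemma chain_rule_real_curve:
  assumes fin: "finite I" and pd: "partially_differentiable I f"
    and \<gamma>: "\<And>s. \<gamma> s \<in> coord_space I" and c: "\<And>s j. j \<in> I \<Longrightarrow> \<gamma> s j = of_real (c j s)"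
    and d: "\<And>j. j \<in> I \<Longrightarrow> (c j has_real_derivative d j) (at s0)"
  shows "((\<lambda>s. f (\<gamma> s)) has_real_derivative (\<Sum>j\<in>I. partial 1 j f (\<gamma> s0) * d j)) (at s0)"
proof -
  let ?p = "\<lambda>j. partial 1 j f (\<gamma> s0)"
  let ?q = "\<lambda>j s. (c j s - c j s0) / (s - s0)"
  define r where "r s = (f (\<gamma> s) - f (\<gamma> s0) - (\<Sum>j\<in>I. ?p j * (c j s - c j s0))) / (s - s0)" for s
  have q: "(?q j \<longlongrightarrow> d j) (at s0)" if "j \<in> I" for j
    using d[OF that] by (simp add: has_field_derivative_iff)
  define D where "D = (\<Sum>j\<in>I. \<bar>d j\<bar>)"
  have D0: "D \<ge> 0" by (simp add: D_def sum_nonneg)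
  have "(r \<longlongrightarrow> 0) (at s0)"
  proof (rule tendstoI)
    fix e :: real assume e: "e > 0"
    let ?e = "e / (D + 1)"
    have e': "?e > 0" using e D0 by simp
    obtain \<delta> where \<delta>: "\<delta> > 0" "\<And>h::nat \<Rightarrow> real. (\<forall>j\<in>I. \<bar>h j\<bar> < \<delta>) \<Longrightarrow>
      \<bar>f (\<lambda>j. if j \<in> I then \<gamma> s0 j + of_real (h j) else \<gamma> s0 j) - f (\<gamma> s0) - (\<Sum>j\<in>I. ?p j * h j)\<bar>
      \<le> ?e * (\<Sum>j\<in>I. \<bar>h j\<bar>)"
      using increment_estimate[OF fin pd \<gamma>[of s0] e'] by blast
    have "((\<lambda>s. \<Sum>j\<in>I. \<bar>?q j s\<bar>) \<longlongrightarrow> D) (at s0)"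
      unfolding D_def by (intro tendsto_sum tendsto_rabs q)
    then have "eventually (\<lambda>s. (\<Sum>j\<in>I. \<bar>?q j s\<bar>) < D + 1) (at s0)"
      by (rule order_tendstoD) simp
    moreover have "eventually (\<lambda>s. \<forall>j\<in>I. \<bar>c j s - c j s0\<bar> < \<delta>) (at s0)"
    proof (rule eventually_ball_finite[OF fin], rule ballI)
      fix j assume "j \<in> I"
      then have "isCont (c j) s0" using d DERIV_isCont by blast
      then have "(c j \<longlongrightarrow> c j s0) (at s0)" by (simp add: isCont_def)
      from tendstoD[OF this \<delta>(1)] show "eventually (\<lambda>s. \<bar>c j s - c j s0\<bar> < \<delta>) (at s0)"
        by (simp add: dist_real_def)
    qed
    moreover have "eventually (\<lambda>s. s \<noteq> s0) (at s0)"
      by (simp add: eventually_at_filter)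
    ultimately show "eventually (\<lambda>s. dist (r s) 0 < e) (at s0)"
    proof eventually_elim
      case (elim s)
      have "(\<lambda>j. if j \<in> I then \<gamma> s0 j + of_real (c j s - c j s0) else \<gamma> s0 j) = \<gamma> s"
        using \<gamma>[of s] \<gamma>[of s0] c
        by (auto simp: fun_eq_iff coord_space_def PiE_iff extensional_def)
      with \<delta>(2)[of "\<lambda>j. c j s - c j s0"] elim
      have "\<bar>f (\<gamma> s) - f (\<gamma> s0) - (\<Sum>j\<in>I. ?p j * (c j s - c j s0))\<bar> \<le> ?e * (\<Sum>j\<in>I. \<bar>c j s - c j s0\<bar>)"
        by simp
      then have "\<bar>r s\<bar> \<le> ?e * (\<Sum>j\<in>I. \<bar>c j s - c j s0\<bar>) / \<bar>s - s0\<bar>"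
        unfolding r_def abs_divide by (intro divide_right_mono) auto
      also have "\<dots> = ?e * (\<Sum>j\<in>I. \<bar>?q j s\<bar>)"
        by (simp add: abs_divide flip: sum_divide_distrib)
      also have "\<dots> < ?e * (D + 1)"
        using elim e' by (intro mult_strict_left_mono) auto
      also have "\<dots> = e" using D0 by simp
      finally show ?case by simp
    qed
  qed
  then have "((\<lambda>s. r s + (\<Sum>j\<in>I. ?p j * ?q j s)) \<longlongrightarrow> 0 + (\<Sum>j\<in>I. ?p j * d j)) (at s0)"
    by (intro tendsto_add tendsto_sum tendsto_mult_left q)
  also have "(\<lambda>s. r s + (\<Sum>j\<in>I. ?p j * ?q j s)) = (\<lambda>s. (f (\<gamma> s) - f (\<gamma> s0)) / (s - s0))"
  proof
    fix s
    have "(\<Sum>j\<in>I. ?p j * ?q j s) = (\<Sum>j\<in>I. ?p j * (c j s - c j s0)) / (s - s0)"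
      by (simp add: sum_divide_distrib)
    then show "r s + (\<Sum>j\<in>I. ?p j * ?q j s) = (f (\<gamma> s) - f (\<gamma> s0)) / (s - s0)"
      unfolding r_def by (simp flip: add_divide_distrib)
  qed
  finally show ?thesis by (simp add: has_field_derivative_iff)
qed

section \<open>Functions invariant under rotation of the coordinates\<close>

lemma Ck_mono: "Ck (Suc n) I f \<Longrightarrow> Ck n I f"
proof (induction n arbitrary: f)
  case (Suc n)
  show ?case
    unfolding Ck.simps(2)[of n]
  proof (intro conjI ballI)
    show "continuous_on (coord_space I) f" using Suc.prems by simp
    fix j v assume j: "j \<in> I" "v \<in> {1, \<i>}"
    have p: "\<forall>j\<in>I. \<forall>v\<in>{1, \<i>}.
        (\<forall>w\<in>coord_space I. (\<lambda>t::real. f (w(j := w j + of_real t * v))) differentiable (at 0)) \<and>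
        Ck (Suc n) I (partial v j f)"
      using Suc.prems unfolding Ck.simps(2)[of "Suc n"] by (rule conjunct2)
    show "Ck n I (partial v j f)"
      using p j Suc.IH by blast
    fix w assume "w \<in> coord_space I"
    then show "(\<lambda>t::real. f (w(j := w j + of_real t * v))) differentiable (at 0)"
      using p j by blast
  qed
qed simp

lemma Ck_SucD:
  assumes "Ck (Suc n) I f" "j \<in> I" "v \<in> {1, \<i>}"
  shows "Ck n I (partial v j f)"
    and "w \<in> coord_space I \<Longrightarrow> (\<lambda>t::real. f (w(j := w j + of_real t * v))) differentiable (at 0)"
  using assms unfolding Ck.simps(2) by blast+

lemma Ck_continuous: "Ck n I f \<Longrightarrow> continuous_on (coord_space I) f"
  by (cases n) auto

lemma Ck_partially_differentiable:
  assumes "Ck (Suc n) I f"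
  shows "partially_differentiable I f"
  unfolding partially_differentiable_def
  using Ck_SucD[OF assms, of _ 1] Ck_continuous by blast

lemma partial_of_real:
  assumes "(\<lambda>t::real. f (w(j := w j + of_real t * v))) differentiable (at 0)"
  shows "((\<lambda>t. complex_of_real (f (w(j := w j + of_real t * v)))) has_vector_derivative of_real (partial v j f w)) (at 0)"
    and "partial v j (\<lambda>u. complex_of_real (f u)) w = of_real (partial v j f w)"
proof -
  show *: "((\<lambda>t. complex_of_real (f (w(j := w j + of_real t * v)))) has_vector_derivative of_real (partial v j f w)) (at 0)"
    using partial_has_vector_derivative[OF assms]
    by (rule bounded_linear.has_vector_derivative[OF bounded_linear_of_real])
  show "partial v j (\<lambda>u. complex_of_real (f u)) w = of_real (partial v j f w)"
    unfolding partial_def[of v j "\<lambda>u. complex_of_real (f u)"] using * by (rule vector_derivative_at)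
qed

text \<open>
  The imaginary part is a difference of mixed derivatives and is not needed: below, the Hessian is only
  evaluated on vectors with real components.
\<close>

lemma Re_ddbar:
  assumes C2: "Ck (Suc (Suc n)) I f" and w: "w \<in> coord_space I" and I: "\<nu> \<in> I" "\<mu> \<in> I"
  shows "Re (ddbar f w \<nu> \<mu>) = (partial 1 \<nu> (partial 1 \<mu> f) w + partial \<i> \<nu> (partial \<i> \<mu> f) w) / 4"
proof -
  have bar: "wirtinger_bar \<mu> (\<lambda>u. of_real (f u)) u = (of_real (partial 1 \<mu> f u) + \<i> * of_real (partial \<i> \<mu> f u)) / 2"
    if "u \<in> coord_space I" for u
    unfolding wirtinger_bar_def
    using Ck_SucD(2)[OF C2 I(2) _ that] by (simp only: partial_of_real insertI1 insertI2)
  have outer: "partial v \<nu> (wirtinger_bar \<mu> (\<lambda>u. of_real (f u))) w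
      = (of_real (partial v \<nu> (partial 1 \<mu> f) w) + \<i> * of_real (partial v \<nu> (partial \<i> \<mu> f) w)) / 2"
    if v: "v \<in> {1, \<i>}" for v
  proof -
    have d: "((\<lambda>t. complex_of_real (partial v' \<mu> f (w(\<nu> := w \<nu> + of_real t * v)))) has_vector_derivative
        of_real (partial v \<nu> (partial v' \<mu> f) w)) (at 0)" if "v' \<in> {1, \<i>}" for v'
      using Ck_SucD(2)[OF Ck_SucD(1)[OF C2 I(2) that] I(1) v w] by (rule partial_of_real)
    have "((\<lambda>t. (of_real (partial 1 \<mu> f (w(\<nu> := w \<nu> + of_real t * v)))
        + \<i> * of_real (partial \<i> \<mu> f (w(\<nu> := w \<nu> + of_real t * v)))) / 2) has_vector_derivative
        (of_real (partial v \<nu> (partial 1 \<mu> f) w) + \<i> * of_real (partial v \<nu> (partial \<i> \<mu> f) w)) / 2) (at 0)"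
      by (intro has_vector_derivative_divide has_vector_derivative_add has_vector_derivative_mult_right d) auto
    also have "(\<lambda>t. (of_real (partial 1 \<mu> f (w(\<nu> := w \<nu> + of_real t * v)))
        + \<i> * of_real (partial \<i> \<mu> f (w(\<nu> := w \<nu> + of_real t * v)))) / 2)
        = (\<lambda>t. wirtinger_bar \<mu> (\<lambda>u. of_real (f u)) (w(\<nu> := w \<nu> + of_real t * v)))"
      unfolding bar[OF coord_space_upd[OF w I(1)]] ..
    finally show ?thesis
      unfolding partial_def[of v \<nu> "wirtinger_bar \<mu> (\<lambda>u. complex_of_real (f u))"] by (rule vector_derivative_at)
  qed
  show ?thesis
    unfolding ddbar_def wirtinger_def outer[OF insertI1] outer[OF insertI2[OF singletonI]]
    by (simp add: field_simps)
qed

lemma even_has_vector_derivative_zero: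
  fixes g :: "real \<Rightarrow> real"
  assumes "(g has_real_derivative D) (at 0)" and "\<And>t. g (- t) = g t"
  shows "D = 0"
proof -
  have "((\<lambda>t::real. - t) has_real_derivative - 1) (at 0)"
    by (auto intro!: derivative_eq_intros)
  then have "((\<lambda>t. g (- t)) has_real_derivative D * - 1) (at 0)"
    using assms(1) by (intro DERIV_chain2[of g D]) simp_all
  then have "(g has_real_derivative - D) (at 0)" unfolding assms(2) by simp
  then have "- D = D" using assms(1) DERIV_unique by blast
  then show ?thesis by simp
qed

text \<open>
  The value depends only on the moduli of the coordinates, at points where all of them are nonzero.
\<close>

definition torus_invariant :: "nat set \<Rightarrow> (cvec \<Rightarrow> real) \<Rightarrow> bool" where
  "torus_invariant I f \<longleftrightarrow> (\<forall>w\<in>coord_space I. (\<forall>j\<in>I. w j \<noteq> 0) \<longrightarrow>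
     f w = f (\<lambda>j. if j \<in> I then of_real (cmod (w j)) else w j))"

lemma torus_invariant_upd:
  assumes inv: "torus_invariant I f" and w: "w \<in> coord_space I" "\<forall>j\<in>I. w j \<noteq> 0" and j: "j \<in> I"
    and z: "z \<noteq> 0" "cmod z = cmod z'"
  shows "f (w(j := z)) = f (w(j := z'))"
proof -
  have z': "z' \<noteq> 0" using z by auto
  have "f (w(j := z)) = f (\<lambda>l. if l \<in> I then of_real (cmod ((w(j := z)) l)) else (w(j := z)) l)"
    using inv coord_space_upd[OF w(1) j] w(2) z(1) by (simp add: torus_invariant_def)
  also have "(\<lambda>l. if l \<in> I then complex_of_real (cmod ((w(j := z)) l)) else (w(j := z)) l)
    = (\<lambda>l. if l \<in> I then of_real (cmod ((w(j := z')) l)) else (w(j := z')) l)"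
    using z(2) j by auto
  also have "f \<dots> = f (w(j := z'))"
    using inv coord_space_upd[OF w(1) j] w(2) z' by (simp add: torus_invariant_def)
  finally show ?thesis .
qed

text \<open>
  At a real coordinate the function is even in the imaginary direction.
\<close>

lemma partial_i_torus_invariant:
  assumes C1: "Ck (Suc n) I f" and inv: "torus_invariant I f"
    and w: "w \<in> coord_space I" "\<forall>j\<in>I. w j \<noteq> 0" and j: "j \<in> I" and r: "w j = of_real r"
  shows "partial \<i> j f w = 0"
proof -
  let ?g = "\<lambda>t. f (w(j := w j + of_real t * \<i>))"
  have "(?g has_real_derivative partial \<i> j f w) (at 0)"
    using partial_has_vector_derivative[where f = f and w = w and j = j and v = \<i>,
        OF Ck_SucD(2)[OF C1 j _ w(1)]]
    by (simp add: has_real_derivative_iff_has_vector_derivative)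
  moreover have "?g (- t) = ?g t" for t
  proof (rule torus_invariant_upd[OF inv w j])
    have "r \<noteq> 0" using r w(2) j by auto
    then show "w j + of_real (- t) * \<i> \<noteq> 0" by (auto simp: r complex_eq_iff)
    show "cmod (w j + of_real (- t) * \<i>) = cmod (w j + of_real t * \<i>)"
      by (simp add: r cmod_def)
  qed
  ultimately show ?thesis by (rule even_has_vector_derivative_zero)
qed

text \<open>At a point with positive real coordinates, rotational invariance expresses the second
  derivatives in the imaginary directions by first derivatives in the radial directions.\<close>

lemma partial_i_i_torus_invariant:
  assumes C2: "Ck (Suc (Suc n)) I f" and inv: "torus_invariant I f"
    and w: "w \<in> coord_space I" and r: "\<And>j. j \<in> I \<Longrightarrow> w j = of_real (r j) \<and> r j > 0"
    and I: "\<nu> \<in> I" "\<mu> \<in> I"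
  shows "partial \<i> \<nu> (partial \<i> \<mu> f) w = (if \<nu> = \<mu> then partial 1 \<nu> f w / r \<nu> else 0)"
proof -
  have w0: "\<forall>j\<in>I. w j \<noteq> 0"
  proof
    fix j assume "j \<in> I"
    with r[of j] show "w j \<noteq> 0" by auto
  qed
  have C1: "Ck (Suc n) I f" using C2 by (rule Ck_mono)
  have nz: "w \<nu> + of_real t * \<i> \<noteq> 0" for t
    using r[OF I(1)] by (auto simp: complex_eq_iff)
  let ?g = "\<lambda>t. partial \<i> \<mu> f (w(\<nu> := w \<nu> + of_real t * \<i>))"
  have g: "(?g has_real_derivative partial \<i> \<nu> (partial \<i> \<mu> f) w) (at 0)"
    using partial_has_vector_derivative[where f = "partial \<i> \<mu> f" and w = w and j = \<nu> and v = \<i>,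
        OF Ck_SucD(2)[OF Ck_SucD(1)[OF C2 I(2)] I(1) _ w]]
    by (simp add: has_real_derivative_iff_has_vector_derivative)
  show ?thesis
  proof (cases "\<nu> = \<mu>")
    case False
    have "?g t = 0" for t
      using partial_i_torus_invariant[OF C1 inv coord_space_upd[OF w I(1)] _ I(2)] w0 nz r[OF I(2)] False
      by simp
    then have "(?g has_real_derivative 0) (at 0)" by simp
    with g False show ?thesis using DERIV_unique by auto
  next
    case True
    define a where "a = r \<nu>"
    have a: "a > 0" "w \<nu> = of_real a" using r[OF I(1)] by (auto simp: a_def)
    define \<rho> where "\<rho> t = sqrt (a\<^sup>2 + t\<^sup>2)" for t
    have \<rho>: "\<rho> t > 0" for t using a by (simp add: \<rho>_def add_pos_nonneg)
    define h' where "h' s = partial 1 \<nu> f (w(\<nu> := of_real s))" for s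
    have h: "((\<lambda>s. f (w(\<nu> := of_real s))) has_real_derivative h' s) (at s)" for s
      using partial_along_line[of f "w(\<nu> := 0)" \<nu> s 1] Ck_SucD(2)[OF C2 I(1) _ coord_space_upd[OF w I(1)], of 1]
      by (simp add: h'_def)
    have fg: "f (w(\<nu> := w \<nu> + of_real t * \<i>)) = f (w(\<nu> := of_real (\<rho> t)))" for t
      by (rule torus_invariant_upd[OF inv w w0 I(1) nz])
        (use \<rho>[of t] in \<open>simp add: a cmod_def \<rho>_def\<close>)
    have d\<rho>: "(\<rho> has_real_derivative t / \<rho> t) (at t)" for t
      unfolding \<rho>_def using \<rho>[of t, unfolded \<rho>_def]
      by (auto intro!: derivative_eq_intros simp: field_simps)
    have "?g t = h' (\<rho> t) * (t / \<rho> t)" for t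
    proof -
      have "((\<lambda>t. f (w(\<nu> := w \<nu> + of_real t * \<i>))) has_real_derivative ?g t) (at t)"
        unfolding True[symmetric]
        by (rule partial_along_line, rule Ck_SucD(2)[OF C2 I(1) _ coord_space_upd[OF w I(1)]]) simp
      moreover have "((\<lambda>t. f (w(\<nu> := w \<nu> + of_real t * \<i>))) has_real_derivative h' (\<rho> t) * (t / \<rho> t)) (at t)"
        unfolding fg using DERIV_chain2[OF h d\<rho>] .
      ultimately show ?thesis by (rule DERIV_unique)
    qed
    then have gt: "?g = (\<lambda>t. h' (\<rho> t) * (t / \<rho> t))" by (rule ext)
    have "isCont h' a"
    proof -
      have "(\<lambda>t. partial 1 \<nu> f ((w(\<nu> := 0))(\<nu> := (w(\<nu> := 0)) \<nu> + of_real t * 1))) = h'"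
        by (simp add: h'_def fun_eq_iff)
      then have "(h' has_real_derivative partial 1 \<nu> (partial 1 \<nu> f) ((w(\<nu> := 0))(\<nu> := (w(\<nu> := 0)) \<nu> + of_real a * 1))) (at a)"
        using partial_along_line[of "partial 1 \<nu> f" "w(\<nu> := 0)" \<nu> a 1]
          Ck_SucD(2)[OF Ck_SucD(1)[OF C2 I(1)] I(1) _ coord_space_upd[OF coord_space_upd[OF w I(1)] I(1)], of 1 1]
        by simp
      then show ?thesis by (rule DERIV_isCont)
    qed
    moreover have \<rho>0: "\<rho> 0 = a" using a by (simp add: \<rho>_def)
    moreover have "isCont \<rho> 0" using d\<rho> DERIV_isCont by blast
    ultimately have "isCont (\<lambda>t. h' (\<rho> t) / \<rho> t) 0"
      using \<rho>[of 0] isCont_o2[of 0 \<rho> h'] by (intro continuous_divide) auto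
    then have "(?g has_real_derivative h' a / a) (at 0)"
      unfolding gt CARAT_DERIV using \<rho>0 by (intro exI[of _ "\<lambda>t. h' (\<rho> t) / \<rho> t"]) auto
    with g have "partial \<i> \<nu> (partial \<i> \<mu> f) w = h' a / a" by (rule DERIV_unique)
    moreover have "w(\<nu> := of_real a) = w" using a by auto
    ultimately show ?thesis using True by (simp add: h'_def a_def)
  qed
qed

text \<open>
  Along the curves that are affine in the logarithms of positive real coordinates, the second derivative
  is four times the complex Hessian. The term with first derivatives that arises from the curvature of
  the curve in the original coordinates cancels against the derivatives in the imaginary directions.
\<close>

lemma torus_invariant_second_derivative:
  fixes r l :: "nat \<Rightarrow> real"
  assumes fin: "finite I" and C2: "Ck (Suc (Suc n)) I f" and inv: "torus_invariant I f"
    and r: "\<And>j. j \<in> I \<Longrightarrow> r j > 0"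
  defines "c \<equiv> \<lambda>j s. r j * exp (l j * s)"
  defines "\<gamma> \<equiv> \<lambda>s. restrict (\<lambda>j. complex_of_real (c j s)) I"
  shows "((\<lambda>s. f (\<gamma> s)) has_real_derivative (\<Sum>j\<in>I. partial 1 j f (\<gamma> s) * (l j * c j s))) (at s)"
    and "((\<lambda>s. \<Sum>j\<in>I. partial 1 j f (\<gamma> s) * (l j * c j s)) has_real_derivative
       4 * (\<Sum>\<nu>\<in>I. \<Sum>\<mu>\<in>I. Re (ddbar f (\<gamma> s) \<nu> \<mu>) * ((l \<nu> * c \<nu> s) * (l \<mu> * c \<mu> s)))) (at s)"
proof -
  have \<gamma>: "\<gamma> s \<in> coord_space I" for s by (simp add: \<gamma>_def coord_space_def)
  have \<gamma>c: "\<gamma> s j = of_real (c j s)" if "j \<in> I" for s j using that by (simp add: \<gamma>_def)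
  have c: "(c j has_real_derivative l j * c j s) (at s)" for j s
    unfolding c_def by (auto intro!: derivative_eq_intros)
  have c0: "c j s > 0" if "j \<in> I" for j s using r[OF that] by (simp add: c_def)
  show "((\<lambda>s. f (\<gamma> s)) has_real_derivative (\<Sum>j\<in>I. partial 1 j f (\<gamma> s) * (l j * c j s))) (at s)"
    by (rule chain_rule_real_curve[OF fin Ck_partially_differentiable[OF C2] \<gamma> \<gamma>c c])
  have p: "((\<lambda>s. partial 1 j f (\<gamma> s)) has_real_derivative
      (\<Sum>\<nu>\<in>I. partial 1 \<nu> (partial 1 j f) (\<gamma> s) * (l \<nu> * c \<nu> s))) (at s)" if "j \<in> I" for j
    using Ck_partially_differentiable[OF Ck_SucD(1)[OF C2 that]]
    by (intro chain_rule_real_curve[OF fin _ \<gamma> \<gamma>c c]) auto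
  have "((\<lambda>s. \<Sum>j\<in>I. partial 1 j f (\<gamma> s) * (l j * c j s)) has_real_derivative
      (\<Sum>\<mu>\<in>I. (\<Sum>\<nu>\<in>I. partial 1 \<nu> (partial 1 \<mu> f) (\<gamma> s) * (l \<nu> * c \<nu> s)) * (l \<mu> * c \<mu> s)
         + partial 1 \<mu> f (\<gamma> s) * (l \<mu> * (l \<mu> * c \<mu> s)))) (at s)"
    by (intro DERIV_sum) (auto intro!: derivative_eq_intros p c simp: algebra_simps)
  also have "(\<Sum>\<mu>\<in>I. (\<Sum>\<nu>\<in>I. partial 1 \<nu> (partial 1 \<mu> f) (\<gamma> s) * (l \<nu> * c \<nu> s)) * (l \<mu> * c \<mu> s)
         + partial 1 \<mu> f (\<gamma> s) * (l \<mu> * (l \<mu> * c \<mu> s)))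
      = (\<Sum>\<mu>\<in>I. \<Sum>\<nu>\<in>I. 4 * (Re (ddbar f (\<gamma> s) \<nu> \<mu>) * ((l \<nu> * c \<nu> s) * (l \<mu> * c \<mu> s))))"
  proof (rule sum.cong[OF refl])
    fix \<mu> assume \<mu>: "\<mu> \<in> I"
    have "4 * (Re (ddbar f (\<gamma> s) \<nu> \<mu>) * ((l \<nu> * c \<nu> s) * (l \<mu> * c \<mu> s)))
        = partial 1 \<nu> (partial 1 \<mu> f) (\<gamma> s) * (l \<nu> * c \<nu> s) * (l \<mu> * c \<mu> s)
          + (if \<nu> = \<mu> then partial 1 \<mu> f (\<gamma> s) * (l \<mu> * (l \<mu> * c \<mu> s)) else 0)" if \<nu>: "\<nu> \<in> I" for \<nu>
    proof -
      have "partial \<i> \<nu> (partial \<i> \<mu> f) (\<gamma> s) = (if \<nu> = \<mu> then partial 1 \<nu> f (\<gamma> s) / c \<nu> s else 0)"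
        using \<gamma>c c0 by (intro partial_i_i_torus_invariant[OF C2 inv \<gamma> _ \<nu> \<mu>]) simp
      then show ?thesis
        unfolding Re_ddbar[OF C2 \<gamma> \<nu> \<mu>] using c0[OF \<nu>, of s] by (auto simp: field_simps)
    qed
    then have "(\<Sum>\<nu>\<in>I. 4 * (Re (ddbar f (\<gamma> s) \<nu> \<mu>) * ((l \<nu> * c \<nu> s) * (l \<mu> * c \<mu> s))))
        = (\<Sum>\<nu>\<in>I. partial 1 \<nu> (partial 1 \<mu> f) (\<gamma> s) * (l \<nu> * c \<nu> s) * (l \<mu> * c \<mu> s))
          + (\<Sum>\<nu>\<in>I. if \<nu> = \<mu> then partial 1 \<mu> f (\<gamma> s) * (l \<mu> * (l \<mu> * c \<mu> s)) else 0)"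
      by (simp add: sum.distrib)
    then show "(\<Sum>\<nu>\<in>I. partial 1 \<nu> (partial 1 \<mu> f) (\<gamma> s) * (l \<nu> * c \<nu> s)) * (l \<mu> * c \<mu> s)
         + partial 1 \<mu> f (\<gamma> s) * (l \<mu> * (l \<mu> * c \<mu> s))
        = (\<Sum>\<nu>\<in>I. 4 * (Re (ddbar f (\<gamma> s) \<nu> \<mu>) * ((l \<nu> * c \<nu> s) * (l \<mu> * c \<mu> s))))"
      using fin \<mu> by (simp add: sum_distrib_right)
  qed
  also have "\<dots> = 4 * (\<Sum>\<nu>\<in>I. \<Sum>\<mu>\<in>I. Re (ddbar f (\<gamma> s) \<nu> \<mu>) * ((l \<nu> * c \<nu> s) * (l \<mu> * c \<mu> s)))"
    by (subst sum.swap) (simp add: sum_distrib_left)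
  finally show "((\<lambda>s. \<Sum>j\<in>I. partial 1 j f (\<gamma> s) * (l j * c j s)) has_real_derivative
       4 * (\<Sum>\<nu>\<in>I. \<Sum>\<mu>\<in>I. Re (ddbar f (\<gamma> s) \<nu> \<mu>) * ((l \<nu> * c \<nu> s) * (l \<mu> * c \<mu> s)))) (at s)" .
qed

section \<open>The metric in charts\<close>

text \<open>
  Derivative in the \<open>\<nu>\<close>-th coordinate of the \<open>j\<close>-th component of \<open>w(a := 1)\<close>. The functions \<open>d\<zeta>\<close>, \<open>d\<eta>\<close>
  and \<open>dz\<close> are the derivatives of the three lifts; their arguments are the chart, the coordinate
  of differentiation, the point and the component.
\<close>

definition dcoord :: "nat \<Rightarrow> nat \<Rightarrow> nat \<Rightarrow> complex" where
  "dcoord a j \<nu> = (if \<nu> = j \<and> j \<noteq> a then 1 else 0)"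

definition d\<zeta> :: "nat \<Rightarrow> nat \<Rightarrow> chart_index \<Rightarrow> nat \<Rightarrow> cvec \<Rightarrow> nat \<Rightarrow> complex" where
  "d\<zeta> m k = (\<lambda>(i, p, r) \<nu> w j. if j \<in> {0..k} then dcoord i j \<nu> else 0)"

definition d\<eta> :: "nat \<Rightarrow> nat \<Rightarrow> chart_index \<Rightarrow> nat \<Rightarrow> cvec \<Rightarrow> nat \<Rightarrow> complex" where
  "d\<eta> m k = (\<lambda>(i, p, r) \<nu> w j. if j \<in> {k+1..m} then dcoord p j \<nu> else 0)"

definition dz :: "nat \<Rightarrow> nat \<Rightarrow> chart_index \<Rightarrow> nat \<Rightarrow> cvec \<Rightarrow> nat \<Rightarrow> complex" where
  "dz m k = (\<lambda>(i, p, r) \<nu> w j.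
     ((w(r := 1)) i * d\<zeta> m k (i, p, r) \<nu> w j + dcoord r i \<nu> * lift_\<zeta> m k (i, p, r) w j)
     + ((w(r := 1)) p * d\<eta> m k (i, p, r) \<nu> w j + dcoord r p \<nu> * lift_\<eta> m k (i, p, r) w j))"

lemma dcoord_deriv: "((\<lambda>x. ((u(\<nu> := x))(a := 1)) j) has_field_derivative dcoord a j \<nu>) (at y)"
  by (cases "j = a"; cases "\<nu> = j") (auto simp: dcoord_def)

lemma lift_\<zeta>_deriv: "((\<lambda>x. lift_\<zeta> m k c (u(\<nu> := x)) j) has_field_derivative d\<zeta> m k c \<nu> u j) (at y)"
  by (cases c; cases "j \<in> {0..k}") (simp_all only: lift_\<zeta>_def d\<zeta>_def prod.case if_True if_False dcoord_deriv DERIV_const)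

lemma lift_\<eta>_deriv: "((\<lambda>x. lift_\<eta> m k c (u(\<nu> := x)) j) has_field_derivative d\<eta> m k c \<nu> u j) (at y)"
  by (cases c; cases "j \<in> {k+1..m}") (simp_all only: lift_\<eta>_def d\<eta>_def prod.case if_True if_False dcoord_deriv DERIV_const)

lemma lift_z_deriv: "((\<lambda>x. lift_z m k c (u(\<nu> := x)) j) has_field_derivative dz m k c \<nu> u j) (at (u \<nu>))"
proof (cases c)
  case (fields i p r)
  show ?thesis
    unfolding fields lift_z_def dz_def prod.case
    by (rule DERIV_cong[OF DERIV_add[OF DERIV_mult'[OF dcoord_deriv lift_\<zeta>_deriv] DERIV_mult'[OF dcoord_deriv lift_\<eta>_deriv]]])
      simp
qed

lemma dz_differentiable: "\<exists>a. ((\<lambda>x. dz m k c \<mu> (u(\<nu> := x)) j) has_field_derivative a) (at y)"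
proof (cases c)
  case (fields i p r)
  define C1 where "C1 = d\<zeta> m k c \<mu> u j"
  define C2 where "C2 = d\<eta> m k c \<mu> u j"
  have C: "d\<zeta> m k c \<mu> u' j = C1" "d\<eta> m k c \<mu> u' j = C2" for u'
    by (simp_all add: fields d\<zeta>_def d\<eta>_def C1_def C2_def)
  show ?thesis
    unfolding fields dz_def prod.case C[unfolded fields]
    by (rule exI, rule DERIV_add[OF DERIV_add[OF DERIV_cmult_right[OF dcoord_deriv] DERIV_cmult[OF lift_\<zeta>_deriv]]
        DERIV_add[OF DERIV_cmult_right[OF dcoord_deriv] DERIV_cmult[OF lift_\<eta>_deriv]]])
qed

text \<open>
  Squared norms of the lifts.
\<close>

definition N\<zeta> :: "nat \<Rightarrow> nat \<Rightarrow> chart_index \<Rightarrow> cvec \<Rightarrow> real" where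
  "N\<zeta> m k c w = (\<Sum>j\<in>{0..k}. (cmod (lift_\<zeta> m k c w j))\<^sup>2)"
definition N\<eta> :: "nat \<Rightarrow> nat \<Rightarrow> chart_index \<Rightarrow> cvec \<Rightarrow> real" where
  "N\<eta> m k c w = (\<Sum>j\<in>{k+1..m}. (cmod (lift_\<eta> m k c w j))\<^sup>2)"
definition Nz :: "nat \<Rightarrow> nat \<Rightarrow> chart_index \<Rightarrow> cvec \<Rightarrow> real" where
  "Nz m k c w = (\<Sum>j\<in>{0..m}. (cmod (lift_z m k c w j))\<^sup>2)"

lemma sum_cmod_sq_pos:
  assumes "finite J" "j \<in> J" "F j \<noteq> (0::complex)"
  shows "(\<Sum>j\<in>J. (cmod (F j))\<^sup>2) > 0"
  using assms by (intro sum_pos2[of _ j]) auto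

lemma N_pos:
  assumes "c \<in> charts m k"
  shows "N\<zeta> m k c w > 0" "N\<eta> m k c w > 0" "Nz m k c w > 0"
proof -
  obtain i p r where c: "c = (i, p, r)" by (cases c)
  have ip: "i \<in> {0..k}" "p \<in> {k+1..m}" "r = i \<or> r = p" using assms by (auto simp: charts_def c)
  show "N\<zeta> m k c w > 0"
    unfolding N\<zeta>_def by (rule sum_cmod_sq_pos[OF _ ip(1)]) (use ip in \<open>auto simp: c lift_\<zeta>_def\<close>)
  show "N\<eta> m k c w > 0"
    unfolding N\<eta>_def by (rule sum_cmod_sq_pos[OF _ ip(2)]) (use ip in \<open>auto simp: c lift_\<eta>_def\<close>)
  have "r \<in> {0..m}" using ip by auto
  then show "Nz m k c w > 0"
    unfolding Nz_def by (intro sum_cmod_sq_pos[of _ r]) (use ip in \<open>auto simp: c lift_z_def lift_\<zeta>_def lift_\<eta>_def\<close>)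
qed

text \<open>
  The Fubini-Study metric of a lift with value \<open>F\<close>, first derivatives \<open>dF\<close> and squared norm \<open>N\<close> at the
  point under consideration.
\<close>

definition fs_term :: "nat set \<Rightarrow> (nat \<Rightarrow> complex) \<Rightarrow> (nat \<Rightarrow> nat \<Rightarrow> complex) \<Rightarrow> real \<Rightarrow> nat \<Rightarrow> nat \<Rightarrow> complex" where
  "fs_term J F dF N \<nu> \<mu> = (\<Sum>j\<in>J. dF \<nu> j * cnj (dF \<mu> j)) / of_real N
    - (\<Sum>j\<in>J. dF \<nu> j * cnj (F j)) * (\<Sum>j\<in>J. F j * cnj (dF \<mu> j)) / (of_real N)\<^sup>2"

lemma ghat_eq:
  assumes "c \<in> charts m k"
  shows "ghat m k c w \<nu> \<mu> =
      2 * fs_term {0..m} (lift_z m k c w) (\<lambda>\<nu>. dz m k c \<nu> w) (Nz m k c w) \<nu> \<mu>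
    + of_nat k * fs_term {0..k} (lift_\<zeta> m k c w) (\<lambda>\<nu>. d\<zeta> m k c \<nu> w) (N\<zeta> m k c w) \<nu> \<mu>
    + of_nat (m - k - 1) * fs_term {k+1..m} (lift_\<eta> m k c w) (\<lambda>\<nu>. d\<eta> m k c \<nu> w) (N\<eta> m k c w) \<nu> \<mu>"
proof -
  have "fubini_study {0..m} (lift_z m k c) w \<nu> \<mu> = fs_term {0..m} (lift_z m k c w) (\<lambda>\<nu>. dz m k c \<nu> w) (Nz m k c w) \<nu> \<mu>"
    unfolding fs_term_def Nz_def
    by (rule fubini_study_eq[where dF = "dz m k c", OF lift_z_deriv dz_differentiable N_pos(3)[OF assms, unfolded Nz_def]])
  moreover have "\<exists>a. ((\<lambda>x. d\<zeta> m k c \<mu> (u(\<nu> := x)) j) has_field_derivative a) (at (u \<nu>))" for \<mu> \<nu> u j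
    by (cases c) (auto simp: d\<zeta>_def intro!: exI[of _ 0])
  from fubini_study_eq[where dF = "d\<zeta> m k c", OF lift_\<zeta>_deriv this N_pos(1)[OF assms, unfolded N\<zeta>_def]]
  have "fubini_study {0..k} (lift_\<zeta> m k c) w \<nu> \<mu> = fs_term {0..k} (lift_\<zeta> m k c w) (\<lambda>\<nu>. d\<zeta> m k c \<nu> w) (N\<zeta> m k c w) \<nu> \<mu>"
    unfolding fs_term_def N\<zeta>_def .
  moreover have "\<exists>a. ((\<lambda>x. d\<eta> m k c \<mu> (u(\<nu> := x)) j) has_field_derivative a) (at (u \<nu>))" for \<mu> \<nu> u j
    by (cases c) (auto simp: d\<eta>_def intro!: exI[of _ 0])
  from fubini_study_eq[where dF = "d\<eta> m k c", OF lift_\<eta>_deriv this N_pos(2)[OF assms, unfolded N\<eta>_def]]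
  have "fubini_study {k+1..m} (lift_\<eta> m k c) w \<nu> \<mu> = fs_term {k+1..m} (lift_\<eta> m k c w) (\<lambda>\<nu>. d\<eta> m k c \<nu> w) (N\<eta> m k c w) \<nu> \<mu>"
    unfolding fs_term_def N\<eta>_def .
  ultimately show ?thesis by (simp add: ghat_def)
qed

section \<open>The volume density\<close>

lemma sum_unit_vector:
  fixes X :: "nat \<Rightarrow> complex"
  assumes "finite J" "\<nu> \<in> J"
  shows "(\<Sum>j\<in>J. (if j = \<nu> then a else 0) * X j) = a * X \<nu>"
    and "(\<Sum>j\<in>J. X j * cnj (if j = \<nu> then a else 0)) = X \<nu> * cnj a"
proof -
  have "(\<Sum>j\<in>J. (if j = \<nu> then a else 0) * X j) = (\<Sum>j\<in>J. if j = \<nu> then a * X \<nu> else 0)"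
    by (intro sum.cong) auto
  then show "(\<Sum>j\<in>J. (if j = \<nu> then a else 0) * X j) = a * X \<nu>" using assms by simp
  have "(\<Sum>j\<in>J. X j * cnj (if j = \<nu> then a else 0)) = (\<Sum>j\<in>J. if j = \<nu> then X \<nu> * cnj a else 0)"
    by (intro sum.cong) auto
  then show "(\<Sum>j\<in>J. X j * cnj (if j = \<nu> then a else 0)) = X \<nu> * cnj a" using assms by simp
qed

text \<open>
  A chart in a form that does not distinguish the two values of \<open>r\<close>: the block \<open>L1\<close> contains the index
  \<open>b1 = r\<close>, and \<open>b2\<close> in the other block \<open>L2\<close> is the index of the coordinate \<open>\<tau>\<close>. The vectors \<open>v1\<close>, \<open>v2\<close>
  and \<open>z\<close> are the lifts, \<open>d1\<close>, \<open>d2\<close> and \<open>d\<close> their derivatives, and \<open>A\<close> is the metric.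
\<close>

locale two_blocks =
  fixes L1 L2 :: "nat set" and b1 b2 :: nat and w :: cvec and k1 k2 :: real
  assumes fin: "finite L1" "finite L2" and disj: "L1 \<inter> L2 = {}" and b: "b1 \<in> L1" "b2 \<in> L2"
    and k: "k1 \<ge> 0" "k2 \<ge> 0"
begin

definition "v1 j = (if j \<in> L1 then (w(b1 := 1)) j else 0)"
definition "v2 j = (if j \<in> L2 then (w(b2 := 1)) j else 0)"
definition "z j = v1 j + w b2 * v2 j"
definition "d1 \<nu> j = (if j \<in> L1 then dcoord b1 j \<nu> else 0)"
definition "d2 \<nu> j = (if j \<in> L2 then dcoord b2 j \<nu> else 0)"
definition "d \<nu> j = d1 \<nu> j + (w b2 * d2 \<nu> j + (if \<nu> = b2 then v2 j else 0))"
definition "S = (\<Sum>j\<in>L1. (cmod (v1 j))\<^sup>2)"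
definition "E = (\<Sum>j\<in>L2. (cmod (v2 j))\<^sup>2)"
definition "F = (\<Sum>j\<in>L1 \<union> L2. (cmod (z j))\<^sup>2)"
definition "T = (cmod (w b2))\<^sup>2"
definition "J1 = L1 - {b1}"
definition "J2 = L2 - {b2}"
definition "A \<nu> \<mu> = 2 * fs_term (L1 \<union> L2) z d F \<nu> \<mu>
  + (of_real k1 * fs_term L1 v1 d1 S \<nu> \<mu> + of_real k2 * fs_term L2 v2 d2 E \<nu> \<mu>)"

lemma sets: "finite J1" "finite J2" "J1 \<inter> J2 = {}" "b2 \<notin> J1" "b2 \<notin> J2"
  using fin disj b by (auto simp: J1_def J2_def)

lemma S_eq: "S = 1 + (\<Sum>j\<in>J1. (cmod (w j))\<^sup>2)"
proof -
  have "(\<Sum>j\<in>J1. (cmod (v1 j))\<^sup>2) = (\<Sum>j\<in>J1. (cmod (w j))\<^sup>2)"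
    by (intro sum.cong) (auto simp: J1_def v1_def)
  then show ?thesis
    unfolding S_def sum.remove[OF fin(1) b(1)] by (simp add: v1_def b J1_def)
qed

lemma E_eq: "E = 1 + (\<Sum>j\<in>J2. (cmod (w j))\<^sup>2)"
proof -
  have "(\<Sum>j\<in>J2. (cmod (v2 j))\<^sup>2) = (\<Sum>j\<in>J2. (cmod (w j))\<^sup>2)"
    by (intro sum.cong) (auto simp: J2_def v2_def)
  then show ?thesis
    unfolding E_def sum.remove[OF fin(2) b(2)] by (simp add: v2_def b J2_def)
qed

lemma v_out: "j \<in> L2 \<Longrightarrow> v1 j = 0" "j \<in> L1 \<Longrightarrow> v2 j = 0"
  using disj by (auto simp: v1_def v2_def)

lemma F_eq: "F = S + T * E"
proof -
  have "F = (\<Sum>j\<in>L1. (cmod (z j))\<^sup>2) + (\<Sum>j\<in>L2. (cmod (z j))\<^sup>2)"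
    unfolding F_def using fin disj by (rule sum.union_disjoint)
  also have "(\<Sum>j\<in>L1. (cmod (z j))\<^sup>2) = S"
    unfolding S_def by (intro sum.cong) (auto simp: z_def v_out)
  also have "(\<Sum>j\<in>L2. (cmod (z j))\<^sup>2) = T * E"
    unfolding E_def T_def sum_distrib_left
    by (intro sum.cong) (auto simp: z_def v_out norm_mult power_mult_distrib)
  finally show ?thesis .
qed

lemma pos: "S > 0" "E > 0" "F > 0"
proof -
  show S: "S > 0" and E: "E > 0" by (auto simp: S_eq E_eq add_pos_nonneg sum_nonneg)
  show "F > 0" unfolding F_eq using S E by (simp add: T_def add_pos_nonneg)
qed

lemma d1_eq: "\<nu> \<in> J1 \<Longrightarrow> d1 \<nu> = (\<lambda>j. if j = \<nu> then 1 else 0)" "\<nu> \<notin> J1 \<Longrightarrow> d1 \<nu> = (\<lambda>j. 0)"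
  by (auto simp: d1_def dcoord_def J1_def fun_eq_iff)

lemma d2_eq: "\<nu> \<in> J2 \<Longrightarrow> d2 \<nu> = (\<lambda>j. if j = \<nu> then 1 else 0)" "\<nu> \<notin> J2 \<Longrightarrow> d2 \<nu> = (\<lambda>j. 0)"
  by (auto simp: d2_def dcoord_def J2_def fun_eq_iff)

lemma d_1: assumes "\<nu> \<in> J1" shows "d \<nu> = (\<lambda>j. if j = \<nu> then 1 else 0)"
proof -
  have "\<nu> \<notin> J2" "\<nu> \<noteq> b2" using assms sets by auto
  then show ?thesis using assms by (auto simp: d_def[abs_def] d1_eq d2_eq fun_eq_iff)
qed

lemma d_2: assumes "\<nu> \<in> J2" shows "d \<nu> = (\<lambda>j. if j = \<nu> then w b2 else 0)"
proof -
  have "\<nu> \<notin> J1" "\<nu> \<noteq> b2" using assms sets by auto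
  then show ?thesis using assms by (auto simp: d_def[abs_def] d1_eq d2_eq fun_eq_iff)
qed

lemma d_e: "d b2 = v2"
  using sets by (auto simp: d_def[abs_def] d1_eq d2_eq fun_eq_iff)

lemma J_sub: "\<nu> \<in> J1 \<Longrightarrow> \<nu> \<in> L1" "\<nu> \<in> J2 \<Longrightarrow> \<nu> \<in> L2"
  "\<nu> \<in> J1 \<Longrightarrow> \<nu> \<in> L1 \<union> L2" "\<nu> \<in> J2 \<Longrightarrow> \<nu> \<in> L1 \<union> L2"
  by (auto simp: J1_def J2_def)

lemma vals: "\<nu> \<in> J1 \<Longrightarrow> v1 \<nu> = w \<nu>" "\<nu> \<in> J2 \<Longrightarrow> v2 \<nu> = w \<nu>" "\<nu> \<in> J1 \<Longrightarrow> v2 \<nu> = 0" "\<nu> \<in> J2 \<Longrightarrow> v1 \<nu> = 0"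
  "\<nu> \<in> J1 \<Longrightarrow> z \<nu> = w \<nu>" "\<nu> \<in> J2 \<Longrightarrow> z \<nu> = w b2 * w \<nu>"
  using disj by (auto simp: J1_def J2_def v1_def v2_def z_def)

lemma finU: "finite (L1 \<union> L2)" using fin by simp

lemma sum_v2: "(\<Sum>j\<in>L1 \<union> L2. v2 j * cnj (v2 j)) = of_real E"
  "(\<Sum>j\<in>L1 \<union> L2. v2 j * cnj (z j)) = cnj (w b2) * of_real E"
  "(\<Sum>j\<in>L1 \<union> L2. z j * cnj (v2 j)) = w b2 * of_real E"
proof -
  have s: "(\<Sum>j\<in>L1 \<union> L2. v2 j * cnj (f j)) = (\<Sum>j\<in>L2. v2 j * cnj (f j))" for f
    by (intro sum.mono_neutral_right finU) (auto simp: v2_def)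
  have 1: "(\<Sum>j\<in>L2. v2 j * cnj (v2 j)) = of_real E"
    unfolding E_def of_real_sum complex_norm_square ..
  then show "(\<Sum>j\<in>L1 \<union> L2. v2 j * cnj (v2 j)) = of_real E" by (simp add: s)
  have "(\<Sum>j\<in>L2. v2 j * cnj (z j)) = (\<Sum>j\<in>L2. cnj (w b2) * (v2 j * cnj (v2 j)))"
    by (intro sum.cong) (auto simp: z_def v_out mult_ac)
  then show 2: "(\<Sum>j\<in>L1 \<union> L2. v2 j * cnj (z j)) = cnj (w b2) * of_real E"
    by (simp add: s 1 flip: sum_distrib_left)
  have "(\<Sum>j\<in>L1 \<union> L2. z j * cnj (v2 j)) = cnj (\<Sum>j\<in>L1 \<union> L2. v2 j * cnj (z j))"
    by (simp add: mult.commute)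
  then show "(\<Sum>j\<in>L1 \<union> L2. z j * cnj (v2 j)) = w b2 * of_real E" by (simp only: 2) simp
qed

lemma T_complex: "w b2 * cnj (w b2) = of_real T"
  unfolding T_def by (simp only: complex_norm_square)

lemma matrix: "blowup_matrix J1 J2 b2 w k1 k2 A S E T F (sqrt S) (sqrt E) (cmod (w b2))"
proof
  note sums = sum_unit_vector[OF fin(1)] sum_unit_vector[OF fin(2)] sum_unit_vector[OF finU] sum_v2 J_sub vals
  have F0: "complex_of_real F \<noteq> 0" "complex_of_real S \<noteq> 0" "complex_of_real E \<noteq> 0" using pos by auto
  show "finite J1" "finite J2" "J1 \<inter> J2 = {}" "b2 \<notin> J1" "b2 \<notin> J2" by (rule sets)+
  show "A \<mu> \<nu> = cnj (A \<nu> \<mu>)" for \<nu> \<mu>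
    by (simp add: A_def fs_term_def mult.commute)
  show "0 \<le> k1" "0 \<le> k2" by (rule k)+
  show "S = 1 + (\<Sum>j\<in>J1. (cmod (w j))\<^sup>2)" by (rule S_eq)
  show "E = 1 + (\<Sum>j\<in>J2. (cmod (w j))\<^sup>2)" by (rule E_eq)
  show "T = (cmod (w b2))\<^sup>2" by (rule T_def)
  show "F = S + T * E" by (rule F_eq)
  show "A \<nu> \<mu> = (if \<nu> = \<mu> then of_real (2 / F + k1 / S) else 0)
      - of_real (2 / F\<^sup>2 + k1 / S\<^sup>2) * (cnj (w \<nu>) * w \<mu>)" if "\<nu> \<in> J1" "\<mu> \<in> J1" for \<nu> \<mu>
  proof -
    have "\<nu> \<notin> J2" "\<mu> \<notin> J2" using that sets by auto
    then show ?thesis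
      using that by (simp add: A_def fs_term_def d_1 d1_eq d2_eq sums; auto simp: algebra_simps)
  qed
  show "A \<nu> \<mu> = (if \<nu> = \<mu> then of_real (2 * T / F + k2 / E) else 0)
      - of_real (2 * T\<^sup>2 / F\<^sup>2 + k2 / E\<^sup>2) * (cnj (w \<nu>) * w \<mu>)" if "\<nu> \<in> J2" "\<mu> \<in> J2" for \<nu> \<mu>
  proof -
    have "\<nu> \<notin> J1" "\<mu> \<notin> J1" using that sets by auto
    then show ?thesis
      using that by (simp add: A_def fs_term_def d_2 d1_eq d2_eq sums; auto simp: algebra_simps power2_eq_square T_complex[symmetric])
  qed
  show "A \<nu> \<mu> = - of_real (2 * T / F\<^sup>2) * (cnj (w \<nu>) * w \<mu>)" if "\<nu> \<in> J1" "\<mu> \<in> J2" for \<nu> \<mu>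
  proof -
    have "\<nu> \<notin> J2" "\<mu> \<notin> J1" "\<nu> \<noteq> \<mu>" using that sets by auto
    then show ?thesis
      using that by (simp add: A_def fs_term_def d_1 d_2 d1_eq d2_eq sums; auto simp: algebra_simps T_complex[symmetric])
  qed
  show "A \<nu> b2 = - of_real (2 * E / F\<^sup>2) * (cnj (w \<nu>) * w b2)" if "\<nu> \<in> J1" for \<nu>
  proof -
    have "\<nu> \<notin> J2" using that sets by auto
    then show ?thesis
      using that sets by (simp add: A_def fs_term_def d_1 d_e d1_eq d2_eq sums; auto simp: algebra_simps)
  qed
  have FS: "of_real F - of_real T * of_real E = complex_of_real S" by (simp add: F_eq)
  show "A \<nu> b2 = of_real (2 * S / F\<^sup>2) * (cnj (w \<nu>) * w b2)" if "\<nu> \<in> J2" for \<nu>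
  proof -
    have "\<nu> \<notin> J1" using that sets by auto
    then have "A \<nu> b2 = 2 * (w b2 * cnj (w \<nu>) / of_real F - of_real T * cnj (w \<nu>) * (w b2 * of_real E) / (of_real F)\<^sup>2)"
      using that sets by (simp add: A_def fs_term_def d_2 d_e d1_eq d2_eq sums; auto simp: algebra_simps T_complex[symmetric])
    also have "\<dots> = 2 * (of_real F - of_real T * of_real E) / (of_real F)\<^sup>2 * (cnj (w \<nu>) * w b2)"
      using F0 by (simp add: field_simps power2_eq_square)
    finally show ?thesis by (simp add: FS)
  qed
  have "A b2 b2 = 2 * (of_real E / of_real F - (w b2 * cnj (w b2)) * of_real E * of_real E / (of_real F)\<^sup>2)"
    using sets by (simp add: A_def fs_term_def d_e d1_eq d2_eq sums; auto simp: algebra_simps)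
  also have "\<dots> = 2 * (of_real F - of_real T * of_real E) * of_real E / (of_real F)\<^sup>2"
    unfolding T_complex using F0 by (simp add: field_simps power2_eq_square)
  finally show "A b2 b2 = of_real (2 * E * S / F\<^sup>2)" by (simp add: FS mult_ac)
qed simp_all

end

lemma cmod_det_ghat_le:
  assumes km: "k < m" and c: "c \<in> charts m k"
  shows "cmod (det_on (coord_set m c) (ghat m k c w)) \<le>
    fact m * (m * (4 + 2 * real k + 2 * real (m - k - 1))) ^ m * (real m)\<^sup>2
      / ((Nz m k c w)\<^sup>2 * N\<zeta> m k c w ^ k * N\<eta> m k c w ^ (m - k - 1))"
proof -
  obtain i p r where cc: "c = (i, p, r)" by (cases c)
  have ip: "i \<in> {0..k}" "p \<in> {k+1..m}" using c by (auto simp: charts_def cc)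
  have un: "{0..k} \<union> {k+1..m} = {0..m}" "{k+1..m} \<union> {0..k} = {0..m}" using km by auto
  have "r = i \<or> r = p" using c by (auto simp: charts_def cc)
  then show ?thesis
  proof
    assume r: "r = i"
    interpret t: two_blocks "{0..k}" "{k+1..m}" i p w "real k" "real (m - k - 1)"
      by unfold_locales (use ip in auto)
    interpret b: blowup_matrix t.J1 t.J2 p w "real k" "real (m - k - 1)" t.A t.S t.E t.T t.F "sqrt t.S" "sqrt t.E" "cmod (w p)"
      by (rule t.matrix)
    have I: "b.I = coord_set m c"
      unfolding b.I_def unfolding t.J1_def t.J2_def coord_set_def cc r using ip km by auto
    have cards: "card t.J1 = k" "card t.J2 = m - k - 1"
      unfolding t.J1_def t.J2_def using ip by auto
    have cI: "card b.I = m" unfolding I coord_set_def cc r using ip km by auto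
    have v: "lift_\<zeta> m k c w = t.v1" "lift_\<eta> m k c w = t.v2"
      unfolding fun_eq_iff lift_\<zeta>_def lift_\<eta>_def t.v1_def t.v2_def cc prod.case by simp_all
    have z: "lift_z m k c w = t.z"
      unfolding fun_eq_iff lift_z_def t.z_def v[symmetric] unfolding cc prod.case r using ip by auto
    have d: "d\<zeta> m k c \<nu> w j = t.d1 \<nu> j" "d\<eta> m k c \<nu> w j = t.d2 \<nu> j" for \<nu> j
      unfolding d\<zeta>_def d\<eta>_def t.d1_def t.d2_def cc prod.case by simp_all
    have dz: "dz m k c \<nu> w j = t.d \<nu> j" for \<nu> j
      unfolding dz_def t.d_def d[symmetric] v[symmetric] unfolding cc prod.case r dcoord_def using ip by auto
    have N: "N\<zeta> m k c w = t.S" "N\<eta> m k c w = t.E" "Nz m k c w = t.F"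
      by (simp_all only: N\<zeta>_def N\<eta>_def Nz_def t.S_def t.E_def t.F_def v z un)
    have g: "ghat m k c w = t.A"
      unfolding fun_eq_iff ghat_eq[OF c] t.A_def fs_term_def v z d dz N un by (simp add: add_ac)
    have nn: "k + (m - k - 1) + 1 = m" "(m - k - 1) + k + 1 = m"
      using km by simp_all
    show ?thesis
      using b.cmod_det_on_blowup_matrix_le
      unfolding b.B_def b.N_def cI
      unfolding cards I g N
      unfolding nn by (simp only: mult_ac add_ac)
  next
    assume r: "r = p"
    interpret t: two_blocks "{k+1..m}" "{0..k}" p i w "real (m - k - 1)" "real k"
      by unfold_locales (use ip in auto)
    interpret b: blowup_matrix t.J1 t.J2 i w "real (m - k - 1)" "real k" t.A t.S t.E t.T t.F "sqrt t.S" "sqrt t.E" "cmod (w i)"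
      by (rule t.matrix)
    have I: "b.I = coord_set m c"
      unfolding b.I_def unfolding t.J1_def t.J2_def coord_set_def cc r using ip km by auto
    have cards: "card t.J2 = k" "card t.J1 = m - k - 1"
      unfolding t.J1_def t.J2_def using ip by auto
    have cI: "card b.I = m" unfolding I coord_set_def cc r using ip km by auto
    have v: "lift_\<zeta> m k c w = t.v2" "lift_\<eta> m k c w = t.v1"
      unfolding fun_eq_iff lift_\<zeta>_def lift_\<eta>_def t.v1_def t.v2_def cc prod.case by simp_all
    have z: "lift_z m k c w = t.z"
      unfolding fun_eq_iff lift_z_def t.z_def v[symmetric] unfolding cc prod.case r using ip by auto
    have d: "d\<zeta> m k c \<nu> w j = t.d2 \<nu> j" "d\<eta> m k c \<nu> w j = t.d1 \<nu> j" for \<nu> j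
      unfolding d\<zeta>_def d\<eta>_def t.d1_def t.d2_def cc prod.case by simp_all
    have dz: "dz m k c \<nu> w j = t.d \<nu> j" for \<nu> j
      unfolding dz_def t.d_def d[symmetric] v[symmetric] unfolding cc prod.case r dcoord_def using ip by auto
    have N: "N\<zeta> m k c w = t.E" "N\<eta> m k c w = t.S" "Nz m k c w = t.F"
      by (simp_all only: N\<zeta>_def N\<eta>_def Nz_def t.S_def t.E_def t.F_def v z un)
    have g: "ghat m k c w = t.A"
      unfolding fun_eq_iff ghat_eq[OF c] t.A_def fs_term_def v z d dz N un by (simp add: add_ac)
    have nn: "k + (m - k - 1) + 1 = m" "(m - k - 1) + k + 1 = m"
      using km by simp_all
    show ?thesis
      using b.cmod_det_on_blowup_matrix_le
      unfolding b.B_def b.N_def cI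
      unfolding cards I g N
      unfolding nn by (simp only: mult_ac add_ac)
  qed
qed

section \<open>Symmetric convex functions\<close>

text \<open>
  Convexity for functions of infinitely many real variables, where sums and multiples are taken
  componentwise. The functions used below depend on finitely many of the variables.
\<close>

definition line_convex :: "((nat \<Rightarrow> real) \<Rightarrow> real) \<Rightarrow> bool" where
  "line_convex u \<longleftrightarrow> (\<forall>x y. \<forall>t\<in>{0..1}. u (\<lambda>j. (1 - t) * x j + t * y j) \<le> (1 - t) * u x + t * u y)"

lemma line_convexD:
  "line_convex u \<Longrightarrow> 0 \<le> t \<Longrightarrow> t \<le> 1 \<Longrightarrow> u (\<lambda>j. (1 - t) * x j + t * y j) \<le> (1 - t) * u x + t * u y"
  by (simp add: line_convex_def)

lemma line_convex_mean:
  assumes cv: "line_convex u" and "finite A" "A \<noteq> {}"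
  shows "u (\<lambda>j. (\<Sum>a\<in>A. X a j) / card A) \<le> (\<Sum>a\<in>A. u (X a)) / card A"
  using assms(2,3)
proof (induction A rule: finite_ne_induct)
  case (insert a A)
  let ?n = "real (card A)" and ?t = "1 / (real (card A) + 1)"
  have n: "?n > 0" using insert by (simp add: card_gt_0_iff)
  have c: "real (card (insert a A)) = ?n + 1" using insert by simp
  have t1: "1 - ?t = ?n / (?n + 1)" using n by (simp add: field_simps)
  have avg: "(1 - ?t) * (s / ?n) + ?t * b = (b + s) / (?n + 1)" for s b
    unfolding t1 using n by (simp add: add_divide_distrib)
  have "u (\<lambda>j. (\<Sum>b\<in>insert a A. X b j) / card (insert a A))
      = u (\<lambda>j. (1 - ?t) * ((\<Sum>b\<in>A. X b j) / ?n) + ?t * X a j)"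
    unfolding avg c using insert by simp
  also have "\<dots> \<le> (1 - ?t) * u (\<lambda>j. (\<Sum>b\<in>A. X b j) / ?n) + ?t * u (X a)"
    by (rule line_convexD[OF cv]) (use n in auto)
  also have "\<dots> \<le> (1 - ?t) * ((\<Sum>b\<in>A. u (X b)) / ?n) + ?t * u (X a)"
    using insert.IH n by (intro add_right_mono mult_left_mono) auto
  also have "\<dots> = (\<Sum>b\<in>insert a A. u (X b)) / card (insert a A)"
    unfolding avg c using insert by simp
  finally show ?case .
qed simp

text \<open>
  The arithmetic mean over a finite set of indices.
\<close>

definition average :: "nat set \<Rightarrow> (nat \<Rightarrow> real) \<Rightarrow> real" where
  "average S x = (\<Sum>j\<in>S. x j) / card S"

lemma sum_permutes_eq_average:
  assumes fin: "finite S" and j: "j \<in> S"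
  shows "(\<Sum>\<sigma> | \<sigma> permutes S. x (\<sigma> j)) / fact (card S) = average S x"
proof -
  let ?T = "\<lambda>j. \<Sum>\<sigma> | \<sigma> permutes S. x (\<sigma> j)"
  have eq: "?T i = ?T j" if "i \<in> S" for i
    using sum_permutations_compose_right[OF permutes_swap_id[OF j that], of "\<lambda>\<sigma>. x (\<sigma> i)"] by simp
  have n: "card S > 0" using fin j card_gt_0_iff by blast
  have "real (card S) * ?T j = (\<Sum>i\<in>S. ?T i)" by (simp add: eq)
  also have "\<dots> = (\<Sum>\<sigma> | \<sigma> permutes S. \<Sum>i\<in>S. x (\<sigma> i))" by (rule sum.swap)
  also have "\<dots> = (\<Sum>\<sigma> | \<sigma> permutes S. \<Sum>i\<in>S. x i)"
  proof (rule sum.cong[OF refl])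
    fix \<sigma> assume "\<sigma> \<in> {\<sigma>. \<sigma> permutes S}"
    then show "(\<Sum>i\<in>S. x (\<sigma> i)) = (\<Sum>i\<in>S. x i)"
      using sum.permute[of \<sigma> S x] by (simp add: o_def)
  qed
  also have "\<dots> = fact (card S) * (\<Sum>i\<in>S. x i)"
    using fin by (simp add: card_permutations)
  finally show ?thesis
    using n by (simp add: average_def field_simps)
qed

text \<open>
  Jensen's inequality for the mean over all permutations of \<open>S\<close>.
\<close>

lemma averaging_decreases:
  assumes cv: "line_convex u" and fin: "finite S"
    and sym: "\<And>x \<sigma>. \<sigma> permutes S \<Longrightarrow> u (x \<circ> \<sigma>) = u x"
  shows "u (\<lambda>j. if j \<in> S then average S x else x j) \<le> u x"
proof -
  let ?P = "{\<sigma>. \<sigma> permutes S}"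
  have P: "finite ?P" "id \<in> ?P" "card ?P = fact (card S)"
    using fin by (auto simp: finite_permutations permutes_id card_permutations)
  have "(\<lambda>j. if j \<in> S then average S x else x j) = (\<lambda>j. (\<Sum>\<sigma>\<in>?P. (x \<circ> \<sigma>) j) / card ?P)" (is "?l = ?r")
  proof
    fix j
    show "(if j \<in> S then average S x else x j) = (\<Sum>\<sigma>\<in>?P. (x \<circ> \<sigma>) j) / card ?P"
    proof (cases "j \<in> S")
      case True
      then show ?thesis using sum_permutes_eq_average[OF fin True, of x] by (simp add: P)
    next
      case False
      then have "(\<Sum>\<sigma>\<in>?P. (x \<circ> \<sigma>) j) = (\<Sum>\<sigma>\<in>?P. x j)"
        by (intro sum.cong) (auto simp: permutes_not_in)
      then show ?thesis using False by (simp add: P)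
    qed
  qed
  then have "u ?l = u ?r" by (rule arg_cong)
  also have "\<dots> \<le> (\<Sum>\<sigma>\<in>?P. u (x \<circ> \<sigma>)) / card ?P"
    by (rule line_convex_mean[OF cv P(1)]) (use P(2) in blast)
  also have "(\<Sum>\<sigma>\<in>?P. u (x \<circ> \<sigma>)) = (\<Sum>\<sigma>\<in>?P. u x)"
    by (intro sum.cong) (auto simp: sym)
  also have "\<dots> / card ?P = u x" by (simp add: P)
  finally show ?thesis .
qed

text \<open>
  The logarithm of the squared norm of a vector with index set \<open>A\<close>, as a function of the logarithms of
  the moduli of its entries.
\<close>

definition lse :: "nat set \<Rightarrow> (nat \<Rightarrow> real) \<Rightarrow> real" where
  "lse A x = ln (\<Sum>j\<in>A. exp (2 * x j))"

lemma sum_exp_pos: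
  assumes "finite A" "A \<noteq> {}"
  shows "(\<Sum>j\<in>A. exp (2 * x j :: real)) > 0"
  using assms by (intro sum_pos) auto

lemma lse_ge: "finite A \<Longrightarrow> j \<in> A \<Longrightarrow> 2 * x j \<le> lse A x"
proof -
  assume A: "finite A" "j \<in> A"
  have "exp (2 * x j) \<le> (\<Sum>j\<in>A. exp (2 * x j))"
    using A by (intro member_le_sum) auto
  then have "ln (exp (2 * x j)) \<le> lse A x"
    unfolding lse_def by (intro ln_mono) auto
  then show ?thesis by simp
qed

lemma lse_add_le:
  assumes A: "finite A" "A \<noteq> {}" and M: "\<And>j. j \<in> A \<Longrightarrow> v j \<le> M" and s: "s \<ge> 0"
  shows "lse A (\<lambda>j. x j + s * v j) \<le> lse A x + s * (2 * M)"
proof -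
  have "(\<Sum>j\<in>A. exp (2 * (x j + s * v j))) \<le> (\<Sum>j\<in>A. exp (2 * x j) * exp (s * (2 * M)))"
    using M s by (intro sum_mono) (auto simp: mult_left_mono simp flip: exp_add)
  also have "\<dots> = (\<Sum>j\<in>A. exp (2 * x j)) * exp (s * (2 * M))"
    by (simp add: sum_distrib_right)
  finally have "ln (\<Sum>j\<in>A. exp (2 * (x j + s * v j))) \<le> ln ((\<Sum>j\<in>A. exp (2 * x j)) * exp (s * (2 * M)))"
    using sum_exp_pos[OF A] by (intro ln_mono)
  then show ?thesis
    using sum_exp_pos[OF A, of x] by (simp add: lse_def ln_mult)
qed

text \<open>The potential of the metric in logarithmic coordinates.\<close>

definition potential :: "nat \<Rightarrow> nat \<Rightarrow> (nat \<Rightarrow> real) \<Rightarrow> real" where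
  "potential m k x = 2 * lse {0..m} x + real k * lse {0..k} x + real (m - k - 1) * lse {k+1..m} x"

text \<open>
  In the application \<open>u\<close> is the sum of the potential and a function \<open>\<phi> \<le> 0\<close> with supremum \<open>0\<close>.
\<close>

locale symmetric_convex =
  fixes m k :: nat and u :: "(nat \<Rightarrow> real) \<Rightarrow> real"
  assumes km: "k < m" and cv: "line_convex u"
    and upper: "\<And>x. u x \<le> potential m k x"
    and sup: "\<And>\<epsilon>. \<epsilon> > 0 \<Longrightarrow> \<exists>x. potential m k x - \<epsilon> \<le> u x"
    and sym: "\<And>x \<sigma>. \<sigma> permutes {0..k} \<or> \<sigma> permutes {k+1..m} \<Longrightarrow> u (x \<circ> \<sigma>) = u x"
begin

text \<open>
  The support function of the moment polytope at a vector with maxima \<open>M1\<close> and \<open>M2\<close> over the two blocks.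
\<close>

definition "support M1 M2 = 4 * max M1 M2 + 2 * real k * M1 + 2 * real (m - k - 1) * M2"

lemma potential_add_le:
  assumes "\<And>j. j \<in> {0..k} \<Longrightarrow> v j \<le> M1" "\<And>j. j \<in> {k+1..m} \<Longrightarrow> v j \<le> M2" "s \<ge> 0"
  shows "potential m k (\<lambda>j. x j + s * v j) \<le> potential m k x + s * support M1 M2"
proof -
  have "v j \<le> max M1 M2" if "j \<in> {0..m}" for j
    using assms(1,2)[of j] that by (cases "j \<le> k") auto
  then have "lse {0..m} (\<lambda>j. x j + s * v j) \<le> lse {0..m} x + s * (2 * max M1 M2)"
    using assms by (intro lse_add_le) auto
  moreover have "lse {0..k} (\<lambda>j. x j + s * v j) \<le> lse {0..k} x + s * (2 * M1)"
    using assms by (intro lse_add_le) auto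
  then have "real k * lse {0..k} (\<lambda>j. x j + s * v j) \<le> real k * (lse {0..k} x + s * (2 * M1))"
    by (intro mult_left_mono) auto
  moreover have "lse {k+1..m} (\<lambda>j. x j + s * v j) \<le> lse {k+1..m} x + s * (2 * M2)"
    using assms km by (intro lse_add_le) auto
  then have "real (m - k - 1) * lse {k+1..m} (\<lambda>j. x j + s * v j) \<le> real (m - k - 1) * (lse {k+1..m} x + s * (2 * M2))"
    by (intro mult_left_mono) auto
  ultimately show ?thesis
    unfolding potential_def support_def by (simp add: algebra_simps)
qed

text \<open>
  Convexity compares \<open>u (x + v)\<close> with \<open>u\<close> at the points \<open>x + n v\<close>, where the potential bounds it
  from above; the term that depends on \<open>x\<close> disappears as \<open>n\<close> tends to infinity.
\<close>

lemma recession_bound: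
  assumes "\<And>j. j \<in> {0..k} \<Longrightarrow> v j \<le> M1" "\<And>j. j \<in> {k+1..m} \<Longrightarrow> v j \<le> M2"
  shows "u (\<lambda>j. x j + v j) \<le> u x + support M1 M2"
proof (rule LIMSEQ_le_const)
  let ?f = "\<lambda>n. u x + (potential m k x - u x) * (1 / real n) + support M1 M2"
  have "?f \<longlonglongrightarrow> u x + (potential m k x - u x) * 0 + support M1 M2"
    by (intro tendsto_intros lim_1_over_n)
  then show "?f \<longlonglongrightarrow> u x + support M1 M2" by simp
  show "\<exists>N. \<forall>n\<ge>N. u (\<lambda>j. x j + v j) \<le> ?f n"
  proof (intro exI[of _ 1] allI impI)
    fix n :: nat assume n: "1 \<le> n"
    let ?t = "1 / real n"
    have t: "0 \<le> ?t" "?t \<le> 1" "?t * real n = 1" using n by auto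
    have "(\<lambda>j. x j + v j) = (\<lambda>j. (1 - ?t) * x j + ?t * (x j + real n * v j))"
      using n by (simp add: fun_eq_iff field_simps)
    then have "u (\<lambda>j. x j + v j) = u (\<lambda>j. (1 - ?t) * x j + ?t * (x j + real n * v j))"
      by (rule arg_cong)
    also have "\<dots> \<le> (1 - ?t) * u x + ?t * u (\<lambda>j. x j + real n * v j)"
      using line_convexD[OF cv t(1,2), of x "\<lambda>j. x j + real n * v j"] by simp
    also have "\<dots> \<le> (1 - ?t) * u x + ?t * (potential m k x + real n * support M1 M2)"
      using upper[of "\<lambda>j. x j + real n * v j"] potential_add_le[of v M1 M2 "real n" x, OF assms] t
      by (intro add_left_mono mult_left_mono) auto
    also have "\<dots> = ?f n"
      using n by (simp add: field_simps)
    finally show "u (\<lambda>j. x j + v j) \<le> ?f n" .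
  qed
qed

lemma zero_nonneg: "u (\<lambda>j. 0) \<ge> 0"
proof (rule field_le_epsilon)
  fix \<epsilon> :: real assume "\<epsilon> > 0"
  from sup[OF this] obtain x where x: "potential m k x - \<epsilon> \<le> u x" by blast
  define M1 where "M1 = Max (x ` {0..k})"
  define M2 where "M2 = Max (x ` {k+1..m})"
  have ne: "{k+1..m} \<noteq> {}" using km by auto
  have M: "j \<in> {0..k} \<Longrightarrow> x j \<le> M1" "j \<in> {k+1..m} \<Longrightarrow> x j \<le> M2" for j
    by (auto simp: M1_def M2_def)
  have "M1 \<in> x ` {0..k}" unfolding M1_def by (intro Max_in) auto
  then obtain j1 where j1: "j1 \<in> {0..k}" "x j1 = M1" by auto
  have "M2 \<in> x ` {k+1..m}" unfolding M2_def using ne by (intro Max_in) auto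
  then obtain j2 where j2: "j2 \<in> {k+1..m}" "x j2 = M2" by auto
  have "2 * M1 \<le> lse {0..m} x" "2 * M2 \<le> lse {0..m} x" "2 * M1 \<le> lse {0..k} x" "2 * M2 \<le> lse {k+1..m} x"
    using lse_ge[of "{0..m}" j1 x] lse_ge[of "{0..m}" j2 x] lse_ge[of "{0..k}" j1 x] lse_ge[of "{k+1..m}" j2 x] j1 j2 km
    by auto
  then have "2 * (2 * max M1 M2) \<le> 2 * lse {0..m} x" "real k * (2 * M1) \<le> real k * lse {0..k} x"
    "real (m - k - 1) * (2 * M2) \<le> real (m - k - 1) * lse {k+1..m} x"
    by (auto intro!: mult_left_mono)
  then have "support M1 M2 \<le> potential m k x"
    unfolding support_def potential_def by linarith
  moreover have "u (\<lambda>j. 0 + x j) \<le> u (\<lambda>j. 0) + support M1 M2"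
    by (rule recession_bound[OF M])
  ultimately show "0 \<le> u (\<lambda>j. 0) + \<epsilon>" using x by simp
qed

theorem lower_bound:
  defines "a \<equiv> \<lambda>x. average {0..k} x" and "b \<equiv> \<lambda>x. average {k+1..m} x"
  shows "2 * real k * a x + 2 * real (m - k - 1) * b x + 4 * min (a x) (b x) \<le> u x"
proof -
  define y where "y = (\<lambda>j. if j \<in> {0..k} then a x else x j)"
  define z where "z = (\<lambda>j. if j \<in> {k+1..m} then average {k+1..m} y else y j)"
  have "average {k+1..m} y = b x"
    unfolding average_def b_def y_def by (auto intro!: arg_cong2[where f = "(/)"] sum.cong)
  then have z: "z = (\<lambda>j. if j \<in> {k+1..m} then b x else y j)" unfolding z_def by (simp only:)
  have "u z \<le> u y" unfolding z_def by (rule averaging_decreases[OF cv _ sym]) auto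
  also have "u y \<le> u x" unfolding y_def a_def by (rule averaging_decreases[OF cv _ sym]) auto
  finally have zx: "u z \<le> u x" .
  have "u (\<lambda>j. z j + (- z j)) \<le> u z + support (- a x) (- b x)"
    by (rule recession_bound) (auto simp: z y_def)
  then have "0 \<le> u x + support (- a x) (- b x)"
    using zx zero_nonneg by simp
  moreover have "max (- a x) (- b x) = - min (a x) (b x)" by (simp add: max_def min_def)
  ultimately show ?thesis by (simp add: support_def)
qed

end

section \<open>Points of the torus\<close>

text \<open>
  The coordinates in \<open>A\<close>, padded by zeros as in the definition of the projective spaces.
\<close>

definition res :: "nat set \<Rightarrow> cvec \<Rightarrow> cvec" where
  "res A z = (\<lambda>j. if j \<in> A then z j else 0)"

text \<open>
  The point of the blow-up over \<open>[z\<^sub>0, \<dots>, z\<^sub>m]\<close>, when all these coordinates are nonzero.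
\<close>

definition torus_pt :: "nat \<Rightarrow> nat \<Rightarrow> cvec \<Rightarrow> triple" where
  "torus_pt m k z = (proj_pt (res {0..m} z), proj_pt (res {0..k} z), proj_pt (res {k+1..m} z))"

lemma proj_pt_scale:
  assumes "c \<noteq> 0"
  shows "proj_pt (\<lambda>j. c * z j) = proj_pt z"
proof -
  have "\<exists>c'. (\<lambda>j. d * (c * z j)) = (\<lambda>j. c' * z j) \<and> c' \<noteq> 0" if "d \<noteq> 0" for d
    using that assms by (intro exI[of _ "d * c"]) (simp add: mult.assoc)
  moreover have "\<exists>d. (\<lambda>j. c' * z j) = (\<lambda>j. d * (c * z j)) \<and> d \<noteq> 0" if "c' \<noteq> 0" for c'
    using that assms by (intro exI[of _ "c' / c"]) simp
  ultimately show ?thesis unfolding proj_pt_def by blast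
qed

lemma torus_pt_cong:
  assumes "k < m" "\<And>j. j \<in> {0..m} \<Longrightarrow> z j = z' j"
  shows "torus_pt m k z = torus_pt m k z'"
proof -
  have "res {0..m} z = res {0..m} z'" "res {0..k} z = res {0..k} z'" "res {k+1..m} z = res {k+1..m} z'"
    using assms by (auto simp: res_def fun_eq_iff)
  then show ?thesis by (simp add: torus_pt_def)
qed

lemma torus_pt_scale:
  assumes "c \<noteq> 0"
  shows "torus_pt m k (\<lambda>j. c * z j) = torus_pt m k z"
proof -
  have "res A (\<lambda>j. c * z j) = (\<lambda>j. c * res A z j)" for A by (auto simp: res_def)
  then show ?thesis by (simp add: torus_pt_def proj_pt_scale[OF assms])
qed

lemma torus_pt_in_blowup:
  assumes "k < m" "\<forall>j\<in>{0..m}. z j \<noteq> 0"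
  shows "torus_pt m k z \<in> blowup m k"
proof -
  have "res {0..m} z \<in> hvec {0..m}" "res {0..k} z \<in> hvec {0..k}"
    using assms by (auto simp: hvec_def res_def)
  moreover have "res {k+1..m} z \<in> hvec {k+1..m}"
    unfolding hvec_def res_def mem_Collect_eq
    using assms by (intro conjI bexI[of _ m]) auto
  moreover have "\<forall>j\<in>{0..k}. res {0..m} z j = 1 * res {0..k} z j" "\<forall>j\<in>{k+1..m}. res {0..m} z j = 1 * res {k+1..m} z j"
    using assms(1) by (auto simp: res_def)
  ultimately show ?thesis
    unfolding torus_pt_def blowup_def by blast
qed

lemma lift_z_low: "c = (i, p, r) \<Longrightarrow> j \<in> {0..k} \<Longrightarrow> lift_z m k c w j = (w(r := 1)) i * lift_\<zeta> m k c w j"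
  and lift_z_high: "c = (i, p, r) \<Longrightarrow> j \<in> {k+1..m} \<Longrightarrow> lift_z m k c w j = (w(r := 1)) p * lift_\<eta> m k c w j"
  and lift_z_out: "j \<notin> {0..k} \<Longrightarrow> j \<notin> {k+1..m} \<Longrightarrow> lift_z m k c w j = 0"
  by (cases c; auto simp: lift_z_def lift_\<zeta>_def lift_\<eta>_def)+

lemma lift_nonzero:
  assumes c: "c \<in> charts m k" and w: "\<forall>j\<in>coord_set m c. w j \<noteq> 0"
  shows "j \<in> {0..k} \<Longrightarrow> lift_\<zeta> m k c w j \<noteq> 0" "j \<in> {k+1..m} \<Longrightarrow> lift_\<eta> m k c w j \<noteq> 0"
    "k < m \<Longrightarrow> j \<in> {0..m} \<Longrightarrow> lift_z m k c w j \<noteq> 0"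
proof -
  obtain i p r where cc: "c = (i, p, r)" by (cases c)
  have ip: "i \<in> {0..k}" "p \<in> {k+1..m}" "r = i \<or> r = p" using c by (auto simp: charts_def cc)
  have w': "j \<in> {0..m} \<Longrightarrow> j \<noteq> r \<Longrightarrow> w j \<noteq> 0" for j
    using w by (auto simp: coord_set_def cc)
  show \<zeta>: "lift_\<zeta> m k c w j \<noteq> 0" if "j \<in> {0..k}" for j
    using that ip w'[of j] by (auto simp: cc lift_\<zeta>_def)
  show \<eta>: "lift_\<eta> m k c w j \<noteq> 0" if "j \<in> {k+1..m}" for j
    using that ip w'[of j] by (auto simp: cc lift_\<eta>_def)
  have st: "(w(r := 1)) i \<noteq> 0" "(w(r := 1)) p \<noteq> 0"
    using ip w'[of i] w'[of p] by auto
  show "lift_z m k c w j \<noteq> 0" if "k < m" "j \<in> {0..m}"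
  proof (cases "j \<in> {0..k}")
    case True
    then show ?thesis using \<zeta> st by (simp only: lift_z_low[OF cc]) simp
  next
    case False
    then have "j \<in> {k+1..m}" using that by auto
    then show ?thesis using \<eta> st by (simp only: lift_z_high[OF cc]) simp
  qed
qed

lemma chart_eq_torus_pt:
  assumes c: "c \<in> charts m k" and km: "k < m" and w: "\<forall>j\<in>coord_set m c. w j \<noteq> 0"
  shows "chart m k c w = torus_pt m k (lift_z m k c w)"
proof -
  obtain i p r where cc: "c = (i, p, r)" by (cases c)
  have ip: "i \<in> {0..k}" "p \<in> {k+1..m}" using c by (auto simp: charts_def cc)
  let ?s = "(w(r := 1)) i" and ?t = "(w(r := 1)) p"
  have "lift_z m k c w i \<noteq> 0" "lift_z m k c w p \<noteq> 0"
    using ip km lift_nonzero(3)[OF c w km] by auto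
  then have st: "?s \<noteq> 0" "?t \<noteq> 0"
    by (simp_all only: lift_z_low[OF cc ip(1)] lift_z_high[OF cc ip(2)]) auto
  have "res {0..m} (lift_z m k c w) = lift_z m k c w"
    using km by (auto simp: res_def fun_eq_iff lift_z_out)
  moreover have "res {0..k} (lift_z m k c w) = (\<lambda>j. ?s * lift_\<zeta> m k c w j)"
    unfolding res_def fun_eq_iff using lift_z_low[OF cc] by (auto simp: cc lift_\<zeta>_def)
  moreover have "res {k+1..m} (lift_z m k c w) = (\<lambda>j. ?t * lift_\<eta> m k c w j)"
    unfolding res_def fun_eq_iff using lift_z_high[OF cc] by (auto simp: cc lift_\<eta>_def)
  ultimately show ?thesis
    by (simp only: torus_pt_def chart_def proj_pt_scale[OF st(1)] proj_pt_scale[OF st(2)])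
qed

section \<open>Invariance\<close>

text \<open>
  Invariance under the generators themselves; no group structure is involved.
\<close>

lemma G_invariant_generator:
  assumes "G_invariant m k \<phi>" "g \<in> generators m k" "y \<in> blowup m k"
  shows "\<phi> (induced g y) = \<phi> y"
proof -
  have "restrict (induced g) (blowup m k) \<in> symmetry_group m k"
    unfolding symmetry_group_def using assms(2) by (intro generate.incl) blast
  then have "\<phi> (restrict (induced g) (blowup m k) y) = \<phi> y"
    using assms(1,3) unfolding G_invariant_def by blast
  then show ?thesis using assms(3) by simp
qed

lemma induced_torus_pt:
  assumes lin: "\<And>c u. g (\<lambda>j. c * u j) = (\<lambda>j. c * g u j)"
    and res: "\<And>A. A \<in> {{0..m}, {0..k}, {k+1..m}} \<Longrightarrow> g (res A z) = res A (g z)"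
  shows "induced g (torus_pt m k z) = torus_pt m k (g z)"
proof -
  have "g ` proj_pt u = proj_pt (g u)" for u
    unfolding proj_pt_def using lin by (auto simp: image_iff) metis+
  then show ?thesis
    using res by (simp add: induced_def torus_pt_def)
qed

lemma G_invariant_transpose:
  assumes inv: "G_invariant m k \<phi>" and km: "k < m"
    and ij: "i \<in> {0..k} \<and> j \<in> {0..k} \<or> i \<in> {k+1..m} \<and> j \<in> {k+1..m}"
    and z: "\<forall>j\<in>{0..m}. z j \<noteq> 0"
  shows "\<phi> (torus_pt m k (z \<circ> Transposition.transpose i j)) = \<phi> (torus_pt m k z)"
proof -
  let ?g = "\<lambda>z::cvec. z \<circ> Transposition.transpose i j"
  have g: "?g \<in> generators m k"
    using ij generators.swap_low[of i k j m] generators.swap_high[of i k m j] by blast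
  have A: "Transposition.transpose i j l \<in> A \<longleftrightarrow> l \<in> A" if "A \<in> {{0..m}, {0..k}, {k+1..m}}" for A l
    using that ij km by (auto simp: Transposition.transpose_def)
  have "induced ?g (torus_pt m k z) = torus_pt m k (?g z)"
    using A by (intro induced_torus_pt) (auto simp: fun_eq_iff res_def)
  then show ?thesis
    using G_invariant_generator[OF inv g torus_pt_in_blowup[OF km z]] by simp
qed

lemma G_invariant_permutes:
  assumes inv: "G_invariant m k \<phi>" and km: "k < m" and \<sigma>: "\<sigma> permutes {0..k} \<or> \<sigma> permutes {k+1..m}"
    and z: "\<forall>j\<in>{0..m}. z j \<noteq> 0"
  shows "\<phi> (torus_pt m k (z \<circ> \<sigma>)) = \<phi> (torus_pt m k z)"
proof -
  have main: "\<forall>z. (\<forall>j\<in>{0..m}. z j \<noteq> 0) \<longrightarrow> \<phi> (torus_pt m k (z \<circ> \<sigma>)) = \<phi> (torus_pt m k z)"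
    if \<sigma>: "\<sigma> permutes S" and S: "S = {0..k} \<or> S = {k+1..m}" for S
  proof -
    have "finite S" using S by auto
    with \<sigma> show ?thesis
    proof (induction \<sigma> rule: permutes_induct)
      case id
      then show ?case by simp
    next
      case (swap a b p)
      show ?case
      proof (intro allI impI)
        fix z :: cvec assume z: "\<forall>j\<in>{0..m}. z j \<noteq> 0"
        have ab: "a \<in> {0..k} \<and> b \<in> {0..k} \<or> a \<in> {k+1..m} \<and> b \<in> {k+1..m}"
          using swap S by auto
        have "(z \<circ> Transposition.transpose a b) j \<noteq> 0" if "j \<in> {0..m}" for j
          using z that ab km by (auto simp: Transposition.transpose_def)
        then have "\<phi> (torus_pt m k ((z \<circ> Transposition.transpose a b) \<circ> p)) = \<phi> (torus_pt m k (z \<circ> Transposition.transpose a b))"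
          using swap by blast
        also have "\<dots> = \<phi> (torus_pt m k z)"
          using z by (intro G_invariant_transpose[OF inv km ab]) auto
        finally show "\<phi> (torus_pt m k (z \<circ> (Transposition.transpose a b \<circ> p))) = \<phi> (torus_pt m k z)"
          by (simp add: o_assoc)
      qed
    qed
  qed
  show ?thesis
    using \<sigma> main z by blast
qed

lemma G_invariant_modulus:
  assumes inv: "G_invariant m k \<phi>" and km: "k < m" and z: "\<forall>j\<in>{0..m}. z j \<noteq> 0"
  shows "\<phi> (torus_pt m k (\<lambda>j. of_real (cmod (z j)))) = \<phi> (torus_pt m k z)"
proof -
  have main: "\<phi> (torus_pt m k (\<lambda>j. if j \<in> B then of_real (cmod (z j)) else z j)) = \<phi> (torus_pt m k z)"
    if "finite B" "B \<subseteq> {0..m}" for B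
    using that
  proof (induction B rule: finite_induct)
    case (insert l B)
    let ?z = "\<lambda>j. if j \<in> B then of_real (cmod (z j)) else z j"
    have zl: "?z l = z l" "l \<in> {0..m}" using insert by auto
    define \<theta> where "\<theta> = 2 * pi - Arg2pi (z l)"
    have \<theta>: "\<theta> \<in> {0..2 * pi}" using Arg2pi[of "z l"] by (auto simp: \<theta>_def)
    let ?g = "\<lambda>u::cvec. u(l := u l * cis \<theta>)"
    have "z l * cis \<theta> = of_real (cmod (z l)) * (cis (Arg2pi (z l)) * cis \<theta>)"
      using Arg2pi_eq[of "z l"] by (simp add: cis_conv_exp)
    also have "cis (Arg2pi (z l)) * cis \<theta> = 1"
      by (simp add: cis_mult \<theta>_def)
    finally have zc: "z l * cis \<theta> = of_real (cmod (z l))" by simp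
    have "induced ?g (torus_pt m k ?z) = torus_pt m k (?g ?z)"
      by (intro induced_torus_pt) (auto simp: fun_eq_iff res_def)
    moreover have "?g ?z = (\<lambda>j. if j \<in> insert l B then of_real (cmod (z j)) else z j)"
      using zl zc by (auto simp: fun_eq_iff)
    moreover have "torus_pt m k ?z \<in> blowup m k"
      using z by (intro torus_pt_in_blowup[OF km]) auto
    ultimately show ?case
      using G_invariant_generator[OF inv generators.phase[OF zl(2) \<theta>], of "torus_pt m k ?z"] insert by simp
  qed simp
  have "\<phi> (torus_pt m k (\<lambda>j. of_real (cmod (z j)))) = \<phi> (torus_pt m k (\<lambda>j. if j \<in> {0..m} then of_real (cmod (z j)) else z j))"
    by (intro arg_cong[where f = \<phi>] torus_pt_cong[OF km]) auto
  then show ?thesis using main[of "{0..m}"] by simp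
qed

text \<open>
  An invariant function in logarithmic coordinates.
\<close>

definition log_function :: "nat \<Rightarrow> nat \<Rightarrow> (triple \<Rightarrow> real) \<Rightarrow> (nat \<Rightarrow> real) \<Rightarrow> real" where
  "log_function m k \<phi> x = \<phi> (torus_pt m k (\<lambda>j. of_real (exp (x j))))"

lemma chart_eq_log_function:
  assumes inv: "G_invariant m k \<phi>" and km: "k < m" and c: "c \<in> charts m k"
    and w: "\<forall>j\<in>coord_set m c. w j \<noteq> 0"
  shows "\<phi> (chart m k c w) = log_function m k \<phi> (\<lambda>j. ln (cmod (lift_z m k c w j)))"
proof -
  have nz: "\<forall>j\<in>{0..m}. lift_z m k c w j \<noteq> 0"
    using lift_nonzero(3)[OF c w km] by blast
  have "\<phi> (chart m k c w) = \<phi> (torus_pt m k (\<lambda>j. of_real (cmod (lift_z m k c w j))))"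
    using G_invariant_modulus[OF inv km nz] chart_eq_torus_pt[OF c km w] by simp
  also have "torus_pt m k (\<lambda>j. complex_of_real (cmod (lift_z m k c w j)))
      = torus_pt m k (\<lambda>j. of_real (exp (ln (cmod (lift_z m k c w j)))))"
    by (rule torus_pt_cong[OF km]) (use nz in simp)
  finally show ?thesis by (simp add: log_function_def)
qed

section \<open>Convexity\<close>

lemma lse_shift:
  assumes "finite A" "A \<noteq> {}"
  shows "lse A (\<lambda>j. y j + c) = lse A y + 2 * c"
proof -
  have "(\<Sum>j\<in>A. exp (2 * (y j + c))) = (\<Sum>j\<in>A. exp (2 * y j)) * exp (2 * c)"
    by (simp add: sum_distrib_right exp_add ring_distribs)
  then show ?thesis
    unfolding lse_def using sum_exp_pos[OF assms, of y] by (simp add: ln_mult)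
qed

text \<open>
  The second derivative is four times the variance of \<open>\<kappa>\<close> for the weights \<open>e\<close>.
\<close>

lemma lse_derivatives:
  fixes b \<kappa> :: "nat \<Rightarrow> real"
  assumes J: "finite J" "J \<noteq> {}"
  defines "e \<equiv> \<lambda>j s. exp (2 * (b j + \<kappa> j * s))"
  shows "((\<lambda>s. lse J (\<lambda>j. b j + \<kappa> j * s)) has_real_derivative
      2 * (\<Sum>j\<in>J. \<kappa> j * e j s) / (\<Sum>j\<in>J. e j s)) (at s)"
    and "((\<lambda>s. 2 * (\<Sum>j\<in>J. \<kappa> j * e j s) / (\<Sum>j\<in>J. e j s)) has_real_derivative
      4 * ((\<Sum>j\<in>J. (\<kappa> j)\<^sup>2 * e j s) / (\<Sum>j\<in>J. e j s) - (\<Sum>j\<in>J. \<kappa> j * e j s)\<^sup>2 / (\<Sum>j\<in>J. e j s)\<^sup>2)) (at s)"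
proof -
  have pos: "(\<Sum>j\<in>J. e j s) > 0" for s
    unfolding e_def by (rule sum_exp_pos[OF J])
  have lse_e: "lse J (\<lambda>j. b j + \<kappa> j * s) = ln (\<Sum>j\<in>J. e j s)" for s
    unfolding lse_def e_def ..
  have e: "(e j has_real_derivative 2 * (\<kappa> j * e j s)) (at s)" for j s
    unfolding e_def by (auto intro!: derivative_eq_intros)
  have 0: "((\<lambda>s. \<Sum>j\<in>J. e j s) has_real_derivative 2 * (\<Sum>j\<in>J. \<kappa> j * e j s)) (at s)" for s
    unfolding sum_distrib_left by (intro DERIV_sum e)
  show "((\<lambda>s. lse J (\<lambda>j. b j + \<kappa> j * s)) has_real_derivative
      2 * (\<Sum>j\<in>J. \<kappa> j * e j s) / (\<Sum>j\<in>J. e j s)) (at s)"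
    unfolding lse_e
    using DERIV_chain2[OF DERIV_ln[OF pos] 0] by (simp add: field_simps)
  have 1: "((\<lambda>s. 2 * (\<Sum>j\<in>J. \<kappa> j * e j s)) has_real_derivative 4 * (\<Sum>j\<in>J. (\<kappa> j)\<^sup>2 * e j s)) (at s)"
  proof -
    have "((\<lambda>s. \<Sum>j\<in>J. \<kappa> j * e j s) has_real_derivative (\<Sum>j\<in>J. \<kappa> j * (2 * (\<kappa> j * e j s)))) (at s)"
      by (intro DERIV_sum DERIV_cmult e)
    from DERIV_cmult[OF this, of 2] show ?thesis
      by (simp add: sum_distrib_left power2_eq_square mult_ac)
  qed
  have "((\<lambda>s. 2 * (\<Sum>j\<in>J. \<kappa> j * e j s) / (\<Sum>j\<in>J. e j s)) has_real_derivative
      (4 * (\<Sum>j\<in>J. (\<kappa> j)\<^sup>2 * e j s) * (\<Sum>j\<in>J. e j s)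
        - 2 * (\<Sum>j\<in>J. \<kappa> j * e j s) * (2 * (\<Sum>j\<in>J. \<kappa> j * e j s))) / ((\<Sum>j\<in>J. e j s) * (\<Sum>j\<in>J. e j s))) (at s)"
    by (rule DERIV_divide[OF 1 0]) (use pos[of s] in simp)
  then show "((\<lambda>s. 2 * (\<Sum>j\<in>J. \<kappa> j * e j s) / (\<Sum>j\<in>J. e j s)) has_real_derivative
      4 * ((\<Sum>j\<in>J. (\<kappa> j)\<^sup>2 * e j s) / (\<Sum>j\<in>J. e j s) - (\<Sum>j\<in>J. \<kappa> j * e j s)\<^sup>2 / (\<Sum>j\<in>J. e j s)\<^sup>2)) (at s)"
    by (rule DERIV_cong) (use pos[of s] in \<open>simp add: field_simps power2_eq_square\<close>)
qed

text \<open>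
  The same variance, from the formula for the Fubini-Study metric: on a vector along which every
  component of the lift is scaled by a factor \<open>\<kappa> j\<close>.
\<close>

lemma fs_term_quadratic:
  fixes a \<kappa> q :: "nat \<Rightarrow> real"
  assumes D: "\<And>j. j \<in> J \<Longrightarrow> (\<Sum>\<nu>\<in>I. of_real (a \<nu>) * dF \<nu> j) = of_real (\<kappa> j * q j)"
    and F: "\<And>j. j \<in> J \<Longrightarrow> F j = of_real (q j)"
  shows "(\<Sum>\<nu>\<in>I. \<Sum>\<mu>\<in>I. Re (fs_term J F dF N \<nu> \<mu>) * (a \<nu> * a \<mu>))
    = (\<Sum>j\<in>J. (\<kappa> j)\<^sup>2 * (q j)\<^sup>2) / N - (\<Sum>j\<in>J. \<kappa> j * (q j)\<^sup>2)\<^sup>2 / N\<^sup>2"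
proof -
  let ?a = "\<lambda>\<nu>. complex_of_real (a \<nu>)"
  let ?P = "\<lambda>\<nu> \<mu>. \<Sum>j\<in>J. dF \<nu> j * cnj (dF \<mu> j)"
  let ?Q = "\<lambda>\<nu>. \<Sum>j\<in>J. dF \<nu> j * cnj (F j)"
  let ?R = "\<lambda>\<mu>. \<Sum>j\<in>J. F j * cnj (dF \<mu> j)"
  have Dc: "(\<Sum>\<mu>\<in>I. ?a \<mu> * cnj (dF \<mu> j)) = of_real (\<kappa> j * q j)" if "j \<in> J" for j
  proof -
    have "(\<Sum>\<mu>\<in>I. ?a \<mu> * cnj (dF \<mu> j)) = cnj (\<Sum>\<nu>\<in>I. ?a \<nu> * dF \<nu> j)" by simp
    then show ?thesis using D[OF that] by simp
  qed
  have P: "(\<Sum>\<nu>\<in>I. \<Sum>\<mu>\<in>I. ?P \<nu> \<mu> * (?a \<nu> * ?a \<mu>)) = of_real (\<Sum>j\<in>J. (\<kappa> j)\<^sup>2 * (q j)\<^sup>2)"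
  proof -
    have "(\<Sum>\<nu>\<in>I. \<Sum>\<mu>\<in>I. ?P \<nu> \<mu> * (?a \<nu> * ?a \<mu>))
        = (\<Sum>\<nu>\<in>I. \<Sum>\<mu>\<in>I. \<Sum>j\<in>J. (?a \<nu> * dF \<nu> j) * (?a \<mu> * cnj (dF \<mu> j)))"
      by (simp add: sum_distrib_left sum_distrib_right mult_ac)
    also have "\<dots> = (\<Sum>\<nu>\<in>I. \<Sum>j\<in>J. \<Sum>\<mu>\<in>I. (?a \<nu> * dF \<nu> j) * (?a \<mu> * cnj (dF \<mu> j)))"
      by (intro sum.cong refl sum.swap)
    also have "\<dots> = (\<Sum>j\<in>J. \<Sum>\<nu>\<in>I. \<Sum>\<mu>\<in>I. (?a \<nu> * dF \<nu> j) * (?a \<mu> * cnj (dF \<mu> j)))"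
      by (rule sum.swap)
    also have "\<dots> = (\<Sum>j\<in>J. of_real (\<kappa> j * q j) * of_real (\<kappa> j * q j))"
    proof (rule sum.cong[OF refl])
      fix j assume j: "j \<in> J"
      show "(\<Sum>\<nu>\<in>I. \<Sum>\<mu>\<in>I. (?a \<nu> * dF \<nu> j) * (?a \<mu> * cnj (dF \<mu> j))) = of_real (\<kappa> j * q j) * of_real (\<kappa> j * q j)"
        unfolding sum_product[symmetric] D[OF j] Dc[OF j] ..
    qed
    finally show ?thesis by (simp add: power2_eq_square mult_ac)
  qed
  have Q: "(\<Sum>\<nu>\<in>I. ?a \<nu> * ?Q \<nu>) = of_real (\<Sum>j\<in>J. \<kappa> j * (q j)\<^sup>2)"
  proof -
    have "(\<Sum>\<nu>\<in>I. ?a \<nu> * ?Q \<nu>) = (\<Sum>\<nu>\<in>I. \<Sum>j\<in>J. (?a \<nu> * dF \<nu> j) * cnj (F j))"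
      by (simp add: sum_distrib_left mult_ac)
    also have "\<dots> = (\<Sum>j\<in>J. (\<Sum>\<nu>\<in>I. ?a \<nu> * dF \<nu> j) * cnj (F j))"
      by (subst sum.swap) (simp add: sum_distrib_right)
    also have "\<dots> = (\<Sum>j\<in>J. of_real (\<kappa> j * (q j)\<^sup>2))"
      by (intro sum.cong) (simp_all add: D F power2_eq_square)
    finally show ?thesis by simp
  qed
  have R: "(\<Sum>\<mu>\<in>I. ?a \<mu> * ?R \<mu>) = of_real (\<Sum>j\<in>J. \<kappa> j * (q j)\<^sup>2)"
  proof -
    have "(\<Sum>\<mu>\<in>I. ?a \<mu> * ?R \<mu>) = (\<Sum>\<mu>\<in>I. \<Sum>j\<in>J. (?a \<mu> * cnj (dF \<mu> j)) * F j)"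
      by (simp add: sum_distrib_left mult_ac)
    also have "\<dots> = (\<Sum>j\<in>J. (\<Sum>\<mu>\<in>I. ?a \<mu> * cnj (dF \<mu> j)) * F j)"
      by (subst sum.swap) (simp add: sum_distrib_right)
    also have "\<dots> = (\<Sum>j\<in>J. of_real (\<kappa> j * (q j)\<^sup>2))"
      by (intro sum.cong) (simp_all add: Dc F power2_eq_square)
    finally show ?thesis by simp
  qed
  have "(\<Sum>\<nu>\<in>I. \<Sum>\<mu>\<in>I. fs_term J F dF N \<nu> \<mu> * (?a \<nu> * ?a \<mu>))
      = (\<Sum>\<nu>\<in>I. \<Sum>\<mu>\<in>I. ?P \<nu> \<mu> * (?a \<nu> * ?a \<mu>)) / of_real N
        - (\<Sum>\<nu>\<in>I. \<Sum>\<mu>\<in>I. (?a \<nu> * ?Q \<nu>) * (?a \<mu> * ?R \<mu>)) / (of_real N)\<^sup>2"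
    unfolding sum_divide_distrib sum_subtractf[symmetric]
    by (intro sum.cong refl) (simp add: fs_term_def left_diff_distrib right_diff_distrib mult_ac)
  also have "\<dots> = of_real ((\<Sum>j\<in>J. (\<kappa> j)\<^sup>2 * (q j)\<^sup>2) / N - (\<Sum>j\<in>J. \<kappa> j * (q j)\<^sup>2)\<^sup>2 / N\<^sup>2)"
    unfolding P sum_product[symmetric] Q R by (simp add: power2_eq_square)
  finally have "Re (\<Sum>\<nu>\<in>I. \<Sum>\<mu>\<in>I. fs_term J F dF N \<nu> \<mu> * (?a \<nu> * ?a \<mu>))
      = (\<Sum>j\<in>J. (\<kappa> j)\<^sup>2 * (q j)\<^sup>2) / N - (\<Sum>j\<in>J. \<kappa> j * (q j)\<^sup>2)\<^sup>2 / N\<^sup>2"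
    by (simp only: Re_complex_of_real)
  then show ?thesis by (simp flip: of_real_mult)
qed

lemma lift_modulus:
  assumes km: "k < m" and c: "c \<in> charts m k"
  shows "lift_z m k c (\<lambda>j. if j \<in> coord_set m c then of_real (cmod (w j)) else w j) j
    = of_real (cmod (lift_z m k c w j))"
proof -
  obtain i p r where cc: "c = (i, p, r)" by (cases c)
  have ip: "i \<in> {0..k}" "p \<in> {k+1..m}" "r = i \<or> r = p" using c by (auto simp: charts_def cc)
  let ?w = "\<lambda>j. if j \<in> coord_set m c then complex_of_real (cmod (w j)) else w j"
  have *: "(?w(r := 1)) j = of_real (cmod ((w(r := 1)) j))" if "j \<in> {0..m}" for j
    using that by (auto simp: coord_set_def cc)
  have st: "(?w(r := 1)) i = of_real (cmod ((w(r := 1)) i))" "(?w(r := 1)) p = of_real (cmod ((w(r := 1)) p))"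
    by (rule *, use ip km in force)+
  have \<zeta>: "lift_\<zeta> m k c ?w j = of_real (cmod (lift_\<zeta> m k c w j))" for j
    using ip km by (auto simp: cc lift_\<zeta>_def coord_set_def)
  have \<eta>: "lift_\<eta> m k c ?w j = of_real (cmod (lift_\<eta> m k c w j))" for j
    using ip km by (auto simp: cc lift_\<eta>_def coord_set_def)
  consider "j \<in> {0..k}" | "j \<in> {k+1..m}" | "j \<notin> {0..k}" "j \<notin> {k+1..m}" by blast
  then show ?thesis
  proof cases
    case 1
    show ?thesis unfolding lift_z_low[OF cc 1] st \<zeta> by (simp add: norm_mult)
  next
    case 2
    show ?thesis unfolding lift_z_high[OF cc 2] st \<eta> by (simp add: norm_mult)
  next
    case 3
    show ?thesis unfolding lift_z_out[OF 3] by simp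
  qed
qed

lemma chart_torus_invariant:
  assumes inv: "G_invariant m k \<phi>" and km: "k < m" and c: "c \<in> charts m k"
  shows "torus_invariant (coord_set m c) (\<phi> \<circ> chart m k c)"
  unfolding torus_invariant_def
proof (intro ballI impI)
  fix w :: cvec assume w: "\<forall>j\<in>coord_set m c. w j \<noteq> 0"
  let ?w = "\<lambda>j. if j \<in> coord_set m c then complex_of_real (cmod (w j)) else w j"
  have w': "\<forall>j\<in>coord_set m c. ?w j \<noteq> 0" using w by simp
  show "(\<phi> \<circ> chart m k c) w = (\<phi> \<circ> chart m k c) ?w"
    by (simp only: o_apply chart_eq_log_function[OF inv km c w] chart_eq_log_function[OF inv km c w']
        lift_modulus[OF km c] norm_of_real abs_norm_cancel)
qed

lemma sum_dcoord:
  fixes a :: "nat \<Rightarrow> real"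
  assumes "finite I" "j \<noteq> b \<Longrightarrow> j \<in> I"
  shows "(\<Sum>\<nu>\<in>I. of_real (a \<nu>) * dcoord b j \<nu>) = of_real (if j = b then 0 else a j)"
proof -
  have "(\<Sum>\<nu>\<in>I. of_real (a \<nu>) * dcoord b j \<nu>) = (\<Sum>\<nu>\<in>I. if \<nu> = j then of_real (if j = b then 0 else a j) else 0)"
    by (intro sum.cong) (auto simp: dcoord_def)
  then show ?thesis using assms by (cases "j = b") auto
qed

lemma DERIV_sum_affine_argument:
  assumes "(A has_real_derivative a) (at s)" "(B has_real_derivative b) (at s)"
    "(C has_real_derivative c) (at s)" "(D has_real_derivative d) (at s)"
  shows "((\<lambda>s. A s + (2 * (B s + 2 * (p + s * q)) + x * (C s + 2 * (p + s * q)) + y * (D s + 2 * (p' + s * q'))))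
    has_real_derivative a + (2 * (b + 2 * q) + x * (c + 2 * q) + y * (d + 2 * q'))) (at s)"
  using assms by (auto intro!: derivative_eq_intros simp: algebra_simps)

lemma DERIV_sum_affine_shift:
  assumes "(A has_real_derivative a) (at s)" "(B has_real_derivative b) (at s)"
    "(C has_real_derivative c) (at s)" "(D has_real_derivative d) (at s)"
  shows "((\<lambda>s. A s + (2 * (B s + p) + x * (C s + p) + y * (D s + p')))
    has_real_derivative a + (2 * b + x * c + y * d)) (at s)"
  using assms by (auto intro!: derivative_eq_intros simp: algebra_simps)

text \<open>
  The line \<open>X + s L\<close> in homogeneous logarithmic coordinates, seen in the chart \<open>(0, m, 0)\<close>, where it is the
  curve \<open>\<gamma>\<close> of points with positive real coordinates \<open>v j s\<close> and velocities \<open>vel j s\<close>. One chart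
  suffices because each chart contains all points with nonzero coordinates.
\<close>

locale log_line =
  fixes m k :: nat and \<phi> :: "triple \<Rightarrow> real" and X L :: "nat \<Rightarrow> real"
  assumes km: "k < m" and smooth: "smooth_on_blowup m k \<phi>" and adm: "admissible m k \<phi>"
    and inv: "G_invariant m k \<phi>"
begin

definition "c0 = (0::nat, m, 0::nat)"
definition "I = coord_set m c0"
definition "coord Y j = (if j = m then Y m - Y 0 else if j \<le> k then Y j - Y 0 else Y j - (Y m :: real))"
definition "v j s = exp (coord X j) * exp (coord L j * s)"
definition "\<gamma> s = restrict (\<lambda>j. complex_of_real (v j s)) I"
definition "vel j s = coord L j * v j s"

lemma c0: "c0 \<in> charts m k"
  using km by (auto simp: c0_def charts_def)

lemma I_eq: "I = {1..m}"
  by (auto simp: I_def c0_def coord_set_def)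

lemma finI: "finite I" by (simp add: I_eq)

lemma \<gamma>_pos: "j \<in> I \<Longrightarrow> \<gamma> s j = of_real (v j s)" "v j s > 0" "\<forall>j\<in>coord_set m c0. \<gamma> s j \<noteq> 0"
  by (auto simp: \<gamma>_def v_def I_def)

lemma \<gamma>_space: "\<gamma> s \<in> coord_space (coord_set m c0)"
  by (simp add: \<gamma>_def coord_space_def I_def)

abbreviation "q b j s \<equiv> exp ((X j - X b) + (L j - L b) * s)"

lemma v_low: "j \<in> {0..k} \<Longrightarrow> j \<noteq> 0 \<Longrightarrow> v j s = q 0 j s"
  and v_high: "j \<in> {k+1..m} \<Longrightarrow> j \<noteq> m \<Longrightarrow> v j s = q m j s"
  and v_m: "v m s = q 0 m s"
  using km by (auto simp: v_def coord_def exp_add)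

lemma lift\<zeta>: assumes "j \<in> {0..k}" shows "lift_\<zeta> m k c0 (\<gamma> s) j = of_real (q 0 j s)"
proof (cases "j = 0")
  case False
  then have "lift_\<zeta> m k c0 (\<gamma> s) j = \<gamma> s j" using assms by (simp add: lift_\<zeta>_def c0_def)
  then show ?thesis using assms False km v_low[OF assms False] \<gamma>_pos(1)[of j s] by (simp add: I_eq)
qed (simp add: lift_\<zeta>_def c0_def)

lemma lift\<eta>: assumes "j \<in> {k+1..m}" shows "lift_\<eta> m k c0 (\<gamma> s) j = of_real (q m j s)"
proof (cases "j = m")
  case False
  then have "lift_\<eta> m k c0 (\<gamma> s) j = \<gamma> s j" using assms by (simp add: lift_\<eta>_def c0_def)
  then show ?thesis using assms False km v_high[OF assms False] \<gamma>_pos(1)[of j s] by (simp add: I_eq)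
qed (use km in \<open>simp add: lift_\<eta>_def c0_def\<close>)

lemma \<gamma>m: "((\<gamma> s)(0 := 1)) m = of_real (q 0 m s)"
  using km \<gamma>_pos(1)[of m s] v_m by (simp add: I_eq)

lemma q_mult: "q 0 m s * q m j s = q 0 j s"
  by (simp add: algebra_simps flip: exp_add)

lemma liftz: assumes "j \<in> {0..m}" shows "lift_z m k c0 (\<gamma> s) j = of_real (q 0 j s)"
proof (cases "j \<in> {0..k}")
  case True
  show ?thesis unfolding lift_z_low[OF c0_def True] lift\<zeta>[OF True] by simp
next
  case False
  then have j: "j \<in> {k+1..m}" using assms by auto
  show ?thesis unfolding lift_z_high[OF c0_def j] lift\<eta>[OF j] \<gamma>m
    using q_mult[of s j] by (simp flip: of_real_mult)
qed

lemma D\<zeta>: assumes "j \<in> {0..k}"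
  shows "(\<Sum>\<nu>\<in>I. of_real (vel \<nu> s) * d\<zeta> m k c0 \<nu> (\<gamma> s) j) = of_real ((L j - L 0) * q 0 j s)"
proof -
  have "(\<Sum>\<nu>\<in>I. of_real (vel \<nu> s) * d\<zeta> m k c0 \<nu> (\<gamma> s) j) = of_real (if j = 0 then 0 else vel j s)"
    using assms km by (subst sum_dcoord[OF finI, of j 0, symmetric]) (auto simp: I_eq d\<zeta>_def c0_def)
  also have "(if j = 0 then 0 else vel j s) = (L j - L 0) * q 0 j s"
    using v_low[OF assms] assms km by (simp add: vel_def coord_def)
  finally show ?thesis .
qed

lemma D\<eta>: assumes "j \<in> {k+1..m}"
  shows "(\<Sum>\<nu>\<in>I. of_real (vel \<nu> s) * d\<eta> m k c0 \<nu> (\<gamma> s) j) = of_real ((L j - L m) * q m j s)"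
proof -
  have "(\<Sum>\<nu>\<in>I. of_real (vel \<nu> s) * d\<eta> m k c0 \<nu> (\<gamma> s) j) = of_real (if j = m then 0 else vel j s)"
    using assms km by (subst sum_dcoord[OF finI, of j m, symmetric]) (auto simp: I_eq d\<eta>_def c0_def)
  also have "(if j = m then 0 else vel j s) = (L j - L m) * q m j s"
    using v_high[OF assms] assms km by (simp add: vel_def coord_def)
  finally show ?thesis .
qed

lemma Dz: assumes "j \<in> {0..m}"
  shows "(\<Sum>\<nu>\<in>I. of_real (vel \<nu> s) * dz m k c0 \<nu> (\<gamma> s) j) = of_real ((L j - L 0) * q 0 j s)"
proof (cases "j \<in> {0..k}")
  case True
  have "dz m k c0 \<nu> (\<gamma> s) j = d\<zeta> m k c0 \<nu> (\<gamma> s) j" for \<nu>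
    using True km by (simp add: dz_def c0_def dcoord_def d\<eta>_def lift_\<eta>_def)
  then show ?thesis using D\<zeta>[OF True] by simp
next
  case False
  then have j: "j \<in> {k+1..m}" using assms by auto
  have "dz m k c0 \<nu> (\<gamma> s) j = of_real (q 0 m s) * d\<eta> m k c0 \<nu> (\<gamma> s) j + dcoord 0 m \<nu> * of_real (q m j s)" for \<nu>
    unfolding dz_def c0_def prod.case \<gamma>m lift\<eta>[OF j, unfolded c0_def] using False
    by (simp add: dcoord_def d\<zeta>_def lift_\<zeta>_def)
  then have "(\<Sum>\<nu>\<in>I. of_real (vel \<nu> s) * dz m k c0 \<nu> (\<gamma> s) j)
     = (\<Sum>\<nu>\<in>I. of_real (q 0 m s) * (of_real (vel \<nu> s) * d\<eta> m k c0 \<nu> (\<gamma> s) j)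
        + (of_real (vel \<nu> s) * dcoord 0 m \<nu>) * of_real (q m j s))"
    by (intro sum.cong) (simp_all add: algebra_simps)
  also have "\<dots> = of_real (q 0 m s) * of_real ((L j - L m) * q m j s) + of_real (vel m s) * of_real (q m j s)"
    unfolding sum.distrib sum_distrib_left[symmetric] sum_distrib_right[symmetric] D\<eta>[OF j]
    using sum_dcoord[OF finI, of m 0 "\<lambda>\<nu>. vel \<nu> s"] km by (simp add: I_eq)
  also have "\<dots> = of_real ((L j - L m) * (q 0 m s * q m j s) + (L m - L 0) * (q 0 m s * q m j s))"
    using v_m[of s] by (simp add: vel_def coord_def)
  also have "\<dots> = of_real ((L j - L 0) * q 0 j s)"
    unfolding q_mult by (simp add: algebra_simps)
  finally show ?thesis .
qed

lemma N_eq: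
  "N\<zeta> m k c0 (\<gamma> s) = (\<Sum>j\<in>{0..k}. (q 0 j s)\<^sup>2)" "N\<eta> m k c0 (\<gamma> s) = (\<Sum>j\<in>{k+1..m}. (q m j s)\<^sup>2)"
  "Nz m k c0 (\<gamma> s) = (\<Sum>j\<in>{0..m}. (q 0 j s)\<^sup>2)"
proof -
  show "N\<zeta> m k c0 (\<gamma> s) = (\<Sum>j\<in>{0..k}. (q 0 j s)\<^sup>2)"
    unfolding N\<zeta>_def by (intro sum.cong refl) (simp only: lift\<zeta> norm_of_real abs_exp_cancel)
  show "N\<eta> m k c0 (\<gamma> s) = (\<Sum>j\<in>{k+1..m}. (q m j s)\<^sup>2)"
    unfolding N\<eta>_def by (intro sum.cong refl) (simp only: lift\<eta> norm_of_real abs_exp_cancel)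
  show "Nz m k c0 (\<gamma> s) = (\<Sum>j\<in>{0..m}. (q 0 j s)\<^sup>2)"
    unfolding Nz_def by (intro sum.cong refl) (simp only: liftz norm_of_real abs_exp_cancel)
qed

text \<open>
  The Hermitian form \<open>dd\<close> evaluated on the velocity.
\<close>

definition "Q dd s = (\<Sum>\<nu>\<in>I. \<Sum>\<mu>\<in>I. Re (dd \<nu> \<mu>) * (vel \<nu> s * vel \<mu> s))"

lemma q_sq: "(q b j s)\<^sup>2 = exp (2 * ((X j - X b) + (L j - L b) * s))"
  by (simp add: power2_eq_square flip: exp_add)

lemma lse_line:
  assumes J: "finite J" "J \<noteq> {}"
    and D: "\<And>j s. j \<in> J \<Longrightarrow> (\<Sum>\<nu>\<in>I. of_real (vel \<nu> s) * dF s \<nu> j) = of_real ((L j - L b) * q b j s)"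
    and F: "\<And>j s. j \<in> J \<Longrightarrow> F s j = of_real (q b j s)"
    and N: "\<And>s. N s = (\<Sum>j\<in>J. (q b j s)\<^sup>2)"
  shows "\<exists>f'. (\<forall>s. ((\<lambda>s. lse J (\<lambda>j. (X j - X b) + (L j - L b) * s)) has_real_derivative f' s) (at s))
    \<and> (\<forall>s. (f' has_real_derivative 4 * Q (fs_term J (F s) (dF s) (N s)) s) (at s))"
proof (intro exI conjI allI)
  fix s
  show "((\<lambda>s. lse J (\<lambda>j. (X j - X b) + (L j - L b) * s)) has_real_derivative
     2 * (\<Sum>j\<in>J. (L j - L b) * exp (2 * ((X j - X b) + (L j - L b) * s)))
       / (\<Sum>j\<in>J. exp (2 * ((X j - X b) + (L j - L b) * s)))) (at s)"
    by (rule lse_derivatives(1)[OF J])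
  have "Q (fs_term J (F s) (dF s) (N s)) s
     = (\<Sum>j\<in>J. (L j - L b)\<^sup>2 * (q b j s)\<^sup>2) / N s - (\<Sum>j\<in>J. (L j - L b) * (q b j s)\<^sup>2)\<^sup>2 / (N s)\<^sup>2"
    unfolding Q_def by (rule fs_term_quadratic) (use D F in auto)
  then show "((\<lambda>s. 2 * (\<Sum>j\<in>J. (L j - L b) * exp (2 * ((X j - X b) + (L j - L b) * s)))
       / (\<Sum>j\<in>J. exp (2 * ((X j - X b) + (L j - L b) * s)))) has_real_derivative
     4 * Q (fs_term J (F s) (dF s) (N s)) s) (at s)"
    unfolding N q_sq using lse_derivatives(2)[OF J, where b = "\<lambda>j. X j - X b" and \<kappa> = "\<lambda>j. L j - L b" and s = s]
    by (simp only:)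
qed

lemma torus_pt_line: "chart m k c0 (\<gamma> s) = torus_pt m k (\<lambda>j. of_real (exp (X j + s * L j)))"
proof -
  have "chart m k c0 (\<gamma> s) = torus_pt m k (lift_z m k c0 (\<gamma> s))"
    by (rule chart_eq_torus_pt[OF c0 km \<gamma>_pos(3)])
  also have "\<dots> = torus_pt m k (\<lambda>j. of_real (exp (- (X 0 + s * L 0))) * of_real (exp (X j + s * L j)))"
  proof (rule torus_pt_cong[OF km])
    fix j assume "j \<in> {0..m}"
    then show "lift_z m k c0 (\<gamma> s) j = of_real (exp (- (X 0 + s * L 0))) * of_real (exp (X j + s * L j))"
      by (simp add: liftz algebra_simps flip: of_real_mult exp_add)
  qed
  also have "\<dots> = torus_pt m k (\<lambda>j. of_real (exp (X j + s * L j)))"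
    by (rule torus_pt_scale) simp
  finally show ?thesis .
qed

lemma lse_line_eq:
  assumes "finite J" "J \<noteq> {}"
  shows "lse J (\<lambda>j. X j + s * L j) = lse J (\<lambda>j. (X j - X b) + (L j - L b) * s) + 2 * (X b + s * L b)"
  using lse_shift[OF assms, of "\<lambda>j. (X j - X b) + (L j - L b) * s" "X b + s * L b"]
  by (simp add: algebra_simps)

theorem convex_on_line:
  "convex_on UNIV (\<lambda>s. log_function m k \<phi> (\<lambda>j. X j + s * L j) + potential m k (\<lambda>j. X j + s * L j))"
proof -
  let ?f = "\<phi> \<circ> chart m k c0" and ?l = "real (m - k - 1)"
  let ?lz = "\<lambda>s. lse {0..m} (\<lambda>j. (X j - X 0) + (L j - L 0) * s)"
  let ?l\<zeta> = "\<lambda>s. lse {0..k} (\<lambda>j. (X j - X 0) + (L j - L 0) * s)"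
  let ?l\<eta> = "\<lambda>s. lse {k+1..m} (\<lambda>j. (X j - X m) + (L j - L m) * s)"
  have C2: "Ck (Suc (Suc 0)) I ?f"
    using smooth c0 unfolding smooth_on_blowup_def I_def by blast
  have tinv: "torus_invariant I ?f"
    unfolding I_def by (rule chart_torus_invariant[OF inv km c0])
  define f1 where "f1 s = (\<Sum>j\<in>I. partial 1 j ?f (\<gamma> s) * vel j s)" for s
  note second = torus_invariant_second_derivative[OF finI C2 tinv,
      where r = "\<lambda>j. exp (coord X j)" and l = "coord L", OF exp_gt_zero]
  have "((\<lambda>s. ?f (\<gamma> s)) has_real_derivative f1 s) (at s)" for s
    unfolding f1_def[abs_def] vel_def \<gamma>_def v_def by (rule second(1))
  moreover have "(f1 has_real_derivative 4 * Q (ddbar ?f (\<gamma> s)) s) (at s)" for s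
    unfolding f1_def[abs_def] vel_def \<gamma>_def v_def Q_def by (rule second(2))
  ultimately have f1: "((\<lambda>s. ?f (\<gamma> s)) has_real_derivative f1 s) (at s)"
    "(f1 has_real_derivative 4 * Q (ddbar ?f (\<gamma> s)) s) (at s)" for s
    by blast+
  let ?gz = "\<lambda>s. fs_term {0..m} (lift_z m k c0 (\<gamma> s)) (\<lambda>\<nu>. dz m k c0 \<nu> (\<gamma> s)) (Nz m k c0 (\<gamma> s))"
  let ?g\<zeta> = "\<lambda>s. fs_term {0..k} (lift_\<zeta> m k c0 (\<gamma> s)) (\<lambda>\<nu>. d\<zeta> m k c0 \<nu> (\<gamma> s)) (N\<zeta> m k c0 (\<gamma> s))"
  let ?g\<eta> = "\<lambda>s. fs_term {k+1..m} (lift_\<eta> m k c0 (\<gamma> s)) (\<lambda>\<nu>. d\<eta> m k c0 \<nu> (\<gamma> s)) (N\<eta> m k c0 (\<gamma> s))"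
  have "\<exists>f'. (\<forall>s. (?lz has_real_derivative f' s) (at s))
      \<and> (\<forall>s. (f' has_real_derivative 4 * Q (?gz s) s) (at s))"
    by (rule lse_line[OF _ _ Dz liftz N_eq(3)]) auto
  then obtain fz where fz: "\<And>s. (?lz has_real_derivative fz s) (at s)"
    "\<And>s. (fz has_real_derivative 4 * Q (?gz s) s) (at s)"
    by blast
  have "\<exists>f'. (\<forall>s. (?l\<zeta> has_real_derivative f' s) (at s))
      \<and> (\<forall>s. (f' has_real_derivative 4 * Q (?g\<zeta> s) s) (at s))"
    by (rule lse_line[OF _ _ D\<zeta> lift\<zeta> N_eq(1)]) auto
  then obtain f\<zeta> where f\<zeta>: "\<And>s. (?l\<zeta> has_real_derivative f\<zeta> s) (at s)"
    "\<And>s. (f\<zeta> has_real_derivative 4 * Q (?g\<zeta> s) s) (at s)"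
    by blast
  have ne: "{k+1..m} \<noteq> {}" using km by auto
  have "\<exists>f'. (\<forall>s. (?l\<eta> has_real_derivative f' s) (at s))
      \<and> (\<forall>s. (f' has_real_derivative 4 * Q (?g\<eta> s) s) (at s))"
    by (rule lse_line[OF _ _ D\<eta> lift\<eta> N_eq(2)]) (use ne in auto)
  then obtain f\<eta> where f\<eta>: "\<And>s. (?l\<eta> has_real_derivative f\<eta> s) (at s)"
    "\<And>s. (f\<eta> has_real_derivative 4 * Q (?g\<eta> s) s) (at s)"
    by blast
  have u: "log_function m k \<phi> (\<lambda>j. X j + s * L j) + potential m k (\<lambda>j. X j + s * L j)
    = ?f (\<gamma> s) + (2 * (?lz s + 2 * (X 0 + s * L 0))
      + real k * (?l\<zeta> s + 2 * (X 0 + s * L 0))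
      + ?l * (?l\<eta> s + 2 * (X m + s * L m)))" for s
    unfolding log_function_def potential_def o_apply torus_pt_line
    using lse_line_eq[of "{0..m}" s 0] lse_line_eq[of "{0..k}" s 0] lse_line_eq[OF _ ne, of s m] by simp
  show ?thesis
    unfolding u
  proof (rule f''_ge0_imp_convex)
    fix s :: real
    show "((\<lambda>s. ?f (\<gamma> s) + (2 * (?lz s + 2 * (X 0 + s * L 0))
      + real k * (?l\<zeta> s + 2 * (X 0 + s * L 0))
      + ?l * (?l\<eta> s + 2 * (X m + s * L m)))) has_real_derivative
      f1 s + (2 * (fz s + 2 * L 0) + real k * (f\<zeta> s + 2 * L 0) + ?l * (f\<eta> s + 2 * L m))) (at s)"
      by (rule DERIV_sum_affine_argument[OF f1(1) fz(1) f\<zeta>(1) f\<eta>(1)])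
    let ?A = "\<lambda>\<nu> \<mu>. ghat m k c0 (\<gamma> s) \<nu> \<mu> + ddbar ?f (\<gamma> s) \<nu> \<mu>"
    show "((\<lambda>s. f1 s + (2 * (fz s + 2 * L 0) + real k * (f\<zeta> s + 2 * L 0) + ?l * (f\<eta> s + 2 * L m)))
      has_real_derivative 4 * Q ?A s) (at s)"
    proof (rule DERIV_cong)
      show "((\<lambda>s. f1 s + (2 * (fz s + 2 * L 0) + real k * (f\<zeta> s + 2 * L 0) + ?l * (f\<eta> s + 2 * L m)))
        has_real_derivative 4 * Q (ddbar ?f (\<gamma> s)) s
          + (2 * (4 * Q (?gz s) s) + real k * (4 * Q (?g\<zeta> s) s) + ?l * (4 * Q (?g\<eta> s) s))) (at s)"
        by (rule DERIV_sum_affine_shift[OF f1(2) fz(2) f\<zeta>(2) f\<eta>(2)])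
      show "4 * Q (ddbar ?f (\<gamma> s)) s
          + (2 * (4 * Q (?gz s) s) + real k * (4 * Q (?g\<zeta> s) s) + ?l * (4 * Q (?g\<eta> s) s)) = 4 * Q ?A s"
        unfolding Q_def ghat_eq[OF c0]
        by (simp add: sum.distrib distrib_right distrib_left sum_distrib_left mult.assoc mult.left_commute[of _ 4])
    qed
    have pd: "pos_def_hermitian I ?A"
      using adm c0 \<gamma>_space[of s] unfolding admissible_def I_def by blast
    have "Q ?A s = Re (\<Sum>\<nu>\<in>I. \<Sum>\<mu>\<in>I. ?A \<nu> \<mu> * of_real (vel \<nu> s) * cnj (of_real (vel \<mu> s)))"
      unfolding Q_def by (simp add: mult.assoc flip: of_real_mult)
    also have "\<dots> \<ge> 0"
    proof (cases "\<exists>\<nu>\<in>I. vel \<nu> s \<noteq> 0")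
      case True
      then have "\<exists>\<nu>\<in>I. complex_of_real (vel \<nu> s) \<noteq> 0" by simp
      then show ?thesis
        using pd unfolding pos_def_hermitian_def by (meson less_imp_le)
    qed simp
    finally show "4 * Q ?A s \<ge> 0" by simp
  qed simp
qed

end

lemma log_function_convex:
  assumes "k < m" "smooth_on_blowup m k \<phi>" "admissible m k \<phi>" "G_invariant m k \<phi>"
  shows "line_convex (\<lambda>x. log_function m k \<phi> x + potential m k x)"
  unfolding line_convex_def
proof (intro allI ballI)
  fix x y :: "nat \<Rightarrow> real" and t :: real assume t: "t \<in> {0..1}"
  interpret log_line m k \<phi> x "\<lambda>j. y j - x j"
    by unfold_locales (use assms in auto)
  have e: "(\<lambda>j. x j + t * (y j - x j)) = (\<lambda>j. (1 - t) * x j + t * y j)"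
    by (simp add: fun_eq_iff algebra_simps)
  show "log_function m k \<phi> (\<lambda>j. (1 - t) * x j + t * y j) + potential m k (\<lambda>j. (1 - t) * x j + t * y j)
    \<le> (1 - t) * (log_function m k \<phi> x + potential m k x) + t * (log_function m k \<phi> y + potential m k y)"
    using convex_onD[OF convex_on_line, of t 0 1] t by (simp add: e)
qed

section \<open>The lower bound for admissible invariant functions\<close>

lemma chart_in_blowup:
  assumes c: "c \<in> charts m k"
  shows "chart m k c w \<in> blowup m k"
proof -
  obtain i p r where cc: "c = (i, p, r)" by (cases c)
  have ip: "i \<in> {0..k}" "p \<in> {k+1..m}" "r = i \<or> r = p" using c by (auto simp: charts_def cc)
  have z: "lift_z m k c w j = (w(r := 1)) i * lift_\<zeta> m k c w j" if "j \<in> {0..k}" for j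
    by (rule lift_z_low[OF cc that])
  have z': "lift_z m k c w j = (w(r := 1)) p * lift_\<eta> m k c w j" if "j \<in> {k+1..m}" for j
    by (rule lift_z_high[OF cc that])
  have \<zeta>: "lift_\<zeta> m k c w \<in> hvec {0..k}"
    using ip unfolding hvec_def mem_Collect_eq by (intro conjI bexI[of _ i]) (auto simp: cc lift_\<zeta>_def)
  have \<eta>: "lift_\<eta> m k c w \<in> hvec {k+1..m}"
    using ip unfolding hvec_def mem_Collect_eq by (intro conjI bexI[of _ p]) (auto simp: cc lift_\<eta>_def)
  have "lift_z m k c w r \<noteq> 0"
    using ip by (auto simp: cc lift_z_def lift_\<zeta>_def lift_\<eta>_def)
  moreover have "lift_z m k c w j = 0" if "j \<notin> {0..m}" for j
    using that ip by (intro lift_z_out) auto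
  ultimately have "lift_z m k c w \<in> hvec {0..m}"
    using ip unfolding hvec_def mem_Collect_eq by (intro conjI bexI[of _ r]) auto
  with \<zeta> \<eta> z z' show ?thesis
    unfolding blowup_def chart_def by blast
qed

lemma charts_cover:
  assumes "y \<in> blowup m k"
  shows "\<exists>c\<in>charts m k. \<exists>w\<in>coord_space (coord_set m c). y = chart m k c w"
proof -
  obtain z \<zeta> \<eta> s t where y: "y = (proj_pt z, proj_pt \<zeta>, proj_pt \<eta>)"
    and z: "z \<in> hvec {0..m}" and \<zeta>: "\<zeta> \<in> hvec {0..k}" and \<eta>: "\<eta> \<in> hvec {k+1..m}"
    and s: "\<forall>j\<in>{0..k}. z j = s * \<zeta> j" and t: "\<forall>j\<in>{k+1..m}. z j = t * \<eta> j"
    using assms unfolding blowup_def by blast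
  obtain i where i: "i \<in> {0..k}" "\<zeta> i \<noteq> 0" using \<zeta> by (auto simp: hvec_def)
  obtain p where p: "p \<in> {k+1..m}" "\<eta> p \<noteq> 0" using \<eta> by (auto simp: hvec_def)
  obtain j0 where j0: "j0 \<in> {0..m}" "z j0 \<noteq> 0" using z by (auto simp: hvec_def)
  have "z i \<noteq> 0 \<or> z p \<noteq> 0"
  proof (cases "j0 \<in> {0..k}")
    case True
    then have "s \<noteq> 0" using s j0 by auto
    then show ?thesis using s i by simp
  next
    case False
    then have "j0 \<in> {k+1..m}" using j0 by auto
    then have "t \<noteq> 0" using t j0 by auto
    then show ?thesis using t p by simp
  qed
  then obtain r where r: "r = i \<or> r = p" "z r \<noteq> 0" by blast
  define c where "c = (i, p, r)"
  define w where "w = restrict (\<lambda>j. if j = i then z i / z r else if j = p then z p / z r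
    else if j \<in> {0..k} then \<zeta> j / \<zeta> i else \<eta> j / \<eta> p) (coord_set m c)"
  have c: "c \<in> charts m k" using i p r by (auto simp: charts_def c_def)
  have w: "w \<in> coord_space (coord_set m c)" by (simp add: w_def coord_space_def)
  have ip: "i \<noteq> p" "i \<le> m" "p \<notin> {0..k}" using i p by auto
  have st: "(w(r := 1)) i = z i / z r" "(w(r := 1)) p = z p / z r"
    using r p ip by (auto simp: w_def coord_set_def c_def)
  have "lift_\<zeta> m k c w j = (1 / \<zeta> i) * \<zeta> j" for j
  proof (cases "j \<in> {0..k}")
    case True
    then have "j \<in> coord_set m c \<or> j = i" "j \<noteq> p" using ip i r p by (auto simp: coord_set_def c_def)
    then show ?thesis using True i by (auto simp: lift_\<zeta>_def c_def w_def)
  next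
    case False
    then show ?thesis using \<zeta> by (auto simp: lift_\<zeta>_def c_def hvec_def)
  qed
  then have \<zeta>': "lift_\<zeta> m k c w = (\<lambda>j. (1 / \<zeta> i) * \<zeta> j)" by (rule ext)
  have "lift_\<eta> m k c w j = (1 / \<eta> p) * \<eta> j" for j
  proof (cases "j \<in> {k+1..m}")
    case True
    then have "j \<in> coord_set m c \<or> j = p" "j \<noteq> i" "j \<notin> {0..k}" using i r by (auto simp: coord_set_def c_def)
    then show ?thesis using True p by (auto simp: lift_\<eta>_def c_def w_def)
  next
    case False
    then show ?thesis using \<eta> by (auto simp: lift_\<eta>_def c_def hvec_def)
  qed
  then have \<eta>': "lift_\<eta> m k c w = (\<lambda>j. (1 / \<eta> p) * \<eta> j)" by (rule ext)
  have "lift_z m k c w j = (1 / z r) * z j" for j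
  proof -
    consider "j \<in> {0..k}" | "j \<in> {k+1..m}" | "j \<notin> {0..k}" "j \<notin> {k+1..m}" by blast
    then show ?thesis
    proof cases
      case 1
      show ?thesis unfolding lift_z_low[OF c_def 1] st \<zeta>' using s i 1 r by simp
    next
      case 2
      show ?thesis unfolding lift_z_high[OF c_def 2] st \<eta>' using t p 2 r by simp
    next
      case 3
      then have "j \<notin> {0..m}" by auto
      then show ?thesis unfolding lift_z_out[OF 3] using z by (auto simp: hvec_def)
    qed
  qed
  then have z': "lift_z m k c w = (\<lambda>j. (1 / z r) * z j)" by (rule ext)
  have "y = chart m k c w"
    unfolding y chart_def \<zeta>' \<eta>' z' using i p r by (simp only: proj_pt_scale divide_eq_0_iff one_neq_zero simp_thms)
  with c w show ?thesis by blast
qed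

text \<open>
  The points with nonzero coordinates are dense.
\<close>

lemma exists_torus_pt_near_sup:
  assumes km: "k < m" and smooth: "smooth_on_blowup m k \<phi>" and inv: "G_invariant m k \<phi>"
    and sup: "(SUP y\<in>blowup m k. ereal (\<phi> y)) = 0" and \<epsilon>: "\<epsilon> > 0"
  shows "\<exists>x. - \<epsilon> \<le> log_function m k \<phi> x"
proof -
  have "ereal (- (\<epsilon> / 2)) < (SUP y\<in>blowup m k. ereal (\<phi> y))"
    unfolding sup using \<epsilon> by simp
  then obtain y where y: "y \<in> blowup m k" "- (\<epsilon> / 2) < \<phi> y"
    unfolding less_SUP_iff by auto
  obtain c w where c: "c \<in> charts m k" and w: "w \<in> coord_space (coord_set m c)" and yc: "y = chart m k c w"
    using charts_cover[OF y(1)] by blast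
  let ?I = "coord_set m c" and ?f = "\<phi> \<circ> chart m k c"
  have "Ck 0 ?I ?f" using smooth c unfolding smooth_on_blowup_def by blast
  then have "continuous_on (coord_space ?I) ?f" by simp
  from coordinate_neighbourhood[OF this w, of "\<epsilon> / 2"] \<epsilon> obtain \<delta> where \<delta>: "\<delta> > 0"
    "\<And>u. u \<in> coord_space ?I \<Longrightarrow> (\<forall>j\<in>?I. cmod (u j - w j) < \<delta>) \<Longrightarrow> \<bar>?f u - ?f w\<bar> < \<epsilon> / 2"
    by auto
  define u where "u = (\<lambda>j. if j \<in> ?I \<and> w j = 0 then of_real (\<delta> / 2) else w j)"
  have u: "u \<in> coord_space ?I" using w by (auto simp: u_def coord_space_def PiE_iff extensional_def)
  have "cmod (u j - w j) < \<delta>" if "j \<in> ?I" for j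
    using \<delta>(1) by (auto simp: u_def)
  then have "\<bar>?f u - ?f w\<bar> < \<epsilon> / 2" using \<delta>(2)[OF u] by blast
  moreover have "- (\<epsilon> / 2) < ?f w" using y(2) yc by simp
  ultimately have "- \<epsilon> \<le> ?f u" by linarith
  moreover have "\<forall>j\<in>?I. u j \<noteq> 0" using \<delta>(1) by (auto simp: u_def)
  from chart_eq_log_function[OF inv km c this]
  have "?f u = log_function m k \<phi> (\<lambda>j. ln (cmod (lift_z m k c u j)))" by simp
  ultimately show ?thesis by auto
qed

lemma lse_permute:
  assumes "\<sigma> permutes S" "S \<subseteq> A \<or> S \<inter> A = {}"
  shows "lse A (x \<circ> \<sigma>) = lse A x"
proof -
  have "\<sigma> permutes A \<or> (\<forall>j\<in>A. \<sigma> j = j)"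
    using assms(2) permutes_subset[OF assms(1)] permutes_not_in[OF assms(1)] by blast
  then have "(\<Sum>j\<in>A. exp (2 * (x \<circ> \<sigma>) j)) = (\<Sum>j\<in>A. exp (2 * x j))"
  proof
    assume "\<sigma> permutes A"
    then show ?thesis using sum.permute[of \<sigma> A "\<lambda>j. exp (2 * x j)"] by (simp add: o_def)
  qed simp
  then show ?thesis by (simp add: lse_def)
qed

text \<open>
  The left-hand side does not depend on \<open>\<phi>\<close>.
\<close>

theorem log_function_lower_bound:
  assumes km: "k < m" and smooth: "smooth_on_blowup m k \<phi>" and adm: "admissible m k \<phi>"
    and inv: "G_invariant m k \<phi>" and sup: "(SUP y\<in>blowup m k. ereal (\<phi> y)) = 0"
  shows "2 * real k * average {0..k} x + 2 * real (m - k - 1) * average {k+1..m} x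
      + 4 * min (average {0..k} x) (average {k+1..m} x)
    \<le> log_function m k \<phi> x + potential m k x"
proof -
  have le0: "\<phi> y \<le> 0" if "y \<in> blowup m k" for y
  proof -
    have "ereal (\<phi> y) \<le> (SUP y\<in>blowup m k. ereal (\<phi> y))" using that by (rule SUP_upper)
    then show ?thesis by (simp add: sup)
  qed
  have nz: "\<forall>j\<in>{0..m}. complex_of_real (exp (x j)) \<noteq> 0" for x by simp
  interpret symmetric_convex m k "\<lambda>x. log_function m k \<phi> x + potential m k x"
  proof
    show "k < m" by (rule km)
    show "line_convex (\<lambda>x. log_function m k \<phi> x + potential m k x)"
      by (rule log_function_convex[OF km smooth adm inv])
    show "log_function m k \<phi> x + potential m k x \<le> potential m k x" for x
      unfolding log_function_def using le0[OF torus_pt_in_blowup[OF km nz]] by simp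
    show "\<exists>x. potential m k x - \<epsilon> \<le> log_function m k \<phi> x + potential m k x" if "\<epsilon> > 0" for \<epsilon>
      using exists_torus_pt_near_sup[OF km smooth inv sup that] by force
    show "log_function m k \<phi> (x \<circ> \<sigma>) + potential m k (x \<circ> \<sigma>) = log_function m k \<phi> x + potential m k x"
      if \<sigma>: "\<sigma> permutes {0..k} \<or> \<sigma> permutes {k+1..m}" for x :: "nat \<Rightarrow> real" and \<sigma>
    proof -
      have "lse {0..m} (x \<circ> \<sigma>) = lse {0..m} x" "lse {0..k} (x \<circ> \<sigma>) = lse {0..k} x" "lse {k+1..m} (x \<circ> \<sigma>) = lse {k+1..m} x"
      proof -
        have "lse A (x \<circ> \<sigma>) = lse A x" if A: "A \<in> {{0..m}, {0..k}, {k+1..m}}" for A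
          using \<sigma>
        proof
          assume "\<sigma> permutes {0..k}"
          then show ?thesis by (rule lse_permute) (use A km in auto)
        next
          assume "\<sigma> permutes {k+1..m}"
          then show ?thesis by (rule lse_permute) (use A km in auto)
        qed
        then show "lse {0..m} (x \<circ> \<sigma>) = lse {0..m} x" "lse {0..k} (x \<circ> \<sigma>) = lse {0..k} x"
          "lse {k+1..m} (x \<circ> \<sigma>) = lse {k+1..m} x" by blast+
      qed
      then have "potential m k (x \<circ> \<sigma>) = potential m k x" by (simp only: potential_def)
      moreover have "log_function m k \<phi> (x \<circ> \<sigma>) = log_function m k \<phi> x"
        unfolding log_function_def
        using G_invariant_permutes[OF inv km \<sigma> nz[of x]] by (simp add: o_def)
      ultimately show ?thesis by simp
    qed
  qed
  show ?thesis by (rule lower_bound)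
qed

section \<open>Integrability\<close>

text \<open>
  A majorant, on the complex plane, of \<open>|z|\<^bsup>- 2\<^esup> exp (- \<kappa> |ln |z| |)\<close>: a sum of multiples of indicator functions
  of discs, whose radii are powers of \<open>e\<close>. The discs shrinking to \<open>0\<close> dominate the function for \<open>|z| \<le> 1\<close>
  and the growing ones for \<open>|z| \<ge> 1\<close>. The value at \<open>0\<close> is infinite, so that bounds by products of this
  function need no exception for points with a vanishing coordinate.
\<close>

definition shell_term :: "real \<Rightarrow> nat \<Rightarrow> complex \<Rightarrow> ennreal" where
  "shell_term \<kappa> n z = ennreal (exp ((2 - \<kappa>) * real (Suc n))) * indicator (cball 0 (exp (- real n))) z
     + ennreal (exp (- (2 + \<kappa>) * real n)) * indicator (cball 0 (exp (real (Suc n)))) z"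

definition shell_majorant :: "real \<Rightarrow> complex \<Rightarrow> ennreal" where
  "shell_majorant \<kappa> z = (\<Sum>n. shell_term \<kappa> n z)"

lemma cmult_indicator_cball_measurable [measurable]:
  "(\<lambda>z. ennreal a * indicator (cball (0::complex) r) z) \<in> borel_measurable borel"
proof -
  have [measurable]: "cball (0::complex) r \<in> sets borel" by (intro borel_closed closed_cball)
  show ?thesis by measurable
qed

lemma cmult_indicator_cball_measurable_lborel:
  "(\<lambda>z. ennreal a * indicator (cball (0::complex) r) z) \<in> borel_measurable lborel"
  unfolding measurable_cong_sets[OF sets_lborel refl] by (rule cmult_indicator_cball_measurable)

lemma shell_majorant_measurable [measurable]: "shell_majorant \<kappa> \<in> borel_measurable borel"
  unfolding shell_majorant_def[abs_def] shell_term_def by measurable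

lemma emeasure_cball_complex: "r \<ge> 0 \<Longrightarrow> emeasure lborel (cball (0::complex) r) = ennreal (unit_ball_vol 2 * r\<^sup>2)"
  using emeasure_cball[of r "0::complex"] by simp

lemma shell_majorant_integral_finite:
  assumes \<kappa>: "\<kappa> > 0"
  shows "(\<integral>\<^sup>+ z. shell_majorant \<kappa> z \<partial>lborel) < \<infinity>"
proof -
  let ?V = "unit_ball_vol 2"
  define q where "q = exp (- \<kappa>)"
  have q: "0 < q" "q < 1" using \<kappa> by (auto simp: q_def)
  have V: "?V \<ge> 0" by (simp add: unit_ball_vol_nonneg)
  have "(\<integral>\<^sup>+ z. shell_majorant \<kappa> z \<partial>lborel) = (\<Sum>n. \<integral>\<^sup>+ z. shell_term \<kappa> n z \<partial>lborel)"
    unfolding shell_majorant_def shell_term_def by (rule nn_integral_suminf)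
      (intro borel_measurable_add cmult_indicator_cball_measurable_lborel)
  also have "\<dots> = (\<Sum>n. ennreal (?V * (exp (2 - \<kappa>) + exp 2) * q ^ n))"
  proof (rule suminf_cong)
    fix n
    have e1: "exp ((2 - \<kappa>) * real (Suc n)) * (?V * (exp (- real n))\<^sup>2) = ?V * exp (2 - \<kappa>) * q ^ n"
      by (simp add: q_def power2_eq_square exp_of_nat_mult[symmetric] algebra_simps flip: exp_add)
    have e2: "exp (- (2 + \<kappa>) * real n) * (?V * (exp (real (Suc n)))\<^sup>2) = ?V * exp 2 * q ^ n"
      by (simp add: q_def power2_eq_square exp_of_nat_mult[symmetric] algebra_simps flip: exp_add)
    have "(\<integral>\<^sup>+ z. shell_term \<kappa> n z \<partial>lborel)
     = ennreal (exp ((2 - \<kappa>) * real (Suc n))) * emeasure lborel (cball (0::complex) (exp (- real n)))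
       + ennreal (exp (- (2 + \<kappa>) * real n)) * emeasure lborel (cball (0::complex) (exp (real (Suc n))))"
      unfolding shell_term_def by (subst nn_integral_add) (simp_all only: nn_integral_cmult_indicator cmult_indicator_cball_measurable_lborel
          sets_lborel borel_closed closed_cball)
    also have "\<dots> = ennreal (?V * exp (2 - \<kappa>) * q ^ n) + ennreal (?V * exp 2 * q ^ n)"
      by (simp only: emeasure_cball_complex exp_ge_zero ennreal_mult''[symmetric] mult_nonneg_nonneg V zero_le_power2
          e1 e2)
    also have "\<dots> = ennreal (?V * (exp (2 - \<kappa>) + exp 2) * q ^ n)"
      using V q by (subst ennreal_plus[symmetric]) (auto simp: algebra_simps)
    finally show "(\<integral>\<^sup>+ z. shell_term \<kappa> n z \<partial>lborel) = ennreal (?V * (exp (2 - \<kappa>) + exp 2) * q ^ n)" .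
  qed
  also have "\<dots> = ennreal (\<Sum>n. ?V * (exp (2 - \<kappa>) + exp 2) * q ^ n)"
    using q V by (intro suminf_ennreal2 summable_mult summable_geometric) auto
  finally show ?thesis by simp
qed

lemma term_le_suminf_ennreal: "(f n :: ennreal) \<le> (\<Sum>n. f n)"
  using sum_le_suminf[of f "{n}"] by simp

lemma shell_majorant_ge:
  assumes z: "z \<noteq> 0" and \<kappa>: "0 < \<kappa>" "\<kappa> < 2"
  shows "ennreal (exp (- 2 * ln (cmod z) - \<kappa> * \<bar>ln (cmod z)\<bar>)) \<le> shell_majorant \<kappa> z"
proof -
  define y where "y = ln (cmod z)"
  have zy: "cmod z = exp y" using z by (simp add: y_def)
  let ?a = "\<lambda>n. ennreal (exp ((2 - \<kappa>) * real (Suc n))) * indicator (cball 0 (exp (- real n))) z"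
  let ?b = "\<lambda>n. ennreal (exp (- (2 + \<kappa>) * real n)) * indicator (cball 0 (exp (real (Suc n)))) z"
  have sub: "?a n + ?b n \<le> shell_majorant \<kappa> z" for n
    unfolding shell_majorant_def shell_term_def[symmetric] by (rule term_le_suminf_ennreal)
  show ?thesis
  proof (cases "y \<le> 0")
    case True
    define n where "n = nat \<lfloor>- y\<rfloor>"
    have n: "real n \<le> - y" "- y < real n + 1"
      using True by (auto simp: n_def)
    have "z \<in> cball 0 (exp (- real n))" using n by (simp add: zy)
    moreover have "(2 - \<kappa>) * (- y) \<le> (2 - \<kappa>) * real (Suc n)"
      using n \<kappa> by (intro mult_left_mono) auto
    then have "- 2 * y - \<kappa> * \<bar>y\<bar> \<le> (2 - \<kappa>) * real (Suc n)"
      using True by (simp add: algebra_simps)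
    ultimately have "ennreal (exp (- 2 * y - \<kappa> * \<bar>y\<bar>)) \<le> ?a n"
      by (simp add: ennreal_leI)
    also have "\<dots> \<le> ?a n + ?b n" by simp
    finally show ?thesis using sub[of n] unfolding y_def by (rule order_trans)
  next
    case False
    define n where "n = nat \<lfloor>y\<rfloor>"
    have n: "real n \<le> y" "y < real n + 1"
      using False by (auto simp: n_def)
    have "z \<in> cball 0 (exp (real (Suc n)))" using n by (simp add: zy)
    moreover have "(2 + \<kappa>) * real n \<le> (2 + \<kappa>) * y"
      using n \<kappa> by (intro mult_left_mono) auto
    then have "- 2 * y - \<kappa> * \<bar>y\<bar> \<le> - (2 + \<kappa>) * real n"
      using False by (simp add: algebra_simps)
    ultimately have "ennreal (exp (- 2 * y - \<kappa> * \<bar>y\<bar>)) \<le> ?b n"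
      by (simp add: ennreal_leI)
    also have "\<dots> \<le> ?a n + ?b n" by simp
    finally show ?thesis using sub[of n] unfolding y_def by (rule order_trans)
  qed
qed

lemma shell_majorant_pos: "shell_majorant \<kappa> z > 0"
proof -
  obtain n :: nat where "cmod z \<le> real n" using real_arch_simple by blast
  moreover have "real n \<le> exp (real (Suc n))"
    using exp_ge_add_one_self[of "real (Suc n)"] by linarith
  ultimately have "z \<in> cball 0 (exp (real (Suc n)))" by simp
  then have "0 < shell_term \<kappa> n z"
    by (simp add: shell_term_def add_nonneg_pos)
  also have "\<dots> \<le> shell_majorant \<kappa> z"
    unfolding shell_majorant_def by (rule term_le_suminf_ennreal)
  finally show ?thesis .
qed

lemma shell_majorant_zero:
  assumes "\<kappa> < 2"
  shows "shell_majorant \<kappa> 0 = \<infinity>"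
proof -
  have "(\<Sum>n. (1::ennreal)) \<le> shell_majorant \<kappa> 0"
    unfolding shell_majorant_def
  proof (rule suminf_le)
    fix n
    have "ennreal 1 \<le> ennreal (exp ((2 - \<kappa>) * real (Suc n)))"
      using assms by (intro ennreal_leI) simp
    also have "\<dots> \<le> shell_term \<kappa> n 0"
      by (simp add: shell_term_def)
    finally show "1 \<le> shell_term \<kappa> n 0" by simp
  qed auto
  moreover have "(\<Sum>n. (1::ennreal)) = \<infinity>"
  proof -
    have "of_nat n \<le> (\<Sum>n. (1::ennreal))" for n
      using sum_le_suminf[of "\<lambda>_. 1::ennreal" "{..<n}"] by simp
    then show ?thesis
      by (metis ennreal_Ex_less_of_nat infinity_ennreal_def less_top linorder_not_le)
  qed
  ultimately show ?thesis by (simp add: top_unique)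
qed

lemma product_majorant_integral:
  fixes I :: "nat set"
  assumes "finite I" "\<kappa> > 0"
  shows "(\<integral>\<^sup>+ w. (\<Prod>j\<in>I. shell_majorant \<kappa> (w j)) \<partial>Pi\<^sub>M I (\<lambda>_. lborel)) < \<infinity>"
proof -
  interpret product_sigma_finite "\<lambda>_::nat. lborel :: complex measure"
    by unfold_locales
  have "(\<integral>\<^sup>+ w. (\<Prod>j\<in>I. shell_majorant \<kappa> (w j)) \<partial>Pi\<^sub>M I (\<lambda>_. lborel)) = (\<Prod>j\<in>I. \<integral>\<^sup>+ z. shell_majorant \<kappa> z \<partial>lborel)"
    by (rule product_nn_integral_prod[OF assms(1)]) simp
  also have "\<dots> < \<infinity>"
    using shell_majorant_integral_finite[OF assms(2)] by (simp add: power_less_top_ennreal)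
  finally show ?thesis .
qed

text \<open>
  The contribution of one block of homogeneous coordinates to the exponent: \<open>y\<close> are the logarithms of the
  moduli of its free coordinates and \<open>s\<close> is the logarithm of its squared norm.
\<close>

lemma block_exponent:
  fixes y :: "nat \<Rightarrow> real"
  assumes fin: "finite J" and \<alpha>: "0 \<le> \<alpha>" "\<alpha> < 1 / 2" and s: "0 \<le> s" "\<And>j. j \<in> J \<Longrightarrow> 2 * y j \<le> s"
    and \<kappa>: "0 < \<kappa>" "\<kappa> \<le> (1 - 2 * \<alpha>) / 2" "\<kappa> * real (card J) \<le> 1 - 2 * \<alpha>"
  defines "n \<equiv> real (card J)"
  shows "- ((1 - \<alpha>) * n + (1 - 2 * \<alpha>) / 2) * s - 2 * \<alpha> * (n + 2) * ((\<Sum>j\<in>J. y j) / (n + 1))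
    \<le> (\<Sum>j\<in>J. - 2 * y j - \<kappa> * \<bar>y j\<bar>)"
proof (cases "J = {}")
  case True
  then show ?thesis using \<alpha> s by (simp add: n_def)
next
  case False
  then have n: "n \<ge> 1" using fin by (simp add: n_def Suc_le_eq card_gt_0_iff)
  let ?\<epsilon> = "1 - 2 * \<alpha>"
  let ?c = "(1 - \<alpha>) + ?\<epsilon> / (2 * n)"
  define \<beta> where "\<beta> = 2 * \<alpha> * (n + 2) / (n + 1)"
  have c0: "?c \<ge> 0" using \<alpha> n by simp
  have "(\<Sum>j\<in>J. max (2 * y j) 0) \<le> (\<Sum>j\<in>J. s)" using s by (intro sum_mono) auto
  then have "(\<Sum>j\<in>J. max (2 * y j) 0) \<le> n * s" by (simp add: n_def)
  then have "?c * (\<Sum>j\<in>J. max (2 * y j) 0) \<le> ?c * (n * s)"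
    using c0 by (rule mult_left_mono)
  also have "?c * (n * s) = ((1 - \<alpha>) * n + ?\<epsilon> / 2) * s"
    using n by (simp add: field_simps)
  finally have 1: "- (((1 - \<alpha>) * n + ?\<epsilon> / 2) * s) \<le> (\<Sum>j\<in>J. - (?c * max (2 * y j) 0))"
    by (simp add: sum_negf sum_distrib_left)
  have \<beta>1: "\<beta> \<ge> 2 * \<alpha>"
    unfolding \<beta>_def using n \<alpha> by (simp add: field_simps)
  have "2 * (n + 2) \<le> 3 * (n + 1)" using n by simp
  then have "2 * (n + 2) * \<alpha> \<le> 3 * (n + 1) * \<alpha>" using \<alpha> by (intro mult_right_mono)
  then have \<beta>2: "\<beta> \<le> 3 * \<alpha>"
    unfolding \<beta>_def using n by (simp add: field_simps)
  have \<kappa>n: "\<kappa> \<le> ?\<epsilon> / n"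
    using \<kappa>(3) n by (simp add: n_def field_simps)
  have each: "- (?c * max (2 * y j) 0) - \<beta> * y j \<le> - 2 * y j - \<kappa> * \<bar>y j\<bar>" for j
  proof (cases "y j \<ge> 0")
    case True
    have "2 * ?c = 2 * (1 - \<alpha>) + ?\<epsilon> / n" using n by (simp add: field_simps)
    moreover define C X Y where "C = ?c" and "X = ?\<epsilon> / n" and "Y = \<beta>"
    ultimately have "2 * C = 2 * (1 - \<alpha>) + X" "\<kappa> \<le> X" "2 * \<alpha> \<le> Y"
      using \<beta>1 \<kappa>n by (simp_all only:)
    then have "2 + \<kappa> \<le> 2 * C + Y" by (simp add: algebra_simps)
    then have "2 + \<kappa> \<le> 2 * ?c + \<beta>" unfolding C_def Y_def .
    then have "(2 + \<kappa>) * y j \<le> (2 * ?c + \<beta>) * y j" using True by (rule mult_right_mono)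
    then show ?thesis using True by (simp add: algebra_simps)
  next
    case False
    have "3 * \<alpha> \<le> 2 - \<kappa>" using \<kappa>(2) \<alpha> by (simp add: field_simps)
    with \<beta>2 have "\<beta> \<le> 2 - \<kappa>" by (rule order_trans)
    then have "\<beta> * (- y j) \<le> (2 - \<kappa>) * (- y j)" using False by (intro mult_right_mono) auto
    then show ?thesis using False by (simp add: algebra_simps)
  qed
  have "2 * \<alpha> * (n + 2) * ((\<Sum>j\<in>J. y j) / (n + 1)) = (\<Sum>j\<in>J. \<beta> * y j)"
    unfolding \<beta>_def by (simp add: sum_distrib_left sum_divide_distrib)
  note eq = this
  have "- ((1 - \<alpha>) * n + ?\<epsilon> / 2) * s - 2 * \<alpha> * (n + 2) * ((\<Sum>j\<in>J. y j) / (n + 1))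
      \<le> (\<Sum>j\<in>J. - (?c * max (2 * y j) 0)) - (\<Sum>j\<in>J. \<beta> * y j)"
    unfolding eq mult_minus_left using 1 by (rule diff_right_mono)
  also have "\<dots> = (\<Sum>j\<in>J. - (?c * max (2 * y j) 0) - \<beta> * y j)"
    by (rule sum_subtractf[symmetric])
  also have "\<dots> \<le> (\<Sum>j\<in>J. - 2 * y j - \<kappa> * \<bar>y j\<bar>)"
    by (intro sum_mono each)
  finally show ?thesis .
qed

text \<open>
  The bound of the integrand in logarithmic form. Here \<open>ph\<close> is the value of \<open>\<phi>\<close>. In the proof,
  \<open>f\<close>, \<open>s\<close> and \<open>e\<close> are the logarithms of \<open>|z|\<^sup>2\<close>, \<open>|\<zeta>|\<^sup>2\<close> and \<open>|\<eta>|\<^sup>2\<close>; \<open>b\<close> is the index of the coordinate \<open>\<tau>\<close>, and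
  \<open>ls\<close> and \<open>lt\<close> are the logarithms of the moduli of \<open>z\<^sub>i\<close> and \<open>z\<^sub>p\<close>, one of which is \<open>0\<close>.
\<close>

lemma integrand_exponent:
  assumes km: "k < m" and c: "c \<in> charts m k" and w: "\<forall>j\<in>coord_set m c. w j \<noteq> 0"
    and \<alpha>: "0 \<le> \<alpha>" "\<alpha> < 1 / 2" and \<kappa>: "\<kappa> = (1 - 2 * \<alpha>) / (2 * real m)"
    and lower: "2 * real k * average {0..k} x + 2 * real (m - k - 1) * average {k+1..m} x
      + 4 * min (average {0..k} x) (average {k+1..m} x) \<le> ph + potential m k x"
    and x: "x = (\<lambda>j. ln (cmod (lift_z m k c w j)))"
  shows "- \<alpha> * ph - 2 * ln (Nz m k c w) - real k * ln (N\<zeta> m k c w) - real (m - k - 1) * ln (N\<eta> m k c w)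
    \<le> (\<Sum>j\<in>coord_set m c. - 2 * ln (cmod (w j)) - \<kappa> * \<bar>ln (cmod (w j))\<bar>)"
proof -
  obtain i p r where cc: "c = (i, p, r)" by (cases c)
  have ip: "i \<in> {0..k}" "p \<in> {k+1..m}" "r = i \<or> r = p" using c by (auto simp: charts_def cc)
  define y where "y j = ln (cmod (w j))" for j
  define f where "f = ln (Nz m k c w)"
  define s where "s = ln (N\<zeta> m k c w)"
  define e where "e = ln (N\<eta> m k c w)"
  define l where "l = real (m - k - 1)"
  let ?s = "(w(r := 1)) i" and ?t = "(w(r := 1)) p"
  define ls where "ls = ln (cmod ?s)"
  define lt where "lt = ln (cmod ?t)"
  define b where "b = (if r = i then p else i)"
  define J1 where "J1 = {0..k} - {i}"
  define J2 where "J2 = {k+1..m} - {p}"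
  have fin: "finite J1" "finite J2" by (auto simp: J1_def J2_def)
  have I: "coord_set m c = insert b (J1 \<union> J2)" "b \<notin> J1 \<union> J2" "J1 \<inter> J2 = {}"
    using ip km by (auto simp: coord_set_def cc b_def J1_def J2_def)
  have card: "card J1 = k" "card J2 = m - k - 1"
    using ip unfolding J1_def J2_def by auto
  have nz: "lift_\<zeta> m k c w j \<noteq> 0" if "j \<in> {0..k}" for j using lift_nonzero(1)[OF c w that] .
  have nz': "lift_\<eta> m k c w j \<noteq> 0" if "j \<in> {k+1..m}" for j using lift_nonzero(2)[OF c w that] .
  have wb: "w b \<noteq> 0" using w I by auto
  have st0: "?s \<noteq> 0" "?t \<noteq> 0" using ip wb by (auto simp: b_def)
  have lst: "ls = 0 \<and> lt = y b \<or> lt = 0 \<and> ls = y b"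
    using ip by (auto simp: ls_def lt_def y_def b_def)
  have x1: "x j = ls + ln (cmod (lift_\<zeta> m k c w j))" if "j \<in> {0..k}" for j
    unfolding x lift_z_low[OF cc that] using st0 nz[OF that] by (simp add: norm_mult ln_mult ls_def)
  have x2: "x j = lt + ln (cmod (lift_\<eta> m k c w j))" if "j \<in> {k+1..m}" for j
    unfolding x lift_z_high[OF cc that] using st0 nz'[OF that] by (simp add: norm_mult ln_mult lt_def)
  have z1: "ln (cmod (lift_\<zeta> m k c w j)) = (if j = i then 0 else y j)" if "j \<in> {0..k}" for j
    using that by (auto simp: cc lift_\<zeta>_def y_def)
  have z2: "ln (cmod (lift_\<eta> m k c w j)) = (if j = p then 0 else y j)" if "j \<in> {k+1..m}" for j
    using that by (auto simp: cc lift_\<eta>_def y_def)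
  define A where "A = (\<Sum>j\<in>J1. y j) / (real k + 1)"
  define B where "B = (\<Sum>j\<in>J2. y j) / (l + 1)"
  have a: "average {0..k} x = ls + A"
  proof -
    have "(\<Sum>j\<in>{0..k}. x j) = (\<Sum>j\<in>{0..k}. ls + (if j = i then 0 else y j))"
      by (intro sum.cong) (auto simp: x1 z1)
    also have "\<dots> = (real k + 1) * ls + (\<Sum>j\<in>J1. y j)"
      unfolding sum.distrib sum.remove[OF finite_atLeastAtMost ip(1), of "\<lambda>j. if j = i then 0 else y j"]
      by (simp add: J1_def)
    moreover have "real (card {0..k}) = real k + 1" "real k + 1 > 0" by simp_all
    moreover have "(d * a + q) / d = a + q / d" if "d > 0" for d a q :: real
      using that by (simp add: add_divide_distrib)
    ultimately show ?thesis unfolding average_def A_def by (simp only:)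
  qed
  have lk: "l + 1 = real (m - k)" using km by (simp add: l_def)
  have b': "average {k+1..m} x = lt + B"
  proof -
    have "(\<Sum>j\<in>{k+1..m}. x j) = (\<Sum>j\<in>{k+1..m}. lt + (if j = p then 0 else y j))"
      by (intro sum.cong) (auto simp: x2 z2)
    also have "\<dots> = (l + 1) * lt + (\<Sum>j\<in>J2. y j)"
      unfolding sum.distrib sum.remove[OF finite_atLeastAtMost ip(2), of "\<lambda>j. if j = p then 0 else y j"] lk
      by (simp add: J2_def)
    moreover have "real (card {k+1..m}) = l + 1" by (simp add: lk)
    moreover have "l + 1 > 0" by (simp add: l_def)
    moreover have "(d * a + q) / d = a + q / d" if "d > 0" for d a q :: real
      using that by (simp add: add_divide_distrib)
    ultimately show ?thesis unfolding average_def B_def by (simp only:)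
  qed
  have expx: "exp (2 * x j) = (cmod (lift_z m k c w j))\<^sup>2" if "j \<in> {0..m}" for j
    using lift_nonzero(3)[OF c w km that] by (simp add: x exp_double)
  have lse0: "lse {0..m} x = f"
    unfolding lse_def f_def Nz_def by (intro arg_cong[where f = ln] sum.cong) (auto simp: expx)
  have N: "N\<zeta> m k c w > 0" "N\<eta> m k c w > 0" "Nz m k c w > 0" using N_pos[OF c] by auto
  have S1: "(\<Sum>j\<in>{0..k}. exp (2 * x j)) = exp (2 * ls + s)"
  proof -
    have "(\<Sum>j\<in>{0..k}. exp (2 * x j)) = (\<Sum>j\<in>{0..k}. exp (2 * ls) * (cmod (lift_\<zeta> m k c w j))\<^sup>2)"
      using nz by (intro sum.cong) (auto simp: x1 exp_add exp_double)
    also have "\<dots> = exp (2 * ls) * N\<zeta> m k c w"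
      unfolding N\<zeta>_def sum_distrib_left ..
    finally show ?thesis using N by (simp add: s_def exp_add)
  qed
  have S2: "(\<Sum>j\<in>{k+1..m}. exp (2 * x j)) = exp (2 * lt + e)"
  proof -
    have "(\<Sum>j\<in>{k+1..m}. exp (2 * x j)) = (\<Sum>j\<in>{k+1..m}. exp (2 * lt) * (cmod (lift_\<eta> m k c w j))\<^sup>2)"
      using nz' by (intro sum.cong refl) (simp add: x2 exp_add exp_double)
    also have "\<dots> = exp (2 * lt) * N\<eta> m k c w"
      unfolding N\<eta>_def sum_distrib_left ..
    finally show ?thesis using N by (simp add: e_def exp_add)
  qed
  have lse1: "lse {0..k} x = 2 * ls + s" and lse2: "lse {k+1..m} x = 2 * lt + e"
    unfolding lse_def S1 S2 by simp_all
  have f_ge: "2 * ls + s \<le> f" "2 * lt + e \<le> f"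
  proof -
    have "(\<Sum>j\<in>{0..k}. exp (2 * x j)) \<le> (\<Sum>j\<in>{0..m}. exp (2 * x j))"
      using km by (intro sum_mono2) auto
    then have "ln (\<Sum>j\<in>{0..k}. exp (2 * x j)) \<le> ln (\<Sum>j\<in>{0..m}. exp (2 * x j))"
      unfolding S1 by (intro ln_mono) auto
    then show "2 * ls + s \<le> f" using lse0 lse1 by (simp add: lse_def)
    have "(\<Sum>j\<in>{k+1..m}. exp (2 * x j)) \<le> (\<Sum>j\<in>{0..m}. exp (2 * x j))"
      using km by (intro sum_mono2) auto
    then have "ln (\<Sum>j\<in>{k+1..m}. exp (2 * x j)) \<le> ln (\<Sum>j\<in>{0..m}. exp (2 * x j))"
      unfolding S2 by (intro ln_mono) auto
    then show "2 * lt + e \<le> f" using lse0 lse2 by (simp add: lse_def)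
  qed
  have sj: "2 * ln (cmod (lift_\<zeta> m k c w j)) \<le> s" if "j \<in> {0..k}" for j
    using lse_ge[of "{0..k}" j x] that x1[OF that] unfolding lse1 by simp
  have ej: "2 * ln (cmod (lift_\<eta> m k c w j)) \<le> e" if "j \<in> {k+1..m}" for j
    using lse_ge[of "{k+1..m}" j x] that x2[OF that] unfolding lse2 by simp
  have s0: "0 \<le> s" and e0: "0 \<le> e"
    using sj[OF ip(1)] ej[OF ip(2)] z1[OF ip(1)] z2[OF ip(2)] by auto
  have sJ: "2 * y j \<le> s" if "j \<in> J1" for j using sj[of j] z1[of j] that by (auto simp: J1_def)
  have eJ: "2 * y j \<le> e" if "j \<in> J2" for j using ej[of j] z2[of j] that by (auto simp: J2_def)
  have avg: "2 * ((\<Sum>j\<in>J. y j) / (real (card J) + 1)) \<le> q" if "\<And>j. j \<in> J \<Longrightarrow> 2 * y j \<le> q" "0 \<le> q" for J q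
  proof -
    have "2 * (\<Sum>j\<in>J. y j) \<le> (\<Sum>j\<in>J. q)"
      unfolding sum_distrib_left using that by (intro sum_mono) auto
    also have "\<dots> \<le> q * (real (card J) + 1)" using that by (simp add: algebra_simps)
    finally show ?thesis by (simp add: field_simps)
  qed
  have As: "2 * A \<le> s" using avg[of J1 s] sJ s0 by (simp add: A_def card)
  have Be: "2 * B \<le> e" using avg[of J2 e] eJ e0 by (simp add: B_def card l_def)
  let ?\<epsilon> = "1 - 2 * \<alpha>"
  have m0: "real m \<ge> 1" using km by simp
  have \<kappa>0: "0 < \<kappa>" using \<alpha> m0 by (simp add: \<kappa>)
  have \<kappa>m: "\<kappa> * real m = ?\<epsilon> / 2" using m0 by (simp add: \<kappa>)
  have \<kappa>n: "\<kappa> * real n \<le> ?\<epsilon> / 2" if "n \<le> m" for n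
    using mult_left_mono[of "real n" "real m" \<kappa>] that \<kappa>0 \<kappa>m by simp
  have \<kappa>1: "\<kappa> \<le> ?\<epsilon> / 2" using \<kappa>n[of 1] m0 by simp
  have half: "?\<epsilon> / 2 \<le> ?\<epsilon>" using \<alpha> by simp
  have "\<kappa> * real (card J1) \<le> ?\<epsilon>" "\<kappa> * real (card J2) \<le> ?\<epsilon>"
    using \<kappa>n[of k] \<kappa>n[of "m - k - 1"] km half unfolding card by auto
  then have bl1: "- ((1 - \<alpha>) * real k + ?\<epsilon> / 2) * s - 2 * \<alpha> * (real k + 2) * A \<le> (\<Sum>j\<in>J1. - 2 * y j - \<kappa> * \<bar>y j\<bar>)"
    and bl2: "- ((1 - \<alpha>) * l + ?\<epsilon> / 2) * e - 2 * \<alpha> * (l + 2) * B \<le> (\<Sum>j\<in>J2. - 2 * y j - \<kappa> * \<bar>y j\<bar>)"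
    using block_exponent[OF fin(1) \<alpha> s0 sJ \<kappa>0 \<kappa>1] block_exponent[OF fin(2) \<alpha> e0 eJ \<kappa>0 \<kappa>1]
    by (simp_all add: card A_def B_def l_def)
  \<comment> \<open>Since \<open>min\<close> is the sum minus \<open>max\<close>, and \<open>max\<close> is at most \<open>f / 2\<close>, the averages enter linearly.\<close>
  have "max (2 * (ls + A)) (2 * (lt + B)) \<le> f" using f_ge As Be by simp
  then have "4 * min (ls + A) (lt + B) \<ge> 4 * (ls + A) + 4 * (lt + B) - 2 * f"
    by (simp add: min_def max_def split: if_splits)
  moreover have "2 * real k * (ls + A) + 2 * l * (lt + B) + 4 * min (ls + A) (lt + B)
      \<le> ph + (2 * f + real k * (2 * ls + s) + l * (2 * lt + e))"
    using lower unfolding a b' potential_def lse0 lse1 lse2 l_def .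
  ultimately have "- ph \<le> 4 * f + real k * s + l * e - 2 * (real k + 2) * A - 2 * (l + 2) * B - 4 * (ls + lt)"
    by (simp add: algebra_simps)
  then have "\<alpha> * (- ph) \<le> \<alpha> * (4 * f + real k * s + l * e - 2 * (real k + 2) * A - 2 * (l + 2) * B - 4 * (ls + lt))"
    using \<alpha>(1) by (rule mult_left_mono)
  then have 1: "- \<alpha> * ph - 2 * f - real k * s - l * e
      \<le> - 2 * ?\<epsilon> * f - (1 - \<alpha>) * (real k * s + l * e)
        - 2 * \<alpha> * (real k + 2) * A - 2 * \<alpha> * (l + 2) * B - 4 * \<alpha> * (ls + lt)"
    by (simp add: algebra_simps)
  have lsum: "ls + lt = y b" using lst by auto
  \<comment> \<open>A convex combination of the two lower bounds of \<open>f\<close>, with weights \<open>1/4\<close> and \<open>3/4\<close>; the larger weight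
    goes to the bound with \<open>y b\<close> if \<open>y b \<ge> 0\<close>, and to the other bound if not.\<close>
  have f4: "(s + e) / 4 + y b + \<bar>y b\<bar> / 2 \<le> f"
  proof -
    have "s + e + 4 * y b + 2 * \<bar>y b\<bar> \<le> 4 * f"
      using lst f_ge s0 e0 by (cases "y b \<ge> 0"; elim disjE conjE; simp)
    then show ?thesis by (simp add: field_simps)
  qed
  have "2 * ?\<epsilon> * ((s + e) / 4 + y b + \<bar>y b\<bar> / 2) \<le> 2 * ?\<epsilon> * f"
    using f4 \<alpha> by (intro mult_left_mono) auto
  then have 2: "- 2 * ?\<epsilon> * f \<le> - (?\<epsilon> / 2) * (s + e) - 2 * ?\<epsilon> * y b - ?\<epsilon> * \<bar>y b\<bar>"
    by (simp add: field_simps)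
  have "\<kappa> * \<bar>y b\<bar> \<le> ?\<epsilon> * \<bar>y b\<bar>" using \<kappa>1 half by (intro mult_right_mono) auto
  then have "- \<alpha> * ph - 2 * f - real k * s - l * e
      \<le> (- ((1 - \<alpha>) * real k + ?\<epsilon> / 2) * s - 2 * \<alpha> * (real k + 2) * A)
        + (- ((1 - \<alpha>) * l + ?\<epsilon> / 2) * e - 2 * \<alpha> * (l + 2) * B) + (- 2 * y b - \<kappa> * \<bar>y b\<bar>)"
    using 1 2 unfolding lsum by (simp add: field_simps)
  also have "\<dots> \<le> (\<Sum>j\<in>J1. - 2 * y j - \<kappa> * \<bar>y j\<bar>) + (\<Sum>j\<in>J2. - 2 * y j - \<kappa> * \<bar>y j\<bar>) + (- 2 * y b - \<kappa> * \<bar>y b\<bar>)"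
    using bl1 bl2 by linarith
  also have "\<dots> = (\<Sum>j\<in>coord_set m c. - 2 * y j - \<kappa> * \<bar>y j\<bar>)"
    unfolding I(1) using fin I(2,3) by (simp add: sum.union_disjoint)
  finally show ?thesis by (simp add: y_def f_def s_def e_def l_def)
qed

section \<open>Integration over the blow-up\<close>

lemma simple_integral_le_sum:
  fixes M :: "'a measure" and N :: "'i \<Rightarrow> 'a measure"
  assumes sf: "simple_function M g" and sets: "\<And>c. c \<in> C \<Longrightarrow> sets (N c) = sets M"
    and le: "\<And>A. A \<in> sets M \<Longrightarrow> emeasure M A \<le> (\<Sum>c\<in>C. emeasure (N c) A)"
  shows "integral\<^sup>S M g \<le> (\<Sum>c\<in>C. integral\<^sup>N (N c) g)"
proof -
  have sp: "space (N c) = space M" if "c \<in> C" for c using sets[OF that] by (rule sets_eq_imp_space_eq)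
  have sf': "simple_function (N c) g" if "c \<in> C" for c
    using sf sets[OF that] sp[OF that] by (simp add: simple_function_def)
  have "integral\<^sup>S M g \<le> (\<Sum>x\<in>g ` space M. x * (\<Sum>c\<in>C. emeasure (N c) (g -` {x} \<inter> space M)))"
    unfolding simple_integral_def
    using simple_functionD(2)[OF sf] by (intro sum_mono mult_left_mono le) auto
  also have "\<dots> = (\<Sum>c\<in>C. \<Sum>x\<in>g ` space M. x * emeasure (N c) (g -` {x} \<inter> space M))"
    unfolding sum_distrib_left by (rule sum.swap)
  also have "\<dots> = (\<Sum>c\<in>C. integral\<^sup>S (N c) g)"
    by (intro sum.cong) (simp_all add: simple_integral_def sp)
  also have "\<dots> = (\<Sum>c\<in>C. integral\<^sup>N (N c) g)"
    using sf' by (intro sum.cong) (simp_all add: nn_integral_eq_simple_integral)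
  finally show ?thesis .
qed

text \<open>A measure constructed from a set function is dominated by it, whether or not the set function
  is countably additive.\<close>

lemma emeasure_measure_of_le: "emeasure (measure_of \<Omega> M \<mu>) A \<le> \<mu> A"
  unfolding emeasure_measure_of_conv by simp

lemma finite_charts: "finite (charts m k)"
proof (rule finite_subset)
  show "charts m k \<subseteq> {0..k} \<times> {k+1..m} \<times> ({0..k} \<union> {k+1..m})"
    by (auto simp: charts_def)
qed auto

lemma finite_coord_set: "finite (coord_set m c)"
  by (cases c) (simp add: coord_set_def)

text \<open>
  The partition of unity is at most \<open>1\<close> and is dropped. This needs neither its measurability nor that of
  the density of the volume, as the bounds \<open>D c\<close> are measurable.
\<close>

lemma integral_blowup_le:
  fixes f :: "triple \<Rightarrow> ennreal"
  assumes D[measurable]: "\<And>c. c \<in> charts m k \<Longrightarrow> D c \<in> borel_measurable (Pi\<^sub>M (coord_set m c) (\<lambda>_. lborel))"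
    and dens: "\<And>c w. c \<in> charts m k \<Longrightarrow> w \<in> coord_space (coord_set m c) \<Longrightarrow>
      ennreal (Re (det_on (coord_set m c) (ghat m k c w))) \<le> D c w"
    and H: "\<And>c w. c \<in> charts m k \<Longrightarrow> w \<in> coord_space (coord_set m c) \<Longrightarrow> D c w * f (chart m k c w) \<le> H c w"
  shows "integral\<^sup>N (blowup_volume m k) f
    \<le> (\<Sum>c\<in>charts m k. integral\<^sup>N (Pi\<^sub>M (coord_set m c) (\<lambda>_. lborel)) (H c))"
proof -
  let ?P = "\<lambda>c. Pi\<^sub>M (coord_set m c) (\<lambda>_. lborel :: complex measure)"
  let ?V = "blowup_volume m k"
  let ?S = "{A. A \<subseteq> blowup m k \<and> (\<forall>c\<in>charts m k.
        chart m k c -` A \<inter> coord_space (coord_set m c) \<in> sets (?P c))}"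
  let ?N = "\<lambda>c. distr (density (?P c) (D c)) ?V (chart m k c)"
  have sp: "space (?P c) = coord_space (coord_set m c)" for c
    by (simp add: space_PiM coord_space_def)
  have meas: "chart m k c \<in> measurable (?P c) ?V" if c: "c \<in> charts m k" for c
    unfolding blowup_volume_def
  proof (rule measurable_measure_of)
    show "?S \<subseteq> Pow (blowup m k)" by auto
    show "chart m k c \<in> space (?P c) \<rightarrow> blowup m k" using chart_in_blowup[OF c] by auto
    show "chart m k c -` A \<inter> space (?P c) \<in> sets (?P c)" if "A \<in> ?S" for A
      using that c unfolding sp by blast
  qed
  have le: "emeasure ?V A \<le> (\<Sum>c\<in>charts m k. emeasure (?N c) A)" if A: "A \<in> sets ?V" for A
  proof -
    have "emeasure ?V A \<le> (\<Sum>c\<in>charts m k. \<integral>\<^sup>+ w. indicator A (chart m k c w)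
          * ennreal (Re (det_on (coord_set m c) (ghat m k c w))
                       / real (chart_multiplicity m k (chart m k c w))) \<partial>?P c)"
      unfolding blowup_volume_def by (rule emeasure_measure_of_le)
    also have "\<dots> \<le> (\<Sum>c\<in>charts m k. \<integral>\<^sup>+ w. D c w * indicator (chart m k c -` A \<inter> space (?P c)) w \<partial>?P c)"
    proof (intro sum_mono nn_integral_mono)
      fix c w assume c: "c \<in> charts m k" and w: "w \<in> space (?P c)"
      have "c \<in> {c' \<in> charts m k. chart m k c w \<in> chart m k c' ` coord_space (coord_set m c')}"
        using c w sp by blast
      then have "1 \<le> chart_multiplicity m k (chart m k c w)"
        unfolding chart_multiplicity_def using finite_charts
        by (metis (no_types, lifting) One_nat_def Suc_leI card_gt_0_iff empty_iff finite_subset mem_Collect_eq subsetI)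
      then have n: "1 \<le> real (chart_multiplicity m k (chart m k c w))" by simp
      have "ennreal (d / n) \<le> ennreal d" if "1 \<le> n" for d n :: real
      proof (cases "d \<ge> 0")
        case True
        then show ?thesis using that by (intro ennreal_leI) (simp add: divide_le_eq mult_le_cancel_left1)
      next
        case False
        then have "d / n \<le> 0" using that by (simp add: divide_nonpos_pos)
        then show ?thesis by (simp add: ennreal_neg)
      qed
      from this[OF n] have "ennreal (Re (det_on (coord_set m c) (ghat m k c w)) / real (chart_multiplicity m k (chart m k c w))) \<le> D c w"
        using dens[OF c] w sp by (metis order_trans)
      then show "indicator A (chart m k c w)
          * ennreal (Re (det_on (coord_set m c) (ghat m k c w)) / real (chart_multiplicity m k (chart m k c w)))
        \<le> D c w * indicator (chart m k c -` A \<inter> space (?P c)) w"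
        using w by (auto simp: indicator_def)
    qed
    also have "\<dots> = (\<Sum>c\<in>charts m k. emeasure (?N c) A)"
    proof (rule sum.cong[OF refl])
      fix c assume c: "c \<in> charts m k"
      have "chart m k c -` A \<inter> space (?P c) \<in> sets (?P c)"
        using measurable_sets[OF meas[OF c] A] .
      then show "(\<integral>\<^sup>+ w. D c w * indicator (chart m k c -` A \<inter> space (?P c)) w \<partial>?P c) = emeasure (?N c) A"
        using meas[OF c] A D[OF c] by (subst emeasure_distr) (auto simp: emeasure_density)
    qed
    finally show ?thesis .
  qed
  show ?thesis
    unfolding nn_integral_def[of ?V]
  proof (rule SUP_least)
    fix g assume "g \<in> {g. simple_function ?V g \<and> g \<le> f}"
    then have g: "simple_function ?V g" "\<And>y. g y \<le> f y" by (auto simp: le_fun_def)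
    have gm: "g \<in> borel_measurable ?V" using g(1) by (rule borel_measurable_simple_function)
    have "integral\<^sup>S ?V g \<le> (\<Sum>c\<in>charts m k. integral\<^sup>N (?N c) g)"
      by (rule simple_integral_le_sum[OF g(1) _ le]) auto
    also have "\<dots> \<le> (\<Sum>c\<in>charts m k. integral\<^sup>N (?P c) (H c))"
    proof (rule sum_mono)
      fix c assume c: "c \<in> charts m k"
      have "integral\<^sup>N (?N c) g = (\<integral>\<^sup>+ w. g (chart m k c w) \<partial>density (?P c) (D c))"
        using meas[OF c] gm by (intro nn_integral_distr) auto
      also have "\<dots> = (\<integral>\<^sup>+ w. D c w * g (chart m k c w) \<partial>?P c)"
        using measurable_compose[OF meas[OF c] gm] D[OF c] by (intro nn_integral_density)
      also have "\<dots> \<le> integral\<^sup>N (?P c) (H c)"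
      proof (rule nn_integral_mono)
        fix w assume w: "w \<in> space (?P c)"
        have "D c w * g (chart m k c w) \<le> D c w * f (chart m k c w)"
          using g(2) by (intro mult_left_mono) auto
        also have "\<dots> \<le> H c w" using H[OF c] w sp by blast
        finally show "D c w * g (chart m k c w) \<le> H c w" .
      qed
      finally show "integral\<^sup>N (?N c) g \<le> integral\<^sup>N (?P c) (H c)" .
    qed
    finally show "integral\<^sup>S ?V g \<le> (\<Sum>c\<in>charts m k. integral\<^sup>N (?P c) (H c))" .
  qed
qed

lemma lift_measurable:
  assumes "c \<in> charts m k"
  shows "(\<lambda>w. lift_\<zeta> m k c w j) \<in> borel_measurable (Pi\<^sub>M (coord_set m c) (\<lambda>_. lborel))"
    "(\<lambda>w. lift_\<eta> m k c w j) \<in> borel_measurable (Pi\<^sub>M (coord_set m c) (\<lambda>_. lborel))"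
    "(\<lambda>w. lift_z m k c w j) \<in> borel_measurable (Pi\<^sub>M (coord_set m c) (\<lambda>_. lborel))"
proof -
  obtain i p r where cc: "c = (i, p, r)" by (cases c)
  have ip: "i \<in> {0..k}" "p \<in> {k+1..m}" "r = i \<or> r = p" using assms by (auto simp: charts_def cc)
  let ?P = "Pi\<^sub>M (coord_set m c) (\<lambda>_. lborel :: complex measure)"
  have co: "(\<lambda>w. w j) \<in> borel_measurable ?P" if "j \<in> coord_set m c" for j
    using measurable_component_singleton[OF that, of "\<lambda>_. lborel :: complex measure"]
      measurable_cong_sets[OF refl sets_lborel, of ?P] by simp
  have upd: "(\<lambda>w. (w(a := 1)) j) \<in> borel_measurable ?P" if "j \<in> coord_set m c \<or> j = a" for a j
    using that co by (cases "j = a") auto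
  show \<zeta>: "(\<lambda>w. lift_\<zeta> m k c w j) \<in> borel_measurable ?P" for j
  proof (cases "j \<in> {0..k}")
    case True
    then have "j \<in> coord_set m c \<or> j = i" using ip by (auto simp: coord_set_def cc)
    from upd[OF this] show ?thesis using True by (simp add: cc lift_\<zeta>_def)
  qed (simp add: cc lift_\<zeta>_def)
  show \<eta>: "(\<lambda>w. lift_\<eta> m k c w j) \<in> borel_measurable ?P" for j
  proof (cases "j \<in> {k+1..m}")
    case True
    then have "j \<in> coord_set m c \<or> j = p" using ip by (auto simp: coord_set_def cc)
    from upd[OF this] show ?thesis using True by (simp add: cc lift_\<eta>_def)
  next
    case False
    then have "(\<lambda>w. lift_\<eta> m k c w j) = (\<lambda>w. 0)" by (auto simp: cc lift_\<eta>_def)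
    then show ?thesis by simp
  qed
  have "(\<lambda>w. (w(r := 1)) i) \<in> borel_measurable ?P" "(\<lambda>w. (w(r := 1)) p) \<in> borel_measurable ?P"
    by (rule upd, use ip in \<open>force simp: coord_set_def cc\<close>)+
  then show "(\<lambda>w. lift_z m k c w j) \<in> borel_measurable ?P"
    using \<zeta> \<eta> unfolding cc lift_z_def prod.case by (intro borel_measurable_add borel_measurable_times) (simp_all add: cc)
qed

lemma N_measurable:
  assumes "c \<in> charts m k"
  shows "N\<zeta> m k c \<in> borel_measurable (Pi\<^sub>M (coord_set m c) (\<lambda>_. lborel))"
    "N\<eta> m k c \<in> borel_measurable (Pi\<^sub>M (coord_set m c) (\<lambda>_. lborel))"
    "Nz m k c \<in> borel_measurable (Pi\<^sub>M (coord_set m c) (\<lambda>_. lborel))"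
  unfolding N\<zeta>_def[abs_def] N\<eta>_def[abs_def] Nz_def[abs_def]
  by (intro borel_measurable_sum borel_measurable_power borel_measurable_norm[THEN measurable_compose[rotated]] lift_measurable[OF assms]
      measurable_compose[OF _ borel_measurable_norm])+

lemma prod_le_ennreal:
  fixes f g :: "'a \<Rightarrow> ennreal"
  assumes "\<And>j. j \<in> I \<Longrightarrow> f j \<le> g j"
  shows "(\<Prod>j\<in>I. f j) \<le> (\<Prod>j\<in>I. g j)"
  using assms by (induction I rule: infinite_finite_induct) (auto intro!: mult_mono)

theorem mainTheorem6:
  fixes m k :: nat and \<alpha> :: real
  assumes "m \<ge> 2" and "k \<in> {1..m - 1}" and "\<alpha> < 1 / 2"
  shows "\<exists>C::real. \<forall>\<phi> :: triple \<Rightarrow> real.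
    smooth_on_blowup m k \<phi> \<longrightarrow> admissible m k \<phi> \<longrightarrow> G_invariant m k \<phi> \<longrightarrow>
    (SUP y\<in>blowup m k. ereal (\<phi> y)) = 0 \<longrightarrow>
    (\<integral>\<^sup>+ y. ennreal (exp (- \<alpha> * \<phi> y)) \<partial>(blowup_volume m k)) \<le> ennreal C"
proof -
  have km: "k < m" using assms by auto
  \<comment> \<open>As \<open>\<phi> \<le> 0\<close>, a negative \<open>\<alpha>\<close> may be replaced by zero.\<close>
  define \<beta> where "\<beta> = max \<alpha> 0"
  have \<beta>: "0 \<le> \<beta>" "\<beta> < 1 / 2" "\<alpha> \<le> \<beta>" using assms(3) by (auto simp: \<beta>_def)
  define \<kappa> where "\<kappa> = (1 - 2 * \<beta>) / (2 * real m)"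
  have "0 < \<kappa>" unfolding \<kappa>_def using \<beta> km by (intro divide_pos_pos) auto
  moreover have "\<kappa> < 2"
  proof -
    have "1 - 2 * \<beta> < 2 * (2 * real m)" using \<beta> km by linarith
    then show ?thesis using km by (simp add: \<kappa>_def divide_less_eq)
  qed
  ultimately have \<kappa>: "0 < \<kappa>" "\<kappa> < 2" .
  define M :: real where "M = fact m * (m * (4 + 2 * real k + 2 * real (m - k - 1))) ^ m * (real m)\<^sup>2"
  have M: "M > 0" unfolding M_def using km by (intro mult_pos_pos zero_less_power) auto
  define d where "d c w = M / ((Nz m k c w)\<^sup>2 * N\<zeta> m k c w ^ k * N\<eta> m k c w ^ (m - k - 1))" for c w
  define H where "H c w = ennreal M * (\<Prod>j\<in>coord_set m c. shell_majorant \<kappa> (w j))" for c :: chart_index and w :: cvec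
  let ?P = "\<lambda>c. Pi\<^sub>M (coord_set m c) (\<lambda>_. lborel :: complex measure)"
  define C where "C = (\<Sum>c\<in>charts m k. integral\<^sup>N (?P c) (H c))"
  have Hm: "(\<lambda>w. \<Prod>j\<in>coord_set m c. shell_majorant \<kappa> (w j)) \<in> borel_measurable (?P c)" for c
    by measurable
  have "integral\<^sup>N (?P c) (H c) < \<infinity>" for c
    unfolding H_def nn_integral_cmult[OF Hm]
    using product_majorant_integral[OF finite_coord_set \<kappa>(1), of m c] by (simp add: ennreal_mult_less_top)
  then have Cfin: "C < \<infinity>" unfolding C_def using finite_charts by (simp add: ennreal_sum_less_top)
  have d_measurable: "(\<lambda>w. ennreal (d c w)) \<in> borel_measurable (?P c)" if "c \<in> charts m k" for c
    using N_measurable[OF that] unfolding d_def by measurable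
  have dens: "ennreal (Re (det_on (coord_set m c) (ghat m k c w))) \<le> ennreal (d c w)" if "c \<in> charts m k" for c w
    using cmod_det_ghat_le[OF km that, of w] complex_Re_le_cmod[of "det_on (coord_set m c) (ghat m k c w)"]
    unfolding d_def M_def by (intro ennreal_leI) linarith
  have "(\<integral>\<^sup>+ y. ennreal (exp (- \<alpha> * \<phi> y)) \<partial>(blowup_volume m k)) \<le> C"
    if smooth: "smooth_on_blowup m k \<phi>" and adm: "admissible m k \<phi>" and inv: "G_invariant m k \<phi>"
      and sup: "(SUP y\<in>blowup m k. ereal (\<phi> y)) = 0" for \<phi>
    unfolding C_def
  proof (rule integral_blowup_le[OF d_measurable dens])
    fix c w assume c: "c \<in> charts m k"
    let ?I = "coord_set m c"
    have "ereal (\<phi> (chart m k c w)) \<le> (SUP y\<in>blowup m k. ereal (\<phi> y))"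
      by (rule SUP_upper) (rule chart_in_blowup[OF c])
    then have neg: "\<phi> (chart m k c w) \<le> 0" by (simp add: sup)
    show "ennreal (d c w) * ennreal (exp (- \<alpha> * \<phi> (chart m k c w))) \<le> H c w"
    proof (cases "\<forall>j\<in>?I. w j \<noteq> 0")
      case True
      let ?x = "\<lambda>j. ln (cmod (lift_z m k c w j))"
      let ?g = "\<lambda>j. - 2 * ln (cmod (w j)) - \<kappa> * \<bar>ln (cmod (w j))\<bar>"
      note N = N_pos[OF c, of w]
      have "- \<beta> * log_function m k \<phi> ?x - 2 * ln (Nz m k c w) - real k * ln (N\<zeta> m k c w)
          - real (m - k - 1) * ln (N\<eta> m k c w) \<le> (\<Sum>j\<in>?I. ?g j)"
        by (rule integrand_exponent[OF km c True \<beta>(1,2) \<kappa>_def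
            log_function_lower_bound[OF km smooth adm inv sup] refl])
      moreover have "\<phi> (chart m k c w) = log_function m k \<phi> ?x"
        by (rule chart_eq_log_function[OF inv km c True])
      moreover have "- \<alpha> * \<phi> (chart m k c w) \<le> - \<beta> * \<phi> (chart m k c w)"
        using \<beta>(3) neg by (simp add: mult_right_mono_neg)
      ultimately have "- \<alpha> * \<phi> (chart m k c w) - 2 * ln (Nz m k c w) - real k * ln (N\<zeta> m k c w)
          - real (m - k - 1) * ln (N\<eta> m k c w) \<le> (\<Sum>j\<in>?I. ?g j)" by simp
      then have "exp (- \<alpha> * \<phi> (chart m k c w) - 2 * ln (Nz m k c w) - real k * ln (N\<zeta> m k c w)
          - real (m - k - 1) * ln (N\<eta> m k c w)) \<le> (\<Prod>j\<in>?I. exp (?g j))"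
        by (simp only: exp_le_cancel_iff flip: exp_sum[OF finite_coord_set])
      moreover have "exp (- \<alpha> * \<phi> (chart m k c w) - 2 * ln (Nz m k c w) - real k * ln (N\<zeta> m k c w)
          - real (m - k - 1) * ln (N\<eta> m k c w))
        = exp (- \<alpha> * \<phi> (chart m k c w)) / ((Nz m k c w)\<^sup>2 * N\<zeta> m k c w ^ k * N\<eta> m k c w ^ (m - k - 1))"
        using N by (simp add: exp_diff exp_of_nat_mult exp_double del: of_nat_diff)
      ultimately have "M * (exp (- \<alpha> * \<phi> (chart m k c w)) / ((Nz m k c w)\<^sup>2 * N\<zeta> m k c w ^ k * N\<eta> m k c w ^ (m - k - 1)))
          \<le> M * (\<Prod>j\<in>?I. exp (?g j))"
        using M by (intro mult_left_mono) auto
      then have "d c w * exp (- \<alpha> * \<phi> (chart m k c w)) \<le> M * (\<Prod>j\<in>?I. exp (?g j))"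
        by (simp add: d_def)
      moreover have "d c w \<ge> 0" using N M by (simp add: d_def)
      ultimately have "ennreal (d c w) * ennreal (exp (- \<alpha> * \<phi> (chart m k c w)))
          \<le> ennreal M * (\<Prod>j\<in>?I. ennreal (exp (?g j)))"
        using M by (simp add: ennreal_leI prod_ennreal prod_nonneg flip: ennreal_mult)
      also have "\<dots> \<le> H c w"
      proof -
        have "ennreal (exp (?g j)) \<le> shell_majorant \<kappa> (w j)" if "j \<in> ?I" for j
          using True that \<kappa> by (intro shell_majorant_ge) blast+
        then show ?thesis
          unfolding H_def by (intro mult_left_mono prod_le_ennreal zero_le)
      qed
      finally show ?thesis .
    next
      case False
      then obtain j where j: "j \<in> ?I" "w j = 0" by blast
      then have "\<exists>j\<in>?I. shell_majorant \<kappa> (w j) = \<infinity>"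
        using shell_majorant_zero[OF \<kappa>(2)] by (intro bexI[of _ j]) simp_all
      then have "(\<Prod>j\<in>?I. shell_majorant \<kappa> (w j)) = \<infinity>"
        using shell_majorant_pos[of \<kappa>] finite_coord_set[of m c]
        by (simp add: ennreal_prod_eq_top less_le)
      then show ?thesis using M by (simp add: H_def ennreal_mult_top)
    qed
  qed
  moreover have "C = ennreal (enn2real C)" using Cfin by simp
  ultimately show ?thesis by metis
qed

end
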